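(* Assume that $\tau(t)>-\infty$ almost surely for all $t\in\mathbb{Z}$. Then the process $(\zeta_t,\,t\in\mathbb{Z})$ is a stationary Gibbs sampler related to $g$. The distribution of $\zeta_t$ at each time $t$ is the distribution with density $g$ in $\mathcal{B}$. This distribution is the unique invariant measure for the Gibbs sampler dynamics, and for all integers $s\le t$ $$\sup_{\zeta\in\mathcal{B}}\mathbb{P}\big(\zeta^{\zeta}_{[s,t]}\neq\zeta_t\big)\le\mathbb{P}(\tau(t)<s),$$ where $\zeta^{\zeta}_{[s,t]}$ is the process starting with configuration $\zeta$ at time $s$. (The objects $\tau(t)$, $\zeta_t$, $\zeta^\zeta_{[s,t]}$ and the Gibbs sampler related to $g$ are defined in the context.)
   Context: Setting. Let $d\ge 2$ and $\mathcal{B}=B(1)\times\cdots\times B(d)$ with $B(k)=[a_k,b_k]\subset\mathbb{R}$, $a_k<b_k$, bounded intervals. Let $g$ be a probability density with support in $\mathcal{B}$. For $\mathbf{x}=(x_1,\dots,x_d)\in\mathcal{B}$ and $y\in B(k)$ let $$g_k(y|\mathbf{x})=\frac{g(x_1,\dots,x_{k-1},y,x_{k+1},\dots,x_d)}{\int_{B(k)}g(x_1,\dots,x_{k-1},z,x_{k+1},\dots,x_d)\,dz},\qquad G_k(x|\mathbf{x})=\int_{a_k}^x g_k(z|\mathbf{x})\,dz ,$$ where it is understood that these conditional densities, and the minima and integrals below, are well defined (and measurable where needed). Gibbs sampler related to $g$. This is the Markov chain on $\mathcal{B}$ that evolves as follows: given the past up to time $t-1$, with configuration $\mathbf{x}$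 at time $t-1$, a site $\kappa(t)$ is chosen uniformly in $\{1,\dots,d\}$ independently of everything else; the coordinates $i\ne\kappa(t)$ are left unchanged, and for $k=\kappa(t)$ the $k$th coordinate is replaced by a value chosen with density $g_k(\cdot|\mathbf{x})$ on $B(k)$. Boxes and coupling functions. For a box $\xi=\xi(1)\times\cdots\times\xi(d)\subset\mathcal{B}$, with each $\xi(i)\subset B(i)$ a closed bounded interval (possibly a single point), define $$R_k(x|\xi)=\int_{a_k}^{x}\Big(\min_{\mathbf{x}\in\xi}g_k(y|\mathbf{x})\Big)dy,\quad x\in B(k),\qquad R_k(\xi)=R_k(b_k|\xi).$$ For a nondecreasing function $G$, $G^{-1}$ denotes the generalized inverse, defined by $G(x)\ge y\Leftrightarrow x\ge G^{-1}(y)$. Randomness. $(U_t,\,t\in\mathbb{Z})$ are independent uniform random variables in $[0,1]$, and $(\kappa(t),\,t\in\mathbb{Z})$ are independent uniform random variables in $\{1,\dots,d\}$, independent of $(U_t)$. Box-valued processes. For $s\in\mathbb{Z}$ set $R_{[s,s]}=0$, $R_{[s,s]}(x)=0$, $D_{[s,s]}(x)=0$, $\eta_{[s,s]}=\mathcal{B}$. Inductively in $t-s\ge1$, for $x\in B(\kappa(t))$, set $$R_{[s,t]}=R_{\kappa(t)}(\eta_{[s,t-1]}),\quad R_{[s,t]}(x)=R_{\kappa(t)}(x|\eta_{[s,t-1]}),\quad D_{[s,t]}(x)=R_{[s+1,t]}+R_{[s,t]}(x)-R_{[s+1,t]}(x),$$ and define the box $\eta_{[s,t]}$ by $\eta_{[s,t]}(k)=\eta_{[s,t-1]}(k)$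 if $k\ne\kappa(t)$, and for $k=\kappa(t)$: - $\eta_{[s,t]}(k)=\eta_{[s+1,t]}(k)$ if $U_t\le R_{[s+1,t]}$; - $\eta_{[s,t]}(k)$ is the point $D_{[s,t]}^{-1}(U_t)$ if $R_{[s+1,t]}<U_t\le R_{[s,t]}$; - $\eta_{[s,t]}(k)=B(k)$ if $U_t>R_{[s,t]}$. Coupling time and stationary process. Let $$\tau(t)=\max\{s<t:\ \eta_{[s,t]}(k)\text{ is a point for all }k\},$$ with $\tau(t)=-\infty$ if there is no such $s$. When $\tau(t)>-\infty$ almost surely for all $t$, define $\zeta_t=\eta_{[\tau(t),t]}\in\mathcal{B}$ (identifying a one-point box with its point). Equivalently (a.s.), $\zeta_t(k)=\zeta_{t-1}(k)$ if $k\neq\kappa(t)$, and $\zeta_t(k)=\sum_{n\le t-1}D_{[n,t]}^{-1}(U_t)\,\mathbf{1}\{R_{[n+1,t]}<U_t\le R_{[n,t]}\}$ if $k=\kappa(t)$. Process started from $\zeta$ at time $s$. Let $\hat G_{[s,t]}(x|\zeta)=R_{[s,t]}+G_{\kappa(t)}(x|\zeta)-R_{[s,t]}(x)$. For $\zeta\in\mathcal{B}$ set $\zeta^\zeta_{[s,s]}=\zeta$ and, for $t>s$, $\zeta^\zeta_{[s,t]}(k)=\zeta^\zeta_{[s,t-1]}(k)$ if $k\ne\kappa(t)$, while for $k=\kappa(t)$ $$\zeta^\zeta_{[s,t]}(k)=\sum_{n=s}^{t-1}\mathbf{1}\{R_{[n+1,t]}<U_t\le R_{[n,t]}\}\,D_{[n,t]}^{-1}(U_t)+\mathbf{1}\{U_t>R_{[s,t]}\}\,\hat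 G_{[s,t]}^{-1}\big(U_t\,\big|\,\zeta^\zeta_{[s,t-1]}\big).$$ *)

theory Defs
  imports "HOL-Probability.Probability" "HOL-Library.Extended"
begin

section \<open>Conditional densities and coupling functions\<close>

text \<open>
  Sites are the elements of a finite type \<^typ>\<open>'n\<close>; the state space is \<^term>\<open>cbox a b\<close>, with
  \<open>B(k) = {a$k..b$k}\<close>. A box is given by the family of its sides \<open>\<xi> :: 'n \<Rightarrow> real set\<close>.
\<close>

definition upd :: "real^'n \<Rightarrow> 'n \<Rightarrow> real \<Rightarrow> real^'n" where
  "upd x k y = (\<chi> i. if i = k then y else x $ i)"

definition box_of :: "('n \<Rightarrow> real set) \<Rightarrow> (real^'n) set" where
  "box_of \<xi> = {x. \<forall>i. x $ i \<in> \<xi> i}"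

text \<open>
  The generalized inverse of a nondecreasing \<open>G\<close> on \<open>[l, r]\<close> is the point \<open>z\<close> of \<open>[l, r]\<close> with
  \<open>G x \<ge> y \<longleftrightarrow> x \<ge> z\<close>. It exists and is unique if \<open>G\<close> is right-continuous and \<open>y \<le> G r\<close>.
\<close>
definition gen_inv :: "real \<Rightarrow> real \<Rightarrow> (real \<Rightarrow> real) \<Rightarrow> real \<Rightarrow> real" where
  "gen_inv l r G y = (THE z. z \<in> {l..r} \<and> (\<forall>x\<in>{l..r}. G x \<ge> y \<longleftrightarrow> x \<ge> z))"

context
  fixes a b :: "real^'n" and g :: "real^'n \<Rightarrow> real"
begin

definition cond_dens :: "'n \<Rightarrow> real \<Rightarrow> real^'n \<Rightarrow> real" where
  "cond_dens k y x = g (upd x k y) / (LBINT z:{a$k..b$k}. g (upd x k z))"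

definition cond_cdf :: "'n \<Rightarrow> real \<Rightarrow> real^'n \<Rightarrow> real" where
  "cond_cdf k x v = (LBINT z:{a$k..x}. cond_dens k z v)"

text \<open>
  The infimum below is a minimum under the attainment clause of \<open>conditionals_ok\<close>.
\<close>
definition min_dens :: "'n \<Rightarrow> real \<Rightarrow> ('n \<Rightarrow> real set) \<Rightarrow> real" where
  "min_dens k y \<xi> = (INF x\<in>box_of \<xi>. cond_dens k y x)"

definition R_fun :: "'n \<Rightarrow> real \<Rightarrow> ('n \<Rightarrow> real set) \<Rightarrow> real" where
  "R_fun k x \<xi> = (LBINT y:{a$k..x}. min_dens k y \<xi>)"

definition density_on_box :: bool where
  "density_on_box \<longleftrightarrow>
     (\<forall>k. a$k < b$k) \<and> g \<in> borel_measurable borel \<and> (\<forall>x. 0 \<le> g x) \<and>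
     (\<forall>x. x \<notin> cbox a b \<longrightarrow> g x = 0) \<and> (\<integral>\<^sup>+x. ennreal (g x) \<partial>lborel) = 1"

text \<open>
  The standing convention that the conditional densities, minima and integrals are well defined
  and measurable: the normalizing integrals are finite and positive at every point of the state
  space, the minima over closed boxes (given by their lower and upper corners \<open>l\<close>, \<open>u\<close>) are
  attained, and they depend measurably on the box and on \<open>y\<close>.
  All of this holds, for instance, if \<open>g\<close> is continuous and positive on \<^term>\<open>cbox a b\<close>.
\<close>
definition conditionals_ok :: bool where
  "conditionals_ok \<longleftrightarrow>
     (\<forall>k. \<forall>x\<in>cbox a b. set_integrable lborel {a$k..b$k} (\<lambda>z. g (upd x k z)) \<and>
        0 < (LBINT z:{a$k..b$k}. g (upd x k z))) \<and>
     (\<forall>k. \<forall>y\<in>{a$k..b$k}. \<forall>l u. cbox l u \<noteq> {} \<and> cbox l u \<subseteq> cbox a b \<longrightarrow>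
        (\<exists>x\<in>cbox l u. \<forall>x'\<in>cbox l u. cond_dens k y x \<le> cond_dens k y x')) \<and>
     (\<forall>k. (\<lambda>(l, u, y). min_dens k y (\<lambda>i. {l$i..u$i})) \<in> borel_measurable
        (restrict_space (borel \<Otimes>\<^sub>M borel \<Otimes>\<^sub>M borel)
          {(l, u, y). cbox l u \<noteq> {} \<and> cbox l u \<subseteq> cbox a b \<and> y \<in> {a$k..b$k}}))"


section \<open>Gibbs sampler\<close>

definition site_update_prob :: "'n \<Rightarrow> real^'n \<Rightarrow> (real^'n) set \<Rightarrow> real" where
  "site_update_prob k x C = (LBINT y:{a$k..b$k}. indicator C (upd x k y) * cond_dens k y x)"

definition gibbs_kernel :: "real^'n \<Rightarrow> (real^'n) set \<Rightarrow> real" where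
  "gibbs_kernel x C = (\<Sum>k\<in>UNIV. site_update_prob k x C) / real CARD('n)"

definition gibbs_invariant :: "(real^'n) measure \<Rightarrow> bool" where
  "gibbs_invariant \<mu> \<longleftrightarrow>
     sets \<mu> = sets borel \<and> prob_space \<mu> \<and> measure \<mu> (cbox a b) = 1 \<and>
     (\<forall>C\<in>sets borel. measure \<mu> C = (\<integral>x. gibbs_kernel x C \<partial>\<mu>))"

end

text \<open>The \<open>\<sigma>\<close>-field generated by the random variables \<open>X t\<close>, \<open>t \<in> T\<close>.\<close>
definition sigma_gen :: "'w measure \<Rightarrow> 's measure \<Rightarrow> ('t \<Rightarrow> 'w \<Rightarrow> 's) \<Rightarrow> 't set \<Rightarrow> 'w set set" where
  "sigma_gen M N X T = sigma_sets (space M) {X t -` A \<inter> space M | t A. t \<in> T \<and> A \<in> sets N}"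

text \<open>
  The process \<open>X\<close> evolves as the Gibbs sampler, \<open>\<kappa> t\<close> being the site updated at time \<open>t\<close>:
  given the past \<open>\<kappa> s\<close>, \<open>X s\<close> (\<open>s \<le> t - 1\<close>), the site \<open>\<kappa> t\<close> is uniform, the other coordinates
  are unchanged, and coordinate \<open>k = \<kappa> t\<close> gets a value with density \<open>g\<^sub>k(\<cdot>|X (t - 1))\<close>.
\<close>
definition gibbs_sampler ::
  "real^'n \<Rightarrow> real^'n \<Rightarrow> (real^'n \<Rightarrow> real) \<Rightarrow> 'w measure \<Rightarrow>
   (int \<Rightarrow> 'w \<Rightarrow> 'n) \<Rightarrow> (int \<Rightarrow> 'w \<Rightarrow> real^'n) \<Rightarrow> bool" where
  "gibbs_sampler a b g M \<kappa> X \<longleftrightarrow>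
     (\<forall>t. X t \<in> borel_measurable M \<and> \<kappa> t \<in> measurable M (count_space UNIV)) \<and>
     (\<forall>t. \<forall>\<omega>\<in>space M. X t \<omega> \<in> cbox a b) \<and>
     (\<forall>t k. \<forall>C\<in>sets borel.
        \<forall>A\<in>sigma_sets (space M)
             (sigma_gen M (count_space UNIV) \<kappa> {..t-1} \<union> sigma_gen M borel X {..t-1}).
        measure M (A \<inter> {\<omega> \<in> space M. \<kappa> t \<omega> = k \<and> X t \<omega> \<in> C}) =
        (\<integral>\<omega>. indicator A \<omega> * (site_update_prob a b g k (X (t-1) \<omega>) C / real CARD('n)) \<partial>M))"

definition stationary :: "'w measure \<Rightarrow> (int \<Rightarrow> 'w \<Rightarrow> 's::topological_space) \<Rightarrow> bool" where
  "stationary M X \<longleftrightarrow>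
     (\<forall>h. distr M (PiM UNIV (\<lambda>_. borel)) (\<lambda>\<omega> t. X (t + h) \<omega>) =
          distr M (PiM UNIV (\<lambda>_. borel)) (\<lambda>\<omega> t. X t \<omega>))"


section \<open>Randomness\<close>

definition driving_sequences ::
  "'w measure \<Rightarrow> (int \<Rightarrow> 'w \<Rightarrow> 'n::finite) \<Rightarrow> (int \<Rightarrow> 'w \<Rightarrow> real) \<Rightarrow> bool" where
  "driving_sequences M \<kappa> U \<longleftrightarrow>
     prob_space M \<and>
     prob_space.indep_vars M (\<lambda>_. borel) U UNIV \<and>
     prob_space.indep_vars M (\<lambda>_. count_space UNIV) \<kappa> UNIV \<and>
     prob_space.indep_set M (sigma_gen M borel U UNIV) (sigma_gen M (count_space UNIV) \<kappa> UNIV) \<and>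
     (\<forall>t. distr M borel (U t) = uniform_measure lborel {0..1}) \<and>
     (\<forall>t. distr M (count_space UNIV) (\<kappa> t) = uniform_count_measure UNIV)"


section \<open>Box-valued processes, coupling time and the constructed processes\<close>

context
  fixes a b :: "real^'n" and g :: "real^'n \<Rightarrow> real"
    and \<kappa> :: "int \<Rightarrow> 'w \<Rightarrow> 'n" and U :: "int \<Rightarrow> 'w \<Rightarrow> real"
begin

text \<open>
  \<open>box_R s t \<omega> x\<close>, \<open>box_D s t \<omega> x\<close> and \<open>eta s t \<omega> k\<close> are \<open>R\<^sub>[\<^sub>s\<^sub>,\<^sub>t\<^sub>](x)\<close>, \<open>D\<^sub>[\<^sub>s\<^sub>,\<^sub>t\<^sub>](x)\<close> and
  \<open>\<eta>\<^sub>[\<^sub>s\<^sub>,\<^sub>t\<^sub>](k)\<close>; the constant \<open>R\<^sub>[\<^sub>s\<^sub>,\<^sub>t\<^sub>]\<close> is \<open>box_R s t \<omega>\<close> at the right endpoint of \<open>B(\<kappa>(t))\<close>.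
  Only \<open>s \<le> t\<close> is meaningful; for \<open>t < s\<close> the values of \<open>s = t\<close> are used.
\<close>
function box_R :: "int \<Rightarrow> int \<Rightarrow> 'w \<Rightarrow> real \<Rightarrow> real"
  and box_D :: "int \<Rightarrow> int \<Rightarrow> 'w \<Rightarrow> real \<Rightarrow> real"
  and eta :: "int \<Rightarrow> int \<Rightarrow> 'w \<Rightarrow> 'n \<Rightarrow> real set"
where
  "box_R s t \<omega> x =
     (if t \<le> s then 0 else R_fun a b g (\<kappa> t \<omega>) x (\<lambda>j. eta s (t-1) \<omega> j))"
| "box_D s t \<omega> x =
     (if t \<le> s then 0
      else box_R (s+1) t \<omega> (b $ \<kappa> t \<omega>) + box_R s t \<omega> x - box_R (s+1) t \<omega> x)"
| "eta s t \<omega> k =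
     (if t \<le> s then {a$k..b$k}
      else if k \<noteq> \<kappa> t \<omega> then eta s (t-1) \<omega> k
      else if U t \<omega> \<le> box_R (s+1) t \<omega> (b$k) then eta (s+1) t \<omega> k
      else if U t \<omega> \<le> box_R s t \<omega> (b$k)
        then {gen_inv (a$k) (b$k) (\<lambda>x. box_D s t \<omega> x) (U t \<omega>)}
      else {a$k..b$k})"
  by pat_completeness auto
termination
  by (relation "Wellfounded.measure (\<lambda>p. case p of
        Inl (s, t, _) \<Rightarrow> 3 * nat (t - s)
      | Inr (Inl (s, t, _)) \<Rightarrow> 3 * nat (t - s) + 1
      | Inr (Inr (s, t, _)) \<Rightarrow> 3 * nat (t - s) + 2)") auto

declare box_R.simps [simp del] box_D.simps [simp del] eta.simps [simp del]

abbreviation box_Rtot :: "int \<Rightarrow> int \<Rightarrow> 'w \<Rightarrow> real" where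
  "box_Rtot s t \<omega> \<equiv> box_R s t \<omega> (b $ \<kappa> t \<omega>)"

definition coupled :: "int \<Rightarrow> int \<Rightarrow> 'w \<Rightarrow> bool" where
  "coupled s t \<omega> \<longleftrightarrow> s < t \<and> (\<forall>k. \<exists>p. eta s t \<omega> k = {p})"

definition tau :: "int \<Rightarrow> 'w \<Rightarrow> int extended" where
  "tau t \<omega> = (if \<exists>s. coupled s t \<omega> then Fin (GREATEST s. coupled s t \<omega>) else Minf)"

text \<open>The value \<open>a\<close> on the event \<open>\<tau>(t) = -\<infinity>\<close> is a convention; \<open>zeta\<close> is only used when this event is null.\<close>
definition zeta :: "int \<Rightarrow> 'w \<Rightarrow> real^'n" where
  "zeta t \<omega> = (case tau t \<omega> of Fin s \<Rightarrow> (\<chi> k. the_elem (eta s t \<omega> k)) | _ \<Rightarrow> a)"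

definition G_hat :: "int \<Rightarrow> int \<Rightarrow> 'w \<Rightarrow> real^'n \<Rightarrow> real \<Rightarrow> real" where
  "G_hat s t \<omega> v x = box_Rtot s t \<omega> + cond_cdf a b g (\<kappa> t \<omega>) x v - box_R s t \<omega> x"

function zeta_from :: "real^'n \<Rightarrow> int \<Rightarrow> int \<Rightarrow> 'w \<Rightarrow> real^'n" where
  "zeta_from z s t \<omega> =
     (if t \<le> s then z
      else \<chi> k. if k \<noteq> \<kappa> t \<omega> then zeta_from z s (t-1) \<omega> $ k
        else (\<Sum>n\<in>{s..t-1}.
                of_bool (box_Rtot (n+1) t \<omega> < U t \<omega> \<and> U t \<omega> \<le> box_Rtot n t \<omega>) *
                gen_inv (a$k) (b$k) (box_D n t \<omega>) (U t \<omega>))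
           + of_bool (U t \<omega> > box_Rtot s t \<omega>) *
             gen_inv (a$k) (b$k) (G_hat s t \<omega> (zeta_from z s (t-1) \<omega>)) (U t \<omega>))"
  by pat_completeness auto
termination
  by (relation "Wellfounded.measure (\<lambda>(z, s, t, \<omega>). nat (t - s))") auto

declare zeta_from.simps [simp del]

end

end

theory Submission
  imports Defs
begin

text \<open>
  The idea is to look at a single update with the past frozen. The boxes \<open>\<eta>\<^sub>[\<^sub>s\<^sub>,\<^sub>t\<^sub>]\<close> shrink as the starting
  time \<open>s\<close> decreases (\<open>eta_mono\<close>), so the levels \<open>R\<^sub>[\<^sub>s\<^sub>,\<^sub>t\<^sub>]\<close> increase and the functions \<open>D\<^sub>[\<^sub>s\<^sub>,\<^sub>t\<^sub>]\<close> are
  nondecreasing. If \<open>U\<^sub>t\<close> falls between two consecutive levels, the new coordinate is \<open>D\<^sub>[\<^sub>n\<^sub>,\<^sub>t\<^sub>]\<close> inverted at \<open>U\<^sub>t\<close>;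
  the lengths of the sets of \<open>u\<close> that put this coordinate below \<open>x\<close> telescope to \<open>R\<^sub>[\<^sub>s\<^sub>,\<^sub>t\<^sub>](x)\<close>
  (\<open>selected_law\<close>). Using the levels above \<open>R\<^sub>[\<^sub>s\<^sub>,\<^sub>t\<^sub>]\<close> to complete \<open>R\<^sub>[\<^sub>s\<^sub>,\<^sub>t\<^sub>](x)\<close> to \<open>G\<^sub>k(x|v)\<close>, for a configuration
  \<open>v\<close> in the current box, yields an exact draw from the conditional distribution (\<open>new_value_cdf\<close>,
  \<open>site_step\<close>). So chains started at time \<open>s\<close> from different configurations can be driven by the same
  marks in such a way that all of them perform Gibbs steps and all of them stay in \<open>\<eta>\<^sub>[\<^sub>s\<^sub>,\<^sub>t\<^sub>]\<close>.

  When \<open>\<eta>\<^sub>[\<^sub>s\<^sub>,\<^sub>t\<^sub>]\<close> is a point, that point is \<open>\<zeta>\<^sub>t\<close> and every such chain is there. This is the bound on the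
  probability of disagreement (\<open>zeta_from_in_eta\<close>). For an invariant law \<open>\<mu>\<close>, the chain started from \<open>\<mu>\<close> keeps
  the law \<open>\<mu>\<close>, so \<open>\<mu> C \<le> P(\<zeta>\<^sub>t \<in> C) + P(\<tau>(t) < s)\<close>; as \<open>s\<close> tends to \<open>-\<infinity>\<close> this identifies \<open>\<mu>\<close> with the law of \<open>\<zeta>\<^sub>t\<close>
  (\<open>invariant_unique\<close>). The density \<open>g\<close> is invariant by Fubini in the updated coordinate
  (\<open>target_invariant\<close>). Hence it is the only invariant law and it is the law of \<open>\<zeta>\<^sub>t\<close>, without a separate
  proof that the law of \<open>\<zeta>\<^sub>t\<close> is invariant.

  Once \<open>\<eta>\<^sub>[\<^sub>s\<^sub>,\<^sub>t\<^sub>-\<^sub>1\<^sub>]\<close> is a point, \<open>R\<^sub>[\<^sub>s\<^sub>,\<^sub>t\<^sub>] = 1\<close> and \<open>\<zeta>\<^sub>t\<close> arises from \<open>\<zeta>\<^sub>t\<^sub>-\<^sub>1\<close> by one of these Gibbs steps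
  (\<open>zeta_recursion\<close>); the mark at time \<open>t\<close> being independent of the past, the process is a Gibbs sampler
  (\<open>zeta_gibbs_step\<close>). Stationarity holds because the construction commutes with time shifts.

  The probabilistic statements are proved on the space of mark sequences with its product law. There,
  independence of the mark at time \<open>t\<close> from everything else says that overwriting this mark by an
  independent copy preserves the law (\<open>nn_integral_resample\<close>). The results are carried over to the given
  probability space by the law of the marks (\<open>marks_law\<close>).
\<close>

section \<open>Indefinite integrals and generalized inverses\<close>

lemma upd_nth [simp]: "upd x k y $ i = (if i = k then y else x $ i)"
  by (simp add: upd_def)

lemma borel_measurable_vecI:
  fixes f :: "'a \<Rightarrow> real^'n"
  assumes "\<And>i. (\<lambda>w. f w $ i) \<in> borel_measurable M"
  shows "f \<in> borel_measurable M"
  using assms by (subst borel_measurable_euclidean_space) (auto simp: Basis_vec_def inner_axis)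

lemma borel_measurable_vec_nth [measurable (raw)]:
  fixes f :: "'a \<Rightarrow> real^'n"
  assumes "f \<in> borel_measurable M"
  shows "(\<lambda>w. f w $ i) \<in> borel_measurable M"
  using measurable_compose[OF assms borel_measurable_continuous_onI[of "\<lambda>x. x $ i"]]
  by (simp add: continuous_on_component)

lemma upd_measurable [measurable (raw)]:
  fixes f :: "'a \<Rightarrow> real^'n"
  assumes [measurable]: "f \<in> borel_measurable M" "h \<in> borel_measurable M"
  shows "(\<lambda>w. upd (f w) k (h w)) \<in> borel_measurable M"
  by (rule borel_measurable_vecI) (simp add: if_distrib)

lemma set_integrable_Icc_subset:
  fixes f :: "real \<Rightarrow> real"
  assumes "set_integrable lborel {l..r} f" "l \<le> x" "y \<le> r"
  shows "set_integrable lborel {x..y} f"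
  by (rule set_integrable_subset[OF assms(1)]) (use assms in auto)

lemma indefinite_LBINT_continuous:
  fixes f :: "real \<Rightarrow> real"
  assumes "set_integrable lborel {l..r} f"
  shows "continuous_on {l..r} (\<lambda>x. LBINT z:{l..x}. f z)"
proof -
  have "continuous_on {l..r} (\<lambda>x. integral {l..x} f)"
    by (intro indefinite_integral_continuous_1 set_borel_integral_eq_integral(1) assms)
  moreover have "integral {l..x} f = (LBINT z:{l..x}. f z)" if "x \<in> {l..r}" for x
    by (rule set_borel_integral_eq_integral(2)[symmetric], rule set_integrable_Icc_subset[OF assms])
       (use that in auto)
  ultimately show ?thesis
    by (rule continuous_on_eq)
qed

lemma indefinite_LBINT_diff:
  fixes f :: "real \<Rightarrow> real"
  assumes f: "set_integrable lborel {l..r} f" and "l \<le> x" "x \<le> y" "y \<le> r"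
  shows "(LBINT z:{l..y}. f z) - (LBINT z:{l..x}. f z) = (LBINT z:{x..y}. f z)"
proof -
  have i: "set_integrable lborel {u..v} f" if "l \<le> u" "v \<le> r" for u v
    using set_integrable_Icc_subset[OF f that] .
  have "integral {l..x} f + integral {x..y} f = integral {l..y} f"
    by (rule Henstock_Kurzweil_Integration.integral_combine) (use assms in \<open>auto intro!: set_borel_integral_eq_integral(1) i\<close>)
  moreover have "(LBINT z:{u..v}. f z) = integral {u..v} f" if "l \<le> u" "v \<le> r" for u v
    by (rule set_borel_integral_eq_integral(2)[OF i[OF that]])
  ultimately show ?thesis
    using assms by force
qed

lemma indefinite_LBINT_increment_mono:
  fixes f h :: "real \<Rightarrow> real"
  assumes f: "set_integrable lborel {l..r} f" and h: "set_integrable lborel {l..r} h"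
    and le: "\<And>z. z \<in> {l..r} \<Longrightarrow> f z \<le> h z" and xy: "l \<le> x" "x \<le> y" "y \<le> r"
  shows "(LBINT z:{l..y}. f z) - (LBINT z:{l..x}. f z) \<le> (LBINT z:{l..y}. h z) - (LBINT z:{l..x}. h z)"
  unfolding indefinite_LBINT_diff[OF f xy] indefinite_LBINT_diff[OF h xy]
  by (intro set_integral_mono set_integrable_Icc_subset[OF f] set_integrable_Icc_subset[OF h] le)
     (use xy in auto)

lemma LBINT_singleton [simp]: "(LBINT z:{c}. f z) = (0::real)"
  unfolding set_lebesgue_integral_def
proof (rule integral_eq_zero_AE)
  show "AE z in lborel. indicator {c} z *\<^sub>R f z = 0"
    using AE_lborel_singleton[of c] by eventually_elim (simp add: indicator_def)
qed

text \<open>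
  The inverse is the least element of \<open>{x. y \<le> G x}\<close>: continuity makes this set closed, \<open>y \<le> G r\<close> makes it
  nonempty, and monotonicity makes it an upper part of \<open>[l, r]\<close>.
\<close>
lemma gen_inv_spec:
  assumes lr: "l \<le> r" and cont: "continuous_on {l..r} G" and mono: "mono_on {l..r} G" and y: "y \<le> G r"
  shows gen_inv_in: "gen_inv l r G y \<in> {l..r}"
    and gen_inv_le_iff: "x \<in> {l..r} \<Longrightarrow> gen_inv l r G y \<le> x \<longleftrightarrow> y \<le> G x"
proof -
  define S where "S = {x\<in>{l..r}. y \<le> G x}"
  have cl: "closed S"
  proof -
    have "S = {l..r} \<inter> G -` {y..}" by (auto simp: S_def)
    then show ?thesis using continuous_closed_preimage[OF cont, of "{y..}"] by simp
  qed
  have ne: "S \<noteq> {}" using lr y by (auto simp: S_def)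
  have bb: "bdd_below S" by (rule bdd_belowI[of _ l]) (auto simp: S_def)
  have z: "Inf S \<in> S" by (rule closed_contains_Inf[OF ne bb cl])
  have spec: "\<forall>x\<in>{l..r}. y \<le> G x \<longleftrightarrow> Inf S \<le> x"
  proof
    fix x assume x: "x \<in> {l..r}"
    show "y \<le> G x \<longleftrightarrow> Inf S \<le> x"
    proof
      assume "y \<le> G x" then show "Inf S \<le> x" using x by (intro cInf_lower bb) (auto simp: S_def)
    next
      assume "Inf S \<le> x"
      then have "G (Inf S) \<le> G x" using z x by (intro mono_onD[OF mono]) (auto simp: S_def)
      then show "y \<le> G x" using z by (auto simp: S_def)
    qed
  qed
  have "gen_inv l r G y = Inf S"
    unfolding gen_inv_def
  proof (rule the_equality)
    show "Inf S \<in> {l..r} \<and> (\<forall>x\<in>{l..r}. (y \<le> G x) = (Inf S \<le> x))"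
      using z spec by (auto simp: S_def)
    fix v assume v: "v \<in> {l..r} \<and> (\<forall>x\<in>{l..r}. (y \<le> G x) = (v \<le> x))"
    then have "y \<le> G v" by auto
    then have "Inf S \<le> v" using spec v by auto
    moreover have "v \<le> Inf S" using v z by (auto simp: S_def)
    ultimately show "v = Inf S" by simp
  qed
  then show "gen_inv l r G y \<in> {l..r}" "x \<in> {l..r} \<Longrightarrow> gen_inv l r G y \<le> x \<longleftrightarrow> y \<le> G x"
    using z spec by (auto simp: S_def)
qed

text \<open>
  The sublevel sets of the inverse are the events \<open>y \<le> G c\<close>. Nothing is known about \<^const>\<open>gen_inv\<close> where the
  inverse does not exist, hence the restriction to the event \<open>P\<close>.
\<close>
lemma gen_inv_measurable:
  fixes G :: "'s \<Rightarrow> real \<Rightarrow> real"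
  assumes lr: "l \<le> r" and P: "{w\<in>space M. P w} \<in> sets M"
    and spec: "\<And>w. w \<in> space M \<Longrightarrow> P w \<Longrightarrow>
      continuous_on {l..r} (G w) \<and> mono_on {l..r} (G w) \<and> y w \<le> G w r"
    and G: "\<And>x. x \<in> {l..r} \<Longrightarrow> (\<lambda>w. G w x) \<in> borel_measurable M"
    and y: "y \<in> borel_measurable M"
  shows "(\<lambda>w. if P w then gen_inv l r (G w) (y w) else d) \<in> borel_measurable M"
proof -
  have "(\<lambda>w. gen_inv l r (G w) (y w)) \<in> borel_measurable (restrict_space M {w. P w})"
    (is "_ \<in> borel_measurable ?N")
  proof (rule borel_measurableI_le)
    fix c
    have [measurable]: "y \<in> borel_measurable ?N" "\<And>x. x \<in> {l..r} \<Longrightarrow> (\<lambda>w. G w x) \<in> borel_measurable ?N"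
      using G y by (auto intro: measurable_restrict_space1)
    have sp: "w \<in> space M" "P w" if "w \<in> space ?N" for w
      using that by (auto simp: space_restrict_space)
    note inn = gen_inv_in[OF lr] and le = gen_inv_le_iff[OF lr]
    consider "c < l" | "c \<in> {l..r}" | "c > r" by force
    then show "{w\<in>space ?N. gen_inv l r (G w) (y w) \<le> c} \<in> sets ?N"
    proof cases
      case 1
      then have "{w\<in>space ?N. gen_inv l r (G w) (y w) \<le> c} = {}"
        using sp spec inn by force
      then show ?thesis by (simp only: sets.empty_sets)
    next
      case 2
      then have "{w\<in>space ?N. gen_inv l r (G w) (y w) \<le> c} = {w\<in>space ?N. y w \<le> G w c}"
        using sp spec le by blast
      then show ?thesis using 2 by simp
    next
      case 3
      then have "{w\<in>space ?N. gen_inv l r (G w) (y w) \<le> c} = space ?N"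
        using sp spec inn by force
      then show ?thesis by (simp only: sets.top)
    qed
  qed
  then show ?thesis
    using P by (subst measurable_If_restrict_space_iff) auto
qed

section \<open>Conditional and minimal densities\<close>

locale gibbs_target =
  fixes a b :: "real^'n" and g :: "real^'n \<Rightarrow> real"
  assumes dens: "density_on_box a b g" and cond: "conditionals_ok a b g"
begin

abbreviation "cd \<equiv> cond_dens a b g"
abbreviation "md \<equiv> min_dens a b g"
abbreviation "RF \<equiv> R_fun a b g"
abbreviation "cdf_of \<equiv> cond_cdf a b g"

lemma ab_le [simp]: "a $ k \<le> b $ k"
  using dens unfolding density_on_box_def by (auto intro: less_imp_le)

lemma g_measurable [measurable]: "g \<in> borel_measurable borel"
  and g_nonneg: "0 \<le> g x"
  and g_outside: "x \<notin> cbox a b \<Longrightarrow> g x = 0"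
  and g_mass: "(\<integral>\<^sup>+x. ennreal (g x) \<partial>lborel) = 1"
  using dens unfolding density_on_box_def by auto

lemma in_state_iff: "x \<in> cbox a b \<longleftrightarrow> (\<forall>i. x $ i \<in> {a$i..b$i})"
  by (auto simp: mem_box_cart)

definition Z :: "'n \<Rightarrow> real^'n \<Rightarrow> real" where
  "Z k x = (LBINT z:{a$k..b$k}. g (upd x k z))"

lemma Z_measurable [measurable]: "Z k \<in> borel_measurable borel"
  unfolding Z_def set_lebesgue_integral_def by measurable

lemma Z_pos: "x \<in> cbox a b \<Longrightarrow> 0 < Z k x"
  and g_section_integrable: "x \<in> cbox a b \<Longrightarrow> set_integrable lborel {a$k..b$k} (\<lambda>z. g (upd x k z))"
  using cond unfolding conditionals_ok_def Z_def by auto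

lemma cond_dens_eq: "cd k y x = g (upd x k y) / Z k x"
  by (simp add: cond_dens_def Z_def)

lemma cond_dens_measurable [measurable (raw)]:
  assumes [measurable]: "f \<in> borel_measurable M" "h \<in> borel_measurable M"
  shows "(\<lambda>w. cd k (h w) (f w)) \<in> borel_measurable M"
  unfolding cond_dens_eq by measurable

lemma cond_cdf_measurable [measurable (raw)]:
  assumes [measurable]: "f \<in> borel_measurable M"
  shows "(\<lambda>w. cdf_of k x (f w)) \<in> borel_measurable M"
proof -
  have "cdf_of k x \<in> borel_measurable borel"
    unfolding cond_cdf_def set_lebesgue_integral_def by measurable
  then show ?thesis using assms by (rule measurable_compose[rotated])
qed

lemma cond_dens_nonneg: "x \<in> cbox a b \<Longrightarrow> 0 \<le> cd k y x"
  using Z_pos[of x k] g_nonneg by (simp add: cond_dens_eq)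

lemma cond_dens_integrable:
  assumes "x \<in> cbox a b"
  shows "set_integrable lborel {a$k..b$k} (\<lambda>y. cd k y x)"
  unfolding cond_dens_eq using g_section_integrable[OF assms] by simp

lemma cond_cdf_right [simp]: "x \<in> cbox a b \<Longrightarrow> cdf_of k (b$k) x = 1"
  using Z_pos[of x k] by (simp add: cond_cdf_def cond_dens_eq Z_def)

lemma cond_cdf_left [simp]: "cdf_of k (a$k) x = 0"
  by (simp add: cond_cdf_def)

definition corners :: "real^'n \<Rightarrow> real^'n \<Rightarrow> bool" where
  "corners l u \<longleftrightarrow> (\<forall>i. a$i \<le> l$i \<and> l$i \<le> u$i \<and> u$i \<le> b$i)"

definition valid_box :: "('n \<Rightarrow> real set) \<Rightarrow> bool" where
  "valid_box \<xi> \<longleftrightarrow> (\<exists>l u. corners l u \<and> \<xi> = (\<lambda>i. {l$i..u$i}))"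

lemma corners_iff: "corners l u \<longleftrightarrow> cbox l u \<noteq> {} \<and> cbox l u \<subseteq> cbox a b"
  unfolding corners_def interval_ne_empty_cart subset_interval_cart
  by (smt (verit, best))

lemma valid_box_subset: "valid_box \<xi> \<Longrightarrow> box_of \<xi> \<subseteq> cbox a b"
  unfolding valid_box_def by (auto simp: corners_def box_of_def mem_box_cart) (meson order_trans)+

lemma valid_box_nonempty: "valid_box \<xi> \<Longrightarrow> box_of \<xi> \<noteq> {}"
  unfolding valid_box_def box_of_def corners_def by force

lemma box_of_mono: "(\<And>i. \<xi> i \<subseteq> \<xi>' i) \<Longrightarrow> box_of \<xi> \<subseteq> box_of \<xi>'"
  by (auto simp: box_of_def)

lemma min_dens_bdd: "valid_box \<xi> \<Longrightarrow> bdd_below ((\<lambda>x. cd k y x) ` box_of \<xi>)"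
  using valid_box_subset cond_dens_nonneg by (intro bdd_belowI2[of _ 0]) blast

lemma min_dens_le: "valid_box \<xi> \<Longrightarrow> x \<in> box_of \<xi> \<Longrightarrow> md k y \<xi> \<le> cd k y x"
  unfolding min_dens_def by (intro cINF_lower min_dens_bdd)

lemma min_dens_nonneg: "valid_box \<xi> \<Longrightarrow> 0 \<le> md k y \<xi>"
  unfolding min_dens_def using valid_box_nonempty valid_box_subset cond_dens_nonneg
  by (intro cINF_greatest) blast+

lemma min_dens_antimono:
  "valid_box \<xi> \<Longrightarrow> valid_box \<xi>' \<Longrightarrow> (\<And>i. \<xi> i \<subseteq> \<xi>' i) \<Longrightarrow> md k y \<xi>' \<le> md k y \<xi>"
  unfolding min_dens_def by (intro cINF_superset_mono valid_box_nonempty min_dens_bdd box_of_mono) auto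

lemma min_dens_point: "box_of \<xi> = {v} \<Longrightarrow> md k y \<xi> = cd k y v"
  by (simp add: min_dens_def)

text \<open>
  The standing convention gives measurability of the minima only on the set of genuine boxes; the
  extension by 0 is measurable on the whole product space, so its integrals over \<open>y\<close> are measurable
  functions of the corners.
\<close>
definition md_ext :: "'n \<Rightarrow> real^'n \<Rightarrow> real^'n \<Rightarrow> real \<Rightarrow> real" where
  "md_ext k l u y = (if corners l u \<and> y \<in> {a$k..b$k} then md k y (\<lambda>i. {l$i..u$i}) else 0)"

lemma corners_measurable [measurable (raw)]:
  assumes [measurable]: "f \<in> borel_measurable M" "h \<in> borel_measurable M"
  shows "Measurable.pred M (\<lambda>w. corners (f w) (h w))"
  unfolding corners_def by measurable

lemma md_ext_measurable [measurable (raw)]: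
  assumes [measurable]: "f \<in> borel_measurable M" "h \<in> borel_measurable M" "q \<in> borel_measurable M"
  shows "(\<lambda>w. md_ext k (f w) (h w) (q w)) \<in> borel_measurable M"
proof -
  let ?S = "{(l, u, y). cbox l u \<noteq> {} \<and> cbox l u \<subseteq> cbox a b \<and> y \<in> {a$k..b$k}}"
  let ?B = "borel \<Otimes>\<^sub>M borel \<Otimes>\<^sub>M borel :: ((real^'n) \<times> (real^'n) \<times> real) measure"
  have "(\<lambda>(l, u, y). md k y (\<lambda>i. {l$i..u$i})) \<in> borel_measurable (restrict_space ?B ?S)"
    using cond unfolding conditionals_ok_def by blast
  moreover have S: "?S = {p. corners (fst p) (fst (snd p)) \<and> snd (snd p) \<in> {a$k..b$k}}"
    by (auto simp: corners_iff)
  moreover have "{p\<in>space ?B. corners (fst p) (fst (snd p)) \<and> snd (snd p) \<in> {a$k..b$k}} \<in> sets ?B"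
    by measurable
  ultimately have "(\<lambda>p. if p \<in> ?S then (\<lambda>(l, u, y). md k y (\<lambda>i. {l$i..u$i})) p else 0) \<in> borel_measurable ?B"
    by (subst measurable_restrict_space_iff[symmetric]) (auto simp: space_pair_measure)
  also have "(\<lambda>p. if p \<in> ?S then (\<lambda>(l, u, y). md k y (\<lambda>i. {l$i..u$i})) p else 0) = (\<lambda>(l, u, y). md_ext k l u y)"
    by (auto simp: md_ext_def corners_iff fun_eq_iff)
  finally have m: "(\<lambda>(l, u, y). md_ext k l u y) \<in> borel_measurable ?B" .
  have "(\<lambda>w. (f w, h w, q w)) \<in> measurable M ?B" by measurable
  from measurable_compose[OF this m] show ?thesis by simp
qed

lemma min_dens_integrable:
  assumes "valid_box \<xi>"
  shows "set_integrable lborel {a$k..b$k} (\<lambda>y. md k y \<xi>)"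
proof -
  obtain l u where lu: "corners l u" "\<xi> = (\<lambda>i. {l$i..u$i})" using assms by (auto simp: valid_box_def)
  obtain x where x: "x \<in> box_of \<xi>" using valid_box_nonempty[OF assms] by auto
  have eq: "indicator {a$k..b$k} y *\<^sub>R md k y \<xi> = md_ext k l u y" for y
    using lu by (simp add: md_ext_def indicator_def)
  show ?thesis
    unfolding set_integrable_def
  proof (rule Bochner_Integration.integrable_bound)
    show "integrable lborel (\<lambda>y. indicator {a$k..b$k} y *\<^sub>R cd k y x)"
      using cond_dens_integrable[of x k] valid_box_subset[OF assms] x by (auto simp: set_integrable_def)
    show "(\<lambda>y. indicator {a$k..b$k} y *\<^sub>R md k y \<xi>) \<in> borel_measurable lborel"
      unfolding eq by measurable
    show "AE y in lborel. norm (indicator {a$k..b$k} y *\<^sub>R md k y \<xi>) \<le> norm (indicator {a$k..b$k} y *\<^sub>R cd k y x)"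
      using min_dens_le[OF assms x, of k] min_dens_nonneg[OF assms, of k]
      by (intro AE_I2) (simp add: indicator_def order_trans[OF _ abs_ge_self])
  qed
qed

lemma R_fun_measurable:
  assumes [measurable]: "f \<in> borel_measurable M" "h \<in> borel_measurable M"
    and x: "x \<in> {a$k..b$k}" and c: "\<And>w. w \<in> space M \<Longrightarrow> corners (f w) (h w)"
  shows "(\<lambda>w. RF k x (\<lambda>i. {f w$i..h w$i})) \<in> borel_measurable M"
proof -
  have "(\<lambda>w. LBINT y:{a$k..x}. md_ext k (f w) (h w) y) \<in> borel_measurable M"
    unfolding set_lebesgue_integral_def by measurable
  also have "?this \<longleftrightarrow> ?thesis"
    using x by (intro measurable_cong) (auto simp: R_fun_def md_ext_def c intro!: set_lebesgue_integral_cong)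
  finally show ?thesis .
qed

lemma R_fun_left [simp]: "RF k (a$k) \<xi> = 0"
  by (simp add: R_fun_def)

lemma R_fun_point: "box_of \<xi> = {v} \<Longrightarrow> RF k x \<xi> = cdf_of k x v"
  by (simp add: R_fun_def cond_cdf_def min_dens_point)

lemma R_fun_continuous: "valid_box \<xi> \<Longrightarrow> continuous_on {a$k..b$k} (\<lambda>x. RF k x \<xi>)"
  unfolding R_fun_def by (intro indefinite_LBINT_continuous min_dens_integrable)

lemma cond_cdf_continuous: "v \<in> cbox a b \<Longrightarrow> continuous_on {a$k..b$k} (\<lambda>x. cdf_of k x v)"
  unfolding cond_cdf_def by (intro indefinite_LBINT_continuous cond_dens_integrable)

lemma R_fun_mono: "valid_box \<xi> \<Longrightarrow> a$k \<le> x \<Longrightarrow> x \<le> y \<Longrightarrow> y \<le> b$k \<Longrightarrow> RF k x \<xi> \<le> RF k y \<xi>"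
  using indefinite_LBINT_increment_mono[of "a$k" "b$k" "\<lambda>_. 0" "\<lambda>y. md k y \<xi>" x y]
  by (simp add: R_fun_def min_dens_integrable min_dens_nonneg set_integrable_def[of _ _ "\<lambda>_. 0"])

lemma R_fun_nonneg: "valid_box \<xi> \<Longrightarrow> x \<in> {a$k..b$k} \<Longrightarrow> 0 \<le> RF k x \<xi>"
  using R_fun_mono[of \<xi> k "a$k" x] by simp

text \<open>
  A smaller box has a larger minimal density. This is what makes the functions \<open>D\<^sub>[\<^sub>s\<^sub>,\<^sub>t\<^sub>]\<close> nondecreasing.
\<close>
lemma R_fun_increment:
  assumes "valid_box \<xi>" "valid_box \<xi>'" "\<And>i. \<xi> i \<subseteq> \<xi>' i" "a$k \<le> x" "x \<le> y" "y \<le> b$k"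
  shows "RF k y \<xi>' - RF k x \<xi>' \<le> RF k y \<xi> - RF k x \<xi>"
  unfolding R_fun_def using assms
  by (intro indefinite_LBINT_increment_mono[where r="b$k"] min_dens_integrable min_dens_antimono) auto

text \<open>
  The minimal density over a box lies below the conditional density at any of its points. This is what
  makes the functions \<open>G_hat\<close> nondecreasing.
\<close>
lemma R_fun_cdf_increment:
  assumes "valid_box \<xi>" "v \<in> box_of \<xi>" "a$k \<le> x" "x \<le> y" "y \<le> b$k"
  shows "RF k y \<xi> - RF k x \<xi> \<le> cdf_of k y v - cdf_of k x v"
  unfolding R_fun_def cond_cdf_def using assms valid_box_subset
  by (intro indefinite_LBINT_increment_mono[where r="b$k"] min_dens_integrable min_dens_le cond_dens_integrable) auto

end

section \<open>Nested boxes and coupling\<close>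

text \<open>
  The boxes are built from the marks at the times in \<open>{s<..t}\<close> by a recursion that does not see absolute
  time. With different \<open>h\<close>, \<open>\<kappa>'\<close>, \<open>\<omega>'\<close> this gives shift equivariance, insensitivity to later marks,
  and the passage from an arbitrary probability space to the space of mark sequences.
\<close>
lemma eta_cong:
  assumes "\<And>i. s < i \<Longrightarrow> i \<le> t \<Longrightarrow> \<kappa> i \<omega> = \<kappa>' (i + h) \<omega>' \<and> U i \<omega> = U' (i + h) \<omega>'"
  shows "eta a b g \<kappa> U s t \<omega> = eta a b g \<kappa>' U' (s + h) (t + h) \<omega>'"
  using assms
proof (induction "nat (t - s)" arbitrary: s t rule: less_induct)
  case less
  show ?case
  proof (cases "t \<le> s")
    case True
    then show ?thesis by (simp add: fun_eq_iff eta.simps)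
  next
    case False
    have k: "\<kappa> t \<omega> = \<kappa>' (t + h) \<omega>'" and u: "U t \<omega> = U' (t + h) \<omega>'"
      using less.prems[of t] False by auto
    have t1: "t + h - 1 = t - 1 + h" and s1: "s + h + 1 = s + 1 + h" by auto
    have e1: "eta a b g \<kappa> U s (t - 1) \<omega> = eta a b g \<kappa>' U' (s + h) (t - 1 + h) \<omega>'"
      by (rule less.hyps) (use False less.prems in auto)
    have e2: "eta a b g \<kappa> U (s + 1) t \<omega> = eta a b g \<kappa>' U' (s + 1 + h) (t + h) \<omega>'"
      by (rule less.hyps) (use False less.prems in auto)
    have e3: "eta a b g \<kappa> U (s + 1) (t - 1) \<omega> = eta a b g \<kappa>' U' (s + 1 + h) (t - 1 + h) \<omega>'"
      by (rule less.hyps) (use False less.prems in auto)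
    have r: "box_R a b g \<kappa> U s t \<omega> = box_R a b g \<kappa>' U' (s + h) (t + h) \<omega>'"
      using False by (simp add: fun_eq_iff box_R.simps k t1 e1)
    have r1: "box_R a b g \<kappa> U (s + 1) t \<omega> = box_R a b g \<kappa>' U' (s + 1 + h) (t + h) \<omega>'"
      by (simp add: fun_eq_iff box_R.simps k t1 e3)
    have d: "box_D a b g \<kappa> U s t \<omega> = box_D a b g \<kappa>' U' (s + h) (t + h) \<omega>'"
      by (simp add: fun_eq_iff box_D.simps k s1 r r1)
    show ?thesis
      by (rule ext, subst (1 2) eta.simps) (simp add: k u t1 s1 e1 e2 r r1 d)
  qed
qed

locale gibbs_driven = gibbs_target a b g for a b :: "real^'n" and g +
  fixes \<kappa> :: "int \<Rightarrow> 'w \<Rightarrow> 'n" and U :: "int \<Rightarrow> 'w \<Rightarrow> real"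
begin

abbreviation "et \<equiv> eta a b g \<kappa> U"
abbreviation "cpl \<equiv> coupled a b g \<kappa> U"

text \<open>
  In \<open>Rk\<close>, \<open>Dk\<close> (and \<open>Ghat\<close> below) the site is a free parameter instead of \<open>\<kappa> t \<omega>\<close>, so that
  they depend on \<open>\<omega>\<close> only through the marks before time \<open>t\<close>: the mark at time \<open>t\<close> can then be
  integrated out with these functions fixed.
\<close>
definition Rk :: "int \<Rightarrow> int \<Rightarrow> 'w \<Rightarrow> 'n \<Rightarrow> real \<Rightarrow> real" where
  "Rk s t \<omega> k x = (if t \<le> s then 0 else RF k x (et s (t-1) \<omega>))"

definition Dk :: "int \<Rightarrow> int \<Rightarrow> 'w \<Rightarrow> 'n \<Rightarrow> real \<Rightarrow> real" where
  "Dk s t \<omega> k x = Rk (s+1) t \<omega> k (b$k) + Rk s t \<omega> k x - Rk (s+1) t \<omega> k x"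

lemma box_R_eq: "box_R a b g \<kappa> U s t \<omega> x = Rk s t \<omega> (\<kappa> t \<omega>) x"
  by (simp add: box_R.simps Rk_def)

lemma box_D_eq: "s < t \<Longrightarrow> box_D a b g \<kappa> U s t \<omega> = Dk s t \<omega> (\<kappa> t \<omega>)"
  by (simp add: fun_eq_iff box_D.simps Dk_def box_R_eq)

lemma eta_init: "t \<le> s \<Longrightarrow> et s t \<omega> = (\<lambda>k. {a$k..b$k})"
  by (simp add: fun_eq_iff eta.simps)

lemma eta_step:
  assumes "s < t"
  shows "et s t \<omega> k = (if k \<noteq> \<kappa> t \<omega> then et s (t-1) \<omega> k
      else if U t \<omega> \<le> Rk (s+1) t \<omega> k (b$k) then et (s+1) t \<omega> k
      else if U t \<omega> \<le> Rk s t \<omega> k (b$k) then {gen_inv (a$k) (b$k) (Dk s t \<omega> k) (U t \<omega>)}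
      else {a$k..b$k})"
  using assms by (subst eta.simps) (simp add: box_R_eq box_D_eq)

text \<open>
  The two properties have to be proved together: nesting at time \<open>t - 1\<close> makes \<open>D\<^sub>[\<^sub>s\<^sub>,\<^sub>t\<^sub>]\<close> nondecreasing, so
  that its inverse exists and the box at time \<open>t\<close> is again a product of intervals contained in \<open>B\<close>.
\<close>
definition nested :: "int \<Rightarrow> int \<Rightarrow> 'w \<Rightarrow> bool" where
  "nested s t \<omega> \<longleftrightarrow> valid_box (et s t \<omega>) \<and> (\<forall>k. et s t \<omega> k \<subseteq> et (s+1) t \<omega> k)"

lemma valid_box_state: "valid_box (\<lambda>k. {a$k..b$k})"
  unfolding valid_box_def corners_def by (intro exI[of _ a] exI[of _ b]) simp

lemma valid_boxI:
  assumes "\<And>k. \<exists>l u. a$k \<le> l \<and> l \<le> u \<and> u \<le> b$k \<and> \<xi> k = {l..u}"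
  shows "valid_box \<xi>"
proof -
  obtain l u where lu: "\<And>k. a$k \<le> l k \<and> l k \<le> u k \<and> u k \<le> b$k \<and> \<xi> k = {l k..u k}"
    using assms by metis
  show ?thesis
    unfolding valid_box_def corners_def
    by (intro exI[of _ "\<chi> i. l i"] exI[of _ "\<chi> i. u i"]) (use lu in \<open>simp add: fun_eq_iff\<close>)
qed

lemma valid_boxD: "valid_box \<xi> \<Longrightarrow> \<exists>l u. a$k \<le> l \<and> l \<le> u \<and> u \<le> b$k \<and> \<xi> k = {l..u}"
  unfolding valid_box_def corners_def by blast

lemma Rk_increment_if_nested:
  assumes "s < t" "nested s (t-1) \<omega>" "nested (s+1) (t-1) \<omega>" "a$k \<le> x" "x \<le> y" "y \<le> b$k"
  shows "Rk (s+1) t \<omega> k y - Rk (s+1) t \<omega> k x \<le> Rk s t \<omega> k y - Rk s t \<omega> k x"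
  using assms R_fun_increment[of "et s (t-1) \<omega>" "et (s+1) (t-1) \<omega>" k x y]
    R_fun_mono[of "et s (t-1) \<omega>" k x y]
  unfolding Rk_def nested_def by auto

lemma Rk_left [simp]: "Rk s t \<omega> k (a$k) = 0"
  by (simp add: Rk_def)

lemma Rk_continuous_if_nested:
  "nested s (t-1) \<omega> \<Longrightarrow> continuous_on {a$k..b$k} (Rk s t \<omega> k)"
  unfolding Rk_def nested_def by (cases "t \<le> s") (simp_all add: R_fun_continuous)

lemma Dk_spec_if_nested:
  assumes "s < t" "nested s (t-1) \<omega>" "nested (s+1) (t-1) \<omega>"
  shows "continuous_on {a$k..b$k} (Dk s t \<omega> k)" "mono_on {a$k..b$k} (Dk s t \<omega> k)"
    "Dk s t \<omega> k (b$k) = Rk s t \<omega> k (b$k)"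
proof -
  show "continuous_on {a$k..b$k} (Dk s t \<omega> k)"
    unfolding Dk_def by (intro continuous_intros Rk_continuous_if_nested assms)
  show "mono_on {a$k..b$k} (Dk s t \<omega> k)"
  proof (rule mono_onI)
    fix x y assume "x \<in> {a$k..b$k}" "y \<in> {a$k..b$k}" "x \<le> y"
    then show "Dk s t \<omega> k x \<le> Dk s t \<omega> k y"
      using Rk_increment_if_nested[OF assms, of k x y] by (simp add: Dk_def)
  qed
  show "Dk s t \<omega> k (b$k) = Rk s t \<omega> k (b$k)"
    by (simp add: Dk_def)
qed

lemma nested_init: "t \<le> s \<Longrightarrow> nested s t \<omega>"
  by (simp add: nested_def eta_init valid_box_state)

text \<open>
  The only case in which \<open>\<eta>\<^sub>[\<^sub>s\<^sub>,\<^sub>t\<^sub>](k)\<close> is not inherited is \<open>k = \<kappa>(t)\<close> and \<open>U\<^sub>t > R\<^sub>[\<^sub>s\<^sub>+\<^sub>1\<^sub>,\<^sub>t\<^sub>]\<close>. Then the process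
  started at \<open>s + 1\<close> has not determined the coordinate, because \<open>R\<^sub>[\<^sub>s\<^sub>+\<^sub>2\<^sub>,\<^sub>t\<^sub>] \<le> R\<^sub>[\<^sub>s\<^sub>+\<^sub>1\<^sub>,\<^sub>t\<^sub>]\<close>, so its side is all of
  \<open>B(k)\<close> and contains \<open>\<eta>\<^sub>[\<^sub>s\<^sub>,\<^sub>t\<^sub>](k)\<close> whatever that is.
\<close>
lemma nested_all: "nested s t \<omega>"
proof (induction "nat (t - s)" arbitrary: s t rule: less_induct)
  case less
  show ?case
  proof (cases "s < t")
    case False
    then show ?thesis by (intro nested_init) auto
  next
    case True
    have n1: "nested s (t-1) \<omega>" and n2: "nested (s+1) (t-1) \<omega>" and n3: "nested (s+1) t \<omega>"
      using True by (auto intro!: less)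
    have n4: "nested (s+2) (t-1) \<omega>"
    proof (cases "s + 2 \<le> t - 1")
      case True
      then show ?thesis by (intro less) auto
    qed (auto intro: nested_init)
    note D = Dk_spec_if_nested[OF True n1 n2]
    have "\<exists>l u. a$k \<le> l \<and> l \<le> u \<and> u \<le> b$k \<and> et s t \<omega> k = {l..u}" for k
    proof -
      have "gen_inv (a$k) (b$k) (Dk s t \<omega> k) (U t \<omega>) \<in> {a$k..b$k}" if "U t \<omega> \<le> Rk s t \<omega> k (b$k)"
        using that D by (intro gen_inv_in) auto
      then have "\<exists>l u. a$k \<le> l \<and> l \<le> u \<and> u \<le> b$k \<and>
           {gen_inv (a$k) (b$k) (Dk s t \<omega> k) (U t \<omega>)} = {l..u}" if "U t \<omega> \<le> Rk s t \<omega> k (b$k)"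
        using that by (intro exI[of _ "gen_inv (a$k) (b$k) (Dk s t \<omega> k) (U t \<omega>)"]) auto
      moreover have "\<exists>l u. a$k \<le> l \<and> l \<le> u \<and> u \<le> b$k \<and> {a$k..b$k} = {l..u}"
        by (intro exI[of _ "a$k"] exI[of _ "b$k"]) auto
      ultimately show ?thesis
        using n1 n3 valid_boxD unfolding nested_def eta_step[OF True] by auto
    qed
    then have v: "valid_box (et s t \<omega>)" by (rule valid_boxI)
    have full: "et (s+1) t \<omega> k = {a$k..b$k}"
      if k: "k = \<kappa> t \<omega>" and U: "U t \<omega> > Rk (s+1) t \<omega> k (b$k)" for k
    proof (cases "s + 1 < t")
      case False
      then show ?thesis by (simp add: eta_init)
    next
      case True
      have "Rk (s+1+1) t \<omega> k (b$k) \<le> Rk (s+1) t \<omega> k (b$k)"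
        using Rk_increment_if_nested[OF True n2, of k "a$k" "b$k"] n4 by (simp add: add.assoc)
      then show ?thesis using k U by (simp add: eta_step[OF True])
    qed
    have "et s t \<omega> k \<subseteq> et (s+1) t \<omega> k" for k
    proof (cases "k = \<kappa> t \<omega>")
      case True
      show ?thesis
      proof (cases "U t \<omega> \<le> Rk (s+1) t \<omega> k (b$k)")
        case True
        then show ?thesis using \<open>k = \<kappa> t \<omega>\<close> \<open>s < t\<close> by (simp add: eta_step)
      next
        case False
        then show ?thesis using full[OF \<open>k = \<kappa> t \<omega>\<close>] valid_boxD[OF v, of k] by auto
      qed
    next
      case False
      have "et (s+1) t \<omega> k = et (s+1) (t-1) \<omega> k"
        using False by (cases "s + 1 < t") (simp_all add: eta_step eta_init)
      then show ?thesis
        using n1 False \<open>s < t\<close> by (simp add: eta_step nested_def)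
    qed
    with v show ?thesis by (simp add: nested_def)
  qed
qed

lemma valid_eta [simp]: "valid_box (et s t \<omega>)"
  using nested_all by (simp add: nested_def)

lemma eta_mono: "s' \<le> s \<Longrightarrow> et s' t \<omega> k \<subseteq> et s t \<omega> k"
proof (induction s rule: int_ge_induct)
  case (step s)
  then show ?case using nested_all[of s t \<omega>] by (auto simp: nested_def)
qed simp

lemma Rk_increment:
  assumes "s < t" "a$k \<le> x" "x \<le> y" "y \<le> b$k"
  shows "Rk (s+1) t \<omega> k y - Rk (s+1) t \<omega> k x \<le> Rk s t \<omega> k y - Rk s t \<omega> k x"
  by (intro Rk_increment_if_nested nested_all assms)

lemmas Rk_continuous = Rk_continuous_if_nested[OF nested_all]
lemmas Dk_continuous = Dk_spec_if_nested(1)[OF _ nested_all nested_all]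
  and Dk_mono = Dk_spec_if_nested(2)[OF _ nested_all nested_all]
  and Dk_right = Dk_spec_if_nested(3)[OF _ nested_all nested_all]

lemma Rk_nonneg: "x \<in> {a$k..b$k} \<Longrightarrow> 0 \<le> Rk s t \<omega> k x"
  by (simp add: Rk_def R_fun_nonneg)

lemma Rk_antimono_start:
  assumes "s' \<le> s" "s \<le> t" "x \<in> {a$k..b$k}"
  shows "Rk s t \<omega> k x \<le> Rk s' t \<omega> k x"
  using assms(1)
proof (induction s' rule: int_le_induct)
  case (step i)
  then show ?case
    using Rk_increment[of "i-1" t k "a$k" x \<omega>] assms by auto
qed simp

definition lo :: "int \<Rightarrow> int \<Rightarrow> 'w \<Rightarrow> real^'n" where
  "lo s t \<omega> = (\<chi> i. Inf (et s t \<omega> i))"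

definition hi :: "int \<Rightarrow> int \<Rightarrow> 'w \<Rightarrow> real^'n" where
  "hi s t \<omega> = (\<chi> i. Sup (et s t \<omega> i))"

lemma eta_eq_Icc: "et s t \<omega> i = {lo s t \<omega> $ i..hi s t \<omega> $ i}"
  and corners_lo_hi: "corners (lo s t \<omega>) (hi s t \<omega>)"
proof -
  have *: "a$i \<le> lo s t \<omega> $ i \<and> lo s t \<omega> $ i \<le> hi s t \<omega> $ i \<and> hi s t \<omega> $ i \<le> b$i \<and>
      et s t \<omega> i = {lo s t \<omega> $ i..hi s t \<omega> $ i}" for i
  proof -
    obtain l u where "a$i \<le> l" "l \<le> u" "u \<le> b$i" "et s t \<omega> i = {l..u}"
      using valid_boxD[OF valid_eta, of i s t \<omega>] by blast
    then show ?thesis by (simp add: lo_def hi_def)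
  qed
  then show "et s t \<omega> i = {lo s t \<omega> $ i..hi s t \<omega> $ i}" "corners (lo s t \<omega>) (hi s t \<omega>)"
    by (auto simp: corners_def)
qed

lemma box_of_eta_iff: "v \<in> box_of (et s t \<omega>) \<longleftrightarrow> (\<forall>i. lo s t \<omega> $ i \<le> v $ i \<and> v $ i \<le> hi s t \<omega> $ i)"
  by (auto simp: box_of_def eta_eq_Icc)

lemma lo_in_eta: "lo s t \<omega> \<in> box_of (et s t \<omega>)"
  using corners_lo_hi[of s t \<omega>] by (auto simp: box_of_eta_iff corners_def)

lemma box_of_eta_subset: "box_of (et s t \<omega>) \<subseteq> cbox a b"
  by (intro valid_box_subset valid_eta)

lemma coupled_iff: "cpl s t \<omega> \<longleftrightarrow> s < t \<and> lo s t \<omega> = hi s t \<omega>"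
  by (simp add: coupled_def eta_eq_Icc atLeastAtMost_singleton_iff vec_eq_iff)

lemma coupled_box: "cpl s t \<omega> \<Longrightarrow> box_of (et s t \<omega>) = {lo s t \<omega>}"
  by (simp add: coupled_iff box_of_eta_iff vec_eq_iff set_eq_iff) (metis order_antisym order_refl)

text \<open>
  By nesting, the box started earlier is a nonempty subset of the one-point box.
\<close>
lemma coupled_antimono:
  assumes "s' \<le> s" "cpl s t \<omega>"
  shows "cpl s' t \<omega>" "lo s' t \<omega> = lo s t \<omega>"
proof -
  have "box_of (et s' t \<omega>) \<subseteq> {lo s t \<omega>}"
    using coupled_box[OF assms(2)] box_of_mono[of "et s' t \<omega>" "et s t \<omega>"] eta_mono[OF assms(1)] by auto
  moreover have "lo s' t \<omega> \<in> box_of (et s' t \<omega>)" "hi s' t \<omega> \<in> box_of (et s' t \<omega>)"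
    using corners_lo_hi[of s' t \<omega>] by (auto simp: box_of_eta_iff corners_def)
  ultimately have "lo s' t \<omega> = lo s t \<omega>" "hi s' t \<omega> = lo s t \<omega>" by blast+
  then show "cpl s' t \<omega>" "lo s' t \<omega> = lo s t \<omega>"
    using assms unfolding coupled_iff by auto
qed

text \<open>
  The coupled starting times form a down-closed set bounded by \<open>t\<close>, hence \<open>\<tau>(t)\<close> is attained.
\<close>
lemma tau_eq:
  assumes "cpl s0 t \<omega>"
  obtains m where "tau a b g \<kappa> U t \<omega> = Fin m" "\<And>s. cpl s t \<omega> \<longleftrightarrow> s \<le> m"
proof -
  let ?S = "{s\<in>{s0..t}. cpl s t \<omega>}"
  have fin: "finite ?S" by (rule finite_subset[of _ "{s0..t}"]) auto
  have ne: "?S \<noteq> {}" using assms by (auto simp: coupled_iff)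
  have m: "Max ?S \<in> ?S" by (rule Max_in[OF fin ne])
  have le: "s \<le> Max ?S" if "cpl s t \<omega>" for s
  proof (cases "s0 \<le> s")
    case True
    then show ?thesis using that by (intro Max_ge[OF fin]) (auto simp: coupled_iff)
  next
    case False
    then show ?thesis using m by auto
  qed
  have "(GREATEST s. cpl s t \<omega>) = Max ?S"
    using m le by (intro Greatest_equality) auto
  then have "tau a b g \<kappa> U t \<omega> = Fin (Max ?S)"
    using assms unfolding tau_def by auto
  moreover have "cpl s t \<omega> \<longleftrightarrow> s \<le> Max ?S" for s
    using m le coupled_antimono(1) by blast
  ultimately show ?thesis by (rule that)
qed

lemma tau_less_iff: "tau a b g \<kappa> U t \<omega> < Fin s \<longleftrightarrow> \<not> cpl s t \<omega>"
proof (cases "\<exists>s. cpl s t \<omega>")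
  case True
  then obtain s0 where "cpl s0 t \<omega>" ..
  then show ?thesis by (rule tau_eq) auto
next
  case False
  then show ?thesis by (simp add: tau_def)
qed

lemma tau_greater_iff: "tau a b g \<kappa> U t \<omega> > Minf \<longleftrightarrow> (\<exists>s. cpl s t \<omega>)"
  by (simp add: tau_def)

text \<open>
  All boxes \<open>\<eta>\<^sub>[\<^sub>s\<^sub>,\<^sub>t\<^sub>]\<close> with \<open>s \<le> \<tau>(t)\<close> are the same point, so any coupled starting time may replace \<open>\<tau>(t)\<close>.
\<close>
lemma zeta_coupled:
  assumes c: "cpl s t \<omega>"
  shows "zeta a b g \<kappa> U t \<omega> = lo s t \<omega>"
proof -
  obtain m where m: "tau a b g \<kappa> U t \<omega> = Fin m" "\<And>s. cpl s t \<omega> \<longleftrightarrow> s \<le> m"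
    using tau_eq[OF c] by metis
  have cm: "cpl m t \<omega>" using m by simp
  have "zeta a b g \<kappa> U t \<omega> = (\<chi> k. the_elem (et m t \<omega> k))" by (simp add: zeta_def m)
  also have "\<dots> = lo m t \<omega>" using cm by (simp add: eta_eq_Icc coupled_iff vec_eq_iff)
  also have "\<dots> = lo s t \<omega>" using coupled_antimono(2)[of s m t \<omega>] cm m(2)[of s] c by simp
  finally show ?thesis .
qed

lemma zeta_uncoupled: "(\<And>s. \<not> cpl s t \<omega>) \<Longrightarrow> zeta a b g \<kappa> U t \<omega> = a"
  by (simp add: zeta_def tau_def)

lemma zeta_in_state: "zeta a b g \<kappa> U t \<omega> \<in> cbox a b"
proof (cases "\<exists>s. cpl s t \<omega>")
  case True
  then show ?thesis using zeta_coupled lo_in_eta box_of_eta_subset by fastforce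
qed (simp add: zeta_uncoupled in_state_iff)

definition Ghat :: "int \<Rightarrow> int \<Rightarrow> 'w \<Rightarrow> 'n \<Rightarrow> real^'n \<Rightarrow> real \<Rightarrow> real" where
  "Ghat s t \<omega> k v x = Rk s t \<omega> k (b$k) + cdf_of k x v - Rk s t \<omega> k x"

lemma Ghat_spec:
  assumes "s < t" "v \<in> box_of (et s (t-1) \<omega>)"
  shows "continuous_on {a$k..b$k} (Ghat s t \<omega> k v)" "mono_on {a$k..b$k} (Ghat s t \<omega> k v)"
    "Ghat s t \<omega> k v (b$k) = 1"
proof -
  have v: "v \<in> cbox a b" using assms box_of_eta_subset by blast
  show "continuous_on {a$k..b$k} (Ghat s t \<omega> k v)"
    unfolding Ghat_def by (intro continuous_intros Rk_continuous cond_cdf_continuous v)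
  show "mono_on {a$k..b$k} (Ghat s t \<omega> k v)"
  proof (rule mono_onI)
    fix x y assume "x \<in> {a$k..b$k}" "y \<in> {a$k..b$k}" "x \<le> y"
    then show "Ghat s t \<omega> k v x \<le> Ghat s t \<omega> k v y"
      using R_fun_cdf_increment[OF valid_eta assms(2), of k x y] assms(1) by (simp add: Ghat_def Rk_def)
  qed
  show "Ghat s t \<omega> k v (b$k) = 1" using v by (simp add: Ghat_def)
qed

text \<open>
  For \<open>0 < U\<^sub>t \<le> R\<^sub>[\<^sub>s\<^sub>,\<^sub>t\<^sub>]\<close> exactly one of the intervals \<open>(R\<^sub>[\<^sub>n\<^sub>+\<^sub>1\<^sub>,\<^sub>t\<^sub>], R\<^sub>[\<^sub>n\<^sub>,\<^sub>t\<^sub>]]\<close>, \<open>s \<le> n < t\<close>, contains \<open>U\<^sub>t\<close>, and the recursion for the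
  side of the box stops at this \<open>n\<close>. The sum in the definition of \<^const>\<open>zeta_from\<close> therefore is
  the point chosen by the box process.
\<close>
lemma eta_selected_point:
  assumes "s \<le> t" "0 < U t \<omega>" "U t \<omega> \<le> Rk s t \<omega> (\<kappa> t \<omega>) (b $ \<kappa> t \<omega>)"
  defines "k \<equiv> \<kappa> t \<omega>"
  shows "et s t \<omega> k = {\<Sum>n\<in>{s..t-1}.
      of_bool (Rk (n+1) t \<omega> k (b$k) < U t \<omega> \<and> U t \<omega> \<le> Rk n t \<omega> k (b$k)) *
      gen_inv (a$k) (b$k) (box_D a b g \<kappa> U n t \<omega>) (U t \<omega>)}"
  using assms(1,3) unfolding k_def[symmetric]
proof (induction s rule: int_le_induct)
  case base
  then show ?case using assms(2) by (simp add: Rk_def)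
next
  case (step i)
  have i: "{i - 1..t - 1} = insert (i - 1) {i..t-1}" using step.hyps by auto
  let ?f = "\<lambda>n. of_bool (Rk (n+1) t \<omega> k (b$k) < U t \<omega> \<and> U t \<omega> \<le> Rk n t \<omega> k (b$k)) *
      gen_inv (a$k) (b$k) (box_D a b g \<kappa> U n t \<omega>) (U t \<omega>)"
  show ?case
  proof (cases "U t \<omega> \<le> Rk i t \<omega> k (b$k)")
    case True
    have "et (i - 1) t \<omega> k = et i t \<omega> k"
      using True step.hyps by (simp add: eta_step k_def)
    then show ?thesis using step.IH True by (simp add: i)
  next
    case False
    have "?f n = 0" if "n \<in> {i..t-1}" for n
      using Rk_antimono_start[of i n t "b$k" k \<omega>] that False by auto
    then have "(\<Sum>n\<in>{i..t-1}. ?f n) = 0" by (intro sum.neutral) auto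
    moreover have "et (i - 1) t \<omega> k = {gen_inv (a$k) (b$k) (Dk (i-1) t \<omega> k) (U t \<omega>)}"
      using False step by (simp add: eta_step k_def)
    ultimately show ?thesis using False step.prems step.hyps by (simp add: i box_D_eq k_def[symmetric])
  qed
qed

lemma eta_unselected:
  assumes "s < t" "U t \<omega> > Rk s t \<omega> k (b$k)" "k = \<kappa> t \<omega>"
  shows "et s t \<omega> k = {a$k..b$k}"
  using Rk_antimono_start[of s "s+1" t "b$k" k \<omega>] assms by (simp add: eta_step)

text \<open>
  A coordinate that the box process determines receives the same value in \<^const>\<open>zeta_from\<close>; any other
  updated coordinate has the full side \<open>B(k)\<close>. On \<open>\<tau>(t) \<ge> s\<close> this leaves \<open>\<zeta>\<^sub>t\<close> as the only possible value,
  which is the claimed bound on the probability of disagreement.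
\<close>
lemma zeta_from_in_eta:
  assumes z: "z \<in> cbox a b" and st: "s \<le> t"
    and U: "\<And>i. s < i \<Longrightarrow> i \<le> t \<Longrightarrow> 0 < U i \<omega> \<and> U i \<omega> \<le> 1"
  shows "zeta_from a b g \<kappa> U z s t \<omega> \<in> box_of (et s t \<omega>)"
  using st U
proof (induction t rule: int_ge_induct)
  case base
  then show ?case using z by (auto simp: zeta_from.simps eta_init box_of_def in_state_iff)
next
  case (step t)
  let ?t = "t + 1" and ?v = "zeta_from a b g \<kappa> U z s t \<omega>"
  have v: "?v \<in> box_of (et s t \<omega>)" using step by auto
  have U1: "0 < U ?t \<omega>" "U ?t \<omega> \<le> 1" using step by auto
  have "zeta_from a b g \<kappa> U z s ?t \<omega> $ k \<in> et s ?t \<omega> k" for k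
  proof (cases "k = \<kappa> ?t \<omega>")
    case False
    then show ?thesis using step.hyps v by (subst zeta_from.simps) (simp add: eta_step box_of_def)
  next
    case k: True
    let ?f = "\<lambda>n. of_bool (Rk (n+1) ?t \<omega> k (b$k) < U ?t \<omega> \<and> U ?t \<omega> \<le> Rk n ?t \<omega> k (b$k)) *
      gen_inv (a$k) (b$k) (box_D a b g \<kappa> U n ?t \<omega>) (U ?t \<omega>)"
    have G: "G_hat a b g \<kappa> U s ?t \<omega> ?v = Ghat s ?t \<omega> k ?v"
      by (simp add: fun_eq_iff G_hat_def Ghat_def box_R_eq k)
    have eq: "zeta_from a b g \<kappa> U z s ?t \<omega> $ k = (\<Sum>n\<in>{s..t}. ?f n)
       + of_bool (U ?t \<omega> > Rk s ?t \<omega> k (b$k)) * gen_inv (a$k) (b$k) (Ghat s ?t \<omega> k ?v) (U ?t \<omega>)"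
      using step.hyps k by (subst zeta_from.simps) (simp add: box_R_eq G)
    show ?thesis
    proof (cases "U ?t \<omega> \<le> Rk s ?t \<omega> k (b$k)")
      case True
      then show ?thesis
        unfolding eq using eta_selected_point[of s ?t \<omega>] U1 step.hyps unfolding k[symmetric] by simp
    next
      case False
      have "?f n = 0" if "n \<in> {s..t}" for n
        using Rk_antimono_start[of s n ?t "b$k" k \<omega>] that False by auto
      then have "(\<Sum>n\<in>{s..t}. ?f n) = 0" by (intro sum.neutral) auto
      moreover have "gen_inv (a$k) (b$k) (Ghat s ?t \<omega> k ?v) (U ?t \<omega>) \<in> {a$k..b$k}"
        using Ghat_spec[of s ?t ?v \<omega> k] v U1 step.hyps by (intro gen_inv_in) auto
      ultimately show ?thesis
        unfolding eq using eta_unselected[of s ?t \<omega> k, OF _ _ k] False step.hyps by simp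
    qed
  qed
  then show ?case by (simp add: box_of_def)
qed

end

section \<open>The space of mark sequences\<close>

abbreviation seq_space :: "(int \<Rightarrow> 'n::finite \<times> real) measure" where
  "seq_space \<equiv> PiM UNIV (\<lambda>_. count_space UNIV \<Otimes>\<^sub>M borel)"

definition uniform01 :: "real measure" where
  "uniform01 = uniform_measure lborel {0..1}"

definition mark_law :: "('n::finite \<times> real) measure" where
  "mark_law = uniform_count_measure UNIV \<Otimes>\<^sub>M uniform01"

definition seq_law :: "(int \<Rightarrow> 'n::finite \<times> real) measure" where
  "seq_law = PiM UNIV (\<lambda>_. mark_law)"

lemma sets_uniform01 [simp, measurable_cong]: "sets uniform01 = sets borel"
  by (simp add: uniform01_def)

lemma space_uniform01 [simp]: "space uniform01 = UNIV"
  by (simp add: uniform01_def)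

lemma prob_space_uniform01: "prob_space uniform01"
  unfolding uniform01_def by (intro prob_space_uniform_measure) auto

lemma sets_mark_law [measurable_cong, simp]:
  "sets (mark_law :: ('n::finite \<times> real) measure) = sets (count_space UNIV \<Otimes>\<^sub>M borel)"
  unfolding mark_law_def by (intro sets_pair_measure_cong sets_uniform_count_measure_count_space sets_uniform01)

lemma space_mark_law [simp]: "space mark_law = UNIV"
  by (simp add: mark_law_def space_pair_measure space_uniform_count_measure)

lemma sets_seq_law [measurable_cong, simp]: "sets seq_law = sets seq_space"
  unfolding seq_law_def by (intro sets_PiM_cong) simp_all

lemma space_seq_law [simp]: "space seq_law = UNIV"
  by (simp add: seq_law_def space_PiM)

lemma space_seq_space: "space seq_space = UNIV"
  by (simp add: space_PiM space_pair_measure)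

lemma prob_space_mark_law: "prob_space (mark_law :: ('n::finite \<times> real) measure)"
proof -
  interpret u: prob_space "uniform_count_measure (UNIV :: 'n set)"
    by (intro prob_space_uniform_count_measure) auto
  interpret v: prob_space uniform01 by (rule prob_space_uniform01)
  interpret pair_prob_space "uniform_count_measure (UNIV :: 'n set)" uniform01 ..
  show ?thesis unfolding mark_law_def by unfold_locales
qed

lemma prob_space_seq_law: "prob_space seq_law"
  unfolding seq_law_def by (intro prob_space_PiM prob_space_mark_law)

text \<open>
  The value \<open>u = 0\<close> is excluded because it lies in none of the intervals \<open>(R\<^sub>[\<^sub>n\<^sub>+\<^sub>1\<^sub>,\<^sub>t\<^sub>], R\<^sub>[\<^sub>n\<^sub>,\<^sub>t\<^sub>]]\<close>.
\<close>
lemma AE_uniform01: "AE u in uniform01. 0 < u \<and> u \<le> 1"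
proof -
  have "AE u in lborel. u \<noteq> (0::real)" by (rule AE_lborel_singleton)
  then have "AE u in lborel. u \<in> {0..1::real} \<longrightarrow> 0 < u \<and> u \<le> 1"
    by eventually_elim auto
  then show ?thesis
    unfolding uniform01_def by (subst AE_uniform_measure) auto
qed

lemma emeasure_uniform01:
  assumes "A \<in> sets borel"
  shows "emeasure uniform01 A = emeasure lborel {u. 0 < u \<and> u \<le> 1 \<and> u \<in> A}"
proof -
  have "emeasure uniform01 A = emeasure lborel ({0..1} \<inter> A)"
    unfolding uniform01_def using assms by (subst emeasure_uniform_measure) (auto simp: divide_ennreal_def)
  also have "\<dots> = emeasure lborel {u. 0 < u \<and> u \<le> 1 \<and> u \<in> A}"
  proof (rule emeasure_eq_AE)
    show "AE x in lborel. (x \<in> {0..1} \<inter> A) = (x \<in> {u. 0 < u \<and> u \<le> 1 \<and> u \<in> A})"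
      using AE_lborel_singleton[of "0::real"] by eventually_elim auto
    have "{u. 0 < u \<and> u \<le> 1 \<and> u \<in> A} = {0<..1} \<inter> A" by auto
    then show "{u. 0 < u \<and> u \<le> 1 \<and> u \<in> A} \<in> sets lborel" using assms by simp
  qed (use assms in auto)
  finally show ?thesis .
qed

lemma AE_mark_law: "AE p in mark_law. 0 < snd p \<and> snd p \<le> 1"
proof -
  interpret v: prob_space uniform01 by (rule prob_space_uniform01)
  interpret u: prob_space "uniform_count_measure (UNIV :: 'a set)"
    by (intro prob_space_uniform_count_measure) auto
  interpret pair_prob_space "uniform_count_measure (UNIV :: 'a set)" uniform01 ..
  have "{p \<in> space (uniform_count_measure (UNIV :: 'a set) \<Otimes>\<^sub>M uniform01). 0 < snd p \<and> snd p \<le> 1}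
      \<in> sets (uniform_count_measure UNIV \<Otimes>\<^sub>M uniform01)"
    by measurable
  then show ?thesis unfolding mark_law_def
    by (rule AE_pair_measure) (use AE_uniform01 in simp)
qed

lemma nn_integral_mark_law:
  fixes f :: "'n::finite \<times> real \<Rightarrow> ennreal"
  assumes [measurable]: "f \<in> borel_measurable (count_space UNIV \<Otimes>\<^sub>M borel)"
  shows "(\<integral>\<^sup>+p. f p \<partial>mark_law) = (\<Sum>k\<in>UNIV. ennreal (1 / CARD('n)) * (\<integral>\<^sup>+u. f (k, u) \<partial>uniform01))"
proof -
  interpret prob_space uniform01 by (rule prob_space_uniform01)
  have "f \<in> borel_measurable mark_law" by measurable
  then have "(\<integral>\<^sup>+p. f p \<partial>mark_law) = (\<integral>\<^sup>+k. \<integral>\<^sup>+u. f (k, u) \<partial>uniform01 \<partial>uniform_count_measure UNIV)"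
    unfolding mark_law_def by (rule nn_integral_fst[symmetric])
  then show ?thesis
    unfolding uniform_count_measure_def by (simp add: nn_integral_point_measure_finite)
qed

lemma measurable_fun_upd_seq:
  assumes "f \<in> measurable M seq_space" "h \<in> measurable M (count_space UNIV \<Otimes>\<^sub>M borel)"
  shows "(\<lambda>x. (f x)(t := h x)) \<in> measurable M seq_space"
proof (rule measurable_PiM_single')
  fix i :: int
  have "(\<lambda>x. f x i) \<in> measurable M (count_space UNIV \<Otimes>\<^sub>M borel)"
    by (rule measurable_compose[OF assms(1) measurable_component_singleton]) simp
  then show "(\<lambda>x. ((f x)(t := h x)) i) \<in> measurable M (count_space UNIV \<Otimes>\<^sub>M borel)"
    using assms(2) by (cases "i = t") auto
qed (simp add: space_pair_measure)

text \<open>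
  Overwriting one coordinate of a product sequence by an independent copy preserves the law. Independence
  of the mark at time \<open>t\<close> from the past is used in this form throughout.
\<close>
lemma nn_integral_resample:
  assumes [measurable]: "f \<in> borel_measurable seq_space"
  shows "(\<integral>\<^sup>+w. f w \<partial>seq_law) = (\<integral>\<^sup>+w. \<integral>\<^sup>+p. f (w(t := p)) \<partial>mark_law \<partial>seq_law)"
proof -
  interpret m: prob_space mark_law by (rule prob_space_mark_law)
  interpret s: prob_space seq_law by (rule prob_space_seq_law)
  interpret pair_prob_space mark_law seq_law ..
  have "distr (mark_law \<Otimes>\<^sub>M PiM UNIV (\<lambda>_. mark_law)) (PiM (insert t UNIV) (\<lambda>_. mark_law))
      (\<lambda>(p, w). w(t := p)) = PiM (insert t UNIV) (\<lambda>_. mark_law)"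
    by (intro distr_pair_PiM_eq_PiM prob_space_mark_law)
  then have eq: "distr (mark_law \<Otimes>\<^sub>M seq_law) seq_law (\<lambda>(p, w). w(t := p)) = seq_law"
    by (simp add: seq_law_def)
  have "snd \<in> measurable (mark_law \<Otimes>\<^sub>M seq_law) seq_space" "fst \<in> measurable (mark_law \<Otimes>\<^sub>M seq_law) (count_space UNIV \<Otimes>\<^sub>M borel)"
    using measurable_snd[of mark_law seq_law] measurable_fst[of mark_law seq_law]
    by (simp_all cong: measurable_cong_sets)
  note upd = measurable_fun_upd_seq[OF this, of t]
  have upd': "(\<lambda>(p, w). w(t := p)) \<in> measurable (mark_law \<Otimes>\<^sub>M seq_law) seq_law"
    using upd unfolding measurable_cong_sets[OF refl sets_seq_law] by (simp add: case_prod_beta')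
  have fupd: "(\<lambda>q. f ((snd q)(t := fst q))) \<in> borel_measurable (mark_law \<Otimes>\<^sub>M seq_law)"
    by (rule measurable_compose[OF upd assms])
  have "(\<integral>\<^sup>+w. f w \<partial>seq_law) = (\<integral>\<^sup>+w. f w \<partial>distr (mark_law \<Otimes>\<^sub>M seq_law) seq_law (\<lambda>(p, w). w(t := p)))"
    by (simp only: eq)
  also have "\<dots> = (\<integral>\<^sup>+q. f ((snd q)(t := fst q)) \<partial>(mark_law \<Otimes>\<^sub>M seq_law))"
    by (subst nn_integral_distr[OF upd']) (simp_all add: case_prod_beta)
  also have "\<dots> = (\<integral>\<^sup>+w. \<integral>\<^sup>+p. f (w(t := p)) \<partial>mark_law \<partial>seq_law)"
    using nn_integral_snd[OF fupd] by simp
  finally show ?thesis .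
qed

lemma AE_seq_law: "AE w in seq_law. \<forall>t. 0 < snd (w t) \<and> snd (w t) \<le> 1"
proof (subst AE_all_countable, rule allI)
  fix t :: int
  interpret product_prob_space "\<lambda>_::int. mark_law" UNIV
    by (intro product_prob_spaceI prob_space_mark_law)
  show "AE w in seq_law. 0 < snd (w t) \<and> snd (w t) \<le> 1"
    unfolding seq_law_def by (rule AE_component[OF _ AE_mark_law]) simp
qed

lemma pred_vec_le:
  fixes f h :: "'a \<Rightarrow> real^'n"
  assumes [measurable]: "f \<in> borel_measurable M" "h \<in> borel_measurable M"
  shows "Measurable.pred M (\<lambda>w. \<forall>i. f w $ i \<le> h w $ i)"
  by measurable

lemma sublevel_Ioc_sets:
  fixes f :: "real \<Rightarrow> real"
  assumes [measurable]: "f \<in> borel_measurable borel"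
  shows "{u. 0 < u \<and> u \<le> r \<and> f u \<le> x} \<in> sets lborel"
  by measurable

section \<open>Measurability of the boxes and the law of the chosen point\<close>

locale gibbs_canonical =
  gibbs_driven a b g "\<lambda>t w. fst (w t)" "\<lambda>t w. snd (w t)" for a b :: "real^'n" and g
begin

abbreviation "zet \<equiv> zeta a b g (\<lambda>t w. fst (w t)) (\<lambda>t w. snd (w t))"

lemma site_measurable: "(\<lambda>w. fst (w t)) \<in> measurable seq_space (count_space (UNIV :: 'n set))"
  and uniform_measurable: "(\<lambda>w::int \<Rightarrow> 'n \<times> real. snd (w t)) \<in> borel_measurable seq_space"
  by measurable

lemma Rk_measurable_aux:
  assumes "lo s (t-1) \<in> borel_measurable seq_space" "hi s (t-1) \<in> borel_measurable seq_space"
    and "x \<in> {a$k..b$k}"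
  shows "(\<lambda>w. Rk s t w k x) \<in> borel_measurable seq_space"
proof -
  have "(\<lambda>w. RF k x (et s (t-1) w)) \<in> borel_measurable seq_space"
    using R_fun_measurable[OF assms corners_lo_hi] by (simp add: eta_eq_Icc[symmetric])
  then show ?thesis unfolding Rk_def by (cases "t \<le> s") simp_all
qed

lemma lo_init: "t \<le> s \<Longrightarrow> lo s t w = a" and hi_init: "t \<le> s \<Longrightarrow> hi s t w = b"
  by (simp_all add: lo_def hi_def eta_init vec_eq_iff)

text \<open>
  The two corners are followed through the recursion for the box. The inverse of \<open>D\<^sub>[\<^sub>s\<^sub>,\<^sub>t\<^sub>]\<close> enters only on the
  event \<open>U\<^sub>t \<le> R\<^sub>[\<^sub>s\<^sub>,\<^sub>t\<^sub>]\<close>, where it exists.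
\<close>
lemma lo_hi_measurable:
  "lo s t \<in> borel_measurable seq_space \<and> hi s t \<in> borel_measurable seq_space"
proof (induction "nat (t - s)" arbitrary: s t rule: less_induct)
  case less
  show ?case
  proof (cases "s < t")
    case False
    then have "lo s t = (\<lambda>_. a)" "hi s t = (\<lambda>_. b)" using lo_init hi_init by auto
    then show ?thesis by simp
  next
    case True
    have corners: "lo s (t-1) \<in> borel_measurable seq_space" "hi s (t-1) \<in> borel_measurable seq_space"
      "lo (s+1) t \<in> borel_measurable seq_space" "hi (s+1) t \<in> borel_measurable seq_space"
      using True less[of "t-1" s] less[of t "s+1"] by auto
    have "lo (s+1) (t-1) \<in> borel_measurable seq_space \<and> hi (s+1) (t-1) \<in> borel_measurable seq_space"
      using True by (intro less) auto
    then have R: "(\<lambda>w. Rk s t w k x) \<in> borel_measurable seq_space"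
      "(\<lambda>w. Rk (s+1) t w k x) \<in> borel_measurable seq_space" if "x \<in> {a$k..b$k}" for k x
      using corners by (intro Rk_measurable_aux that; simp)+
    define D where "D k w = (if snd (w t) \<le> Rk s t w k (b$k)
      then gen_inv (a$k) (b$k) (Dk s t w k) (snd (w t)) else 0)" for k and w :: "int \<Rightarrow> 'n \<times> real"
    have D: "D k \<in> borel_measurable seq_space" for k
      unfolding D_def
    proof (rule gen_inv_measurable)
      show "(\<lambda>w. Dk s t w k x) \<in> borel_measurable seq_space" if "x \<in> {a$k..b$k}" for x
        unfolding Dk_def using R[of x k] R[of "b$k" k] that by simp

      show "{w \<in> space seq_space. snd (w t) \<le> Rk s t w k (b$k)} \<in> sets seq_space"
        by (intro borel_measurable_le uniform_measurable R) simp
    qed (use Dk_continuous Dk_mono Dk_right True uniform_measurable in auto)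
    have eqs: "lo s t w $ k = (if k \<noteq> fst (w t) then lo s (t-1) w $ k
      else if snd (w t) \<le> Rk (s+1) t w k (b$k) then lo (s+1) t w $ k
      else if snd (w t) \<le> Rk s t w k (b$k) then D k w else a $ k)"
      "hi s t w $ k = (if k \<noteq> fst (w t) then hi s (t-1) w $ k
      else if snd (w t) \<le> Rk (s+1) t w k (b$k) then hi (s+1) t w $ k
      else if snd (w t) \<le> Rk s t w k (b$k) then D k w else b $ k)" for w k
      by (auto simp: lo_def hi_def eta_step[OF True] D_def)
    have preds: "{w \<in> space seq_space. k \<noteq> fst (w t)} \<in> sets seq_space"
      "{w \<in> space seq_space. snd (w t) \<le> Rk (s+1) t w k (b$k)} \<in> sets seq_space"
      "{w \<in> space seq_space. snd (w t) \<le> Rk s t w k (b$k)} \<in> sets seq_space" for k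
    proof -
      have "Measurable.pred seq_space (\<lambda>w. k \<noteq> fst (w t))"
        by (rule measurable_compose[OF site_measurable]) simp
      then show "{w \<in> space seq_space. k \<noteq> fst (w t)} \<in> sets seq_space"
        by (simp add: pred_def)
    qed (intro borel_measurable_le uniform_measurable R; simp)+
    show ?thesis
      by (intro conjI borel_measurable_vecI; simp only: eqs)
        (intro measurable_If preds borel_measurable_vec_nth borel_measurable_const corners D)+
  qed
qed

lemma lo_measurable [measurable]: "lo s t \<in> borel_measurable seq_space"
  and hi_measurable [measurable]: "hi s t \<in> borel_measurable seq_space"
  using lo_hi_measurable by auto

lemma Rk_measurable: "x \<in> {a$k..b$k} \<Longrightarrow> (\<lambda>w. Rk s t w k x) \<in> borel_measurable seq_space"
  by (intro Rk_measurable_aux lo_measurable hi_measurable)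

lemma coupled_measurable [measurable]: "Measurable.pred seq_space (cpl s t)"
proof -
  have "cpl s t = (\<lambda>w. s < t \<and> (\<forall>i. hi s t w $ i \<le> lo s t w $ i))"
    using corners_lo_hi[of s t]
    by (auto simp: fun_eq_iff coupled_iff vec_eq_iff corners_def intro: order_antisym)
  moreover have "Measurable.pred seq_space (\<lambda>w. s < t \<and> (\<forall>i. hi s t w $ i \<le> lo s t w $ i))"
    by (intro pred_intros_logic pred_vec_le lo_measurable hi_measurable) simp
  ultimately show ?thesis by simp
qed

lemma zeta_measurable [measurable]: "zet t \<in> borel_measurable seq_space"
proof (rule measurableI)
  fix B :: "(real^'n) set" assume [measurable]: "B \<in> sets borel"
  have gen: "{w \<in> space M. (\<exists>s::int. c s w \<and> l s w \<in> B) \<or> (\<forall>s. \<not> c s w) \<and> a \<in> B} \<in> sets M"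
    if [measurable]: "\<And>s. Measurable.pred M (c s)" "\<And>s. l s \<in> borel_measurable M"
    for M :: "(int \<Rightarrow> 'n \<times> real) measure" and c l
    by measurable
  have "zet t -` B \<inter> space seq_space = {w \<in> space seq_space.
      (\<exists>s. cpl s t w \<and> lo s t w \<in> B) \<or> (\<forall>s. \<not> cpl s t w) \<and> a \<in> B}"
  proof (rule set_eqI)
    fix w
    show "w \<in> zet t -` B \<inter> space seq_space \<longleftrightarrow> w \<in> {w \<in> space seq_space.
        (\<exists>s. cpl s t w \<and> lo s t w \<in> B) \<or> (\<forall>s. \<not> cpl s t w) \<and> a \<in> B}"
    proof (cases "\<exists>s. cpl s t w")
      case True
      then obtain s where s: "cpl s t w" ..
      then have "(\<exists>s. cpl s t w \<and> lo s t w \<in> B) \<longleftrightarrow> zet t w \<in> B"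
        using zeta_coupled by metis
      with s show ?thesis by (auto simp del: ex_simps)
    next
      case False
      then show ?thesis using zeta_uncoupled[of t w] by auto
    qed
  qed
  also have "\<dots> \<in> sets seq_space" by (intro gen coupled_measurable lo_measurable)
  finally show "zet t -` B \<inter> space seq_space \<in> sets seq_space" .
qed simp

lemma eta_upd: "r < t \<Longrightarrow> et s r (w(t := p)) = et s r w"
  using eta_cong[of s r "\<lambda>t w. fst (w t)" "w(t := p)" "\<lambda>t w. fst (w t)" 0 w
      "\<lambda>t w. snd (w t)" "\<lambda>t w. snd (w t)" a b g] by auto

lemma Rk_upd: "Rk s t (w(t := p)) k x = Rk s t w k x"
  by (simp add: Rk_def eta_upd)

lemma Dk_upd: "Dk s t (w(t := p)) k x = Dk s t w k x"
  by (simp add: Dk_def Rk_upd)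

lemma Ghat_upd: "Ghat s t (w(t := p)) k v x = Ghat s t w k v x"
  by (simp add: Ghat_def Rk_upd)

lemma coupled_upd: "r < t \<Longrightarrow> cpl s r (w(t := p)) = cpl s r w"
  by (simp add: coupled_def eta_upd)

lemma zeta_upd: "r < t \<Longrightarrow> zet r (w(t := p)) = zet r w"
  by (simp add: zeta_def tau_def eta_upd coupled_upd)

lemma mark_section_measurable: "(\<lambda>u. w(t := (k, u))) \<in> measurable borel seq_space"
  by (rule measurable_fun_upd_seq) (auto simp: space_seq_space)

text \<open>
  The core computation. On the interval \<open>(R\<^sub>[\<^sub>i\<^sub>,\<^sub>t\<^sub>], R\<^sub>[\<^sub>i\<^sub>-\<^sub>1\<^sub>,\<^sub>t\<^sub>]]\<close> the chosen point is at most \<open>x\<close> iff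
  \<open>u \<le> D\<^sub>[\<^sub>i\<^sub>-\<^sub>1\<^sub>,\<^sub>t\<^sub>](x)\<close>, which contributes the length \<open>D\<^sub>[\<^sub>i\<^sub>-\<^sub>1\<^sub>,\<^sub>t\<^sub>](x) - R\<^sub>[\<^sub>i\<^sub>,\<^sub>t\<^sub>] = R\<^sub>[\<^sub>i\<^sub>-\<^sub>1\<^sub>,\<^sub>t\<^sub>](x) - R\<^sub>[\<^sub>i\<^sub>,\<^sub>t\<^sub>](x)\<close>; these
  lengths telescope.
\<close>
lemma selected_law:
  assumes "n \<le> t" and x: "x \<in> {a$k..b$k}"
  shows "emeasure lborel {u. 0 < u \<and> u \<le> Rk n t w k (b$k) \<and> lo n t (w(t := (k, u))) $ k \<le> x}
    = ennreal (Rk n t w k x)"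
  using assms(1)
proof (induction n rule: int_le_induct)
  case base
  have "{u. 0 < u \<and> u \<le> Rk t t w k (b$k) \<and> lo t t (w(t := (k, u))) $ k \<le> x} = {}"
    by (auto simp: Rk_def)
  then show ?case by (simp only:) (simp add: Rk_def)
next
  case (step i)
  let ?A = "\<lambda>n. {u. 0 < u \<and> u \<le> Rk n t w k (b$k) \<and> lo n t (w(t := (k, u))) $ k \<le> x}"
  let ?r = "Rk i t w k (b$k)" and ?r' = "Rk (i-1) t w k (b$k)" and ?D = "Dk (i-1) t w k x"
  have i: "i - 1 < t" using step by simp
  have rr': "?r \<le> ?r'" using Rk_antimono_start[of "i-1" i t "b$k" k w] step by simp
  have r0: "0 \<le> ?r" by (simp add: Rk_nonneg)
  have xb: "?D \<le> ?r'"
    using mono_onD[OF Dk_mono[OF i, of k w], of x "b$k"] x Dk_right[OF i, of w k] by simp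
  have ax: "?r \<le> ?D"
    using mono_onD[OF Dk_mono[OF i, of k w], of "a$k" x] x by (simp add: Dk_def)
  \<comment> \<open>below the old level nothing changes; above it the chosen point is the inverse of \<open>D\<close>\<close>
  have "?A (i-1) = ?A i \<union> {?r<..?D}"
  proof (rule set_eqI)
    fix u
    let ?w = "w(t := (k, u))"
    consider "u \<le> ?r" | "?r < u" "u \<le> ?r'" | "?r' < u" by linarith
    then show "u \<in> ?A (i-1) \<longleftrightarrow> u \<in> ?A i \<union> {?r<..?D}"
    proof cases
      case 1
      have "lo (i-1) t ?w $ k = lo i t ?w $ k"
        using 1 i by (simp add: lo_def eta_step Rk_upd)
      then show ?thesis using 1 rr' by auto
    next
      case 2
      have "et (i-1) t ?w k = {gen_inv (a$k) (b$k) (Dk (i-1) t ?w k) u}"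
        using 2 i by (simp add: eta_step Rk_upd)
      then have "lo (i-1) t ?w $ k = gen_inv (a$k) (b$k) (Dk (i-1) t ?w k) u"
        by (simp add: lo_def)
      moreover have "gen_inv (a$k) (b$k) (Dk (i-1) t ?w k) u \<le> x \<longleftrightarrow> u \<le> Dk (i-1) t ?w k x"
        using i x 2(2) Dk_continuous Dk_mono Dk_right[OF i, of ?w k]
        by (intro gen_inv_le_iff) (auto simp: Rk_upd)
      ultimately show ?thesis using 2 r0 by (auto simp: Dk_upd)
    next
      case 3
      then show ?thesis using xb rr' by auto
    qed
  qed
  moreover have "?A i \<in> sets lborel"
    by (intro sublevel_Ioc_sets borel_measurable_vec_nth measurable_compose[OF mark_section_measurable lo_measurable])
  moreover have "?A i \<inter> {?r<..?D} = {}" by auto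
  ultimately have "emeasure lborel (?A (i-1)) = emeasure lborel (?A i) + emeasure lborel {?r<..?D}"
    by (simp only:) (intro plus_emeasure[symmetric], auto)
  also have "\<dots> = ennreal (Rk i t w k x) + ennreal (?D - ?r)"
    unfolding step.IH using ax by (simp only: emeasure_lborel_Ioc)
  also have "\<dots> = ennreal (Rk (i-1) t w k x)"
    using ax x by (subst ennreal_plus[symmetric]) (auto simp: Rk_nonneg Dk_def)
  finally show ?case .
qed

text \<open>
  The value given to coordinate \<open>k\<close> at time \<open>t\<close> by a chain started at time \<open>s\<close> and now at \<open>v\<close>: it is the value
  prescribed for \<^const>\<open>zeta_from\<close>, with the point of the box in place of the sum. The last branch is a
  convention; it is not reached if the mark is at most 1 and \<open>v\<close> lies in the current box.
\<close>
definition new_value :: "int \<Rightarrow> int \<Rightarrow> 'n \<Rightarrow> (int \<Rightarrow> 'n \<times> real) \<Rightarrow> real^'n \<Rightarrow> real" where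
  "new_value s t k w v =
     (if snd (w t) \<le> Rk s t w k (b$k) then lo s t w $ k
      else if snd (w t) \<le> 1 \<and> v \<in> box_of (et s (t-1) w)
        then gen_inv (a$k) (b$k) (Ghat s t w k v) (snd (w t))
      else a $ k)"

definition move :: "int \<Rightarrow> int \<Rightarrow> (int \<Rightarrow> 'n \<times> real) \<Rightarrow> real^'n \<Rightarrow> real^'n" where
  "move s t w v = upd v (fst (w t)) (new_value s t (fst (w t)) w v)"

lemma new_value_in:
  assumes "s < t"
  shows "new_value s t k w v \<in> {a$k..b$k}"
proof -
  have "lo s t w $ k \<in> {a$k..b$k}"
    using lo_in_eta box_of_eta_subset by (meson in_state_iff subsetD)
  moreover have "gen_inv (a$k) (b$k) (Ghat s t w k v) (snd (w t)) \<in> {a$k..b$k}"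
    if "v \<in> box_of (et s (t-1) w)" "snd (w t) \<le> 1"
    using that assms Ghat_spec[of s t v w k] by (intro gen_inv_in) auto
  ultimately show ?thesis by (auto simp: new_value_def)
qed

lemma move_in_eta:
  assumes "s < t" "v \<in> box_of (et s (t-1) w)"
  shows "move s t w v \<in> box_of (et s t w)"
proof -
  have "move s t w v $ k \<in> et s t w k" for k
  proof (cases "k = fst (w t)")
    case True
    have "lo s t w $ k \<in> et s t w k" using lo_in_eta[of s t w] by (auto simp: box_of_def)
    moreover have "et s t w k = {a$k..b$k}" if "Rk s t w k (b$k) < snd (w t)"
      using eta_unselected assms that True by auto
    ultimately show ?thesis
      using True new_value_in[OF assms(1), of k w v]
      by (cases "snd (w t) \<le> Rk s t w k (b$k)") (auto simp: move_def new_value_def)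
  next
    case False
    then show ?thesis using assms by (simp add: move_def eta_step box_of_def)
  qed
  then show ?thesis by (simp add: box_of_def)
qed

lemma new_value_measurable:
  assumes "s < t" and f: "f \<in> measurable M seq_space" and h: "h \<in> borel_measurable M"
  shows "(\<lambda>x. new_value s t k (f x) (h x)) \<in> borel_measurable M"
proof -
  note * = measurable_compose[OF f]
  have R: "(\<lambda>w. Rk s t (f w) k x) \<in> borel_measurable M" if "x \<in> {a$k..b$k}" for x
    by (intro * Rk_measurable that)
  have U: "(\<lambda>w. snd (f w t)) \<in> borel_measurable M" by (intro * uniform_measurable)
  have small: "{x \<in> space M. snd (f x t) \<le> Rk s t (f x) k (b$k)} \<in> sets M"
    by (intro borel_measurable_le U R) simp
  have "Measurable.pred M (\<lambda>x. snd (f x t) \<le> 1 \<and>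
      (\<forall>i. lo s (t-1) (f x) $ i \<le> h x $ i) \<and> (\<forall>i. h x $ i \<le> hi s (t-1) (f x) $ i))"
    by (intro pred_intros_logic pred_vec_le h * lo_measurable hi_measurable)
       (use borel_measurable_le[OF U borel_measurable_const[of 1]] in \<open>simp add: pred_def\<close>)
  then have large: "{x \<in> space M. snd (f x t) \<le> 1 \<and> h x \<in> box_of (et s (t-1) (f x))} \<in> sets M"
    by (simp add: pred_def box_of_eta_iff all_conj_distrib)
  have "(\<lambda>x. if snd (f x t) \<le> 1 \<and> h x \<in> box_of (et s (t-1) (f x))
      then gen_inv (a$k) (b$k) (Ghat s t (f x) k (h x)) (snd (f x t)) else a$k) \<in> borel_measurable M"
  proof (rule gen_inv_measurable)
    show "(\<lambda>w. Ghat s t (f w) k (h w) x) \<in> borel_measurable M" if "x \<in> {a$k..b$k}" for x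
      unfolding Ghat_def
      by (intro borel_measurable_diff borel_measurable_add R that cond_cdf_measurable h) simp
  qed (use Ghat_spec assms(1) large U in auto)
  then show ?thesis
    unfolding new_value_def
    by (intro measurable_If[OF _ _ small] borel_measurable_vec_nth * lo_measurable)
qed

lemma move_measurable:
  assumes "s < t" and "f \<in> measurable M seq_space" "h \<in> borel_measurable M"
  shows "(\<lambda>x. move s t (f x) (h x)) \<in> borel_measurable M"
  unfolding move_def
  by (rule measurable_compose_countable[where f="\<lambda>k x. upd (h x) k (new_value s t k (f x) (h x))"])
     (intro upd_measurable new_value_measurable assms measurable_compose[OF assms(2) site_measurable])+

end

section \<open>An update is a step of the Gibbs sampler\<close>

context gibbs_target
begin

lemma site_update_prob_measurable [measurable (raw)]:
  assumes [measurable]: "f \<in> borel_measurable M" and C[measurable]: "C \<in> sets borel"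
  shows "(\<lambda>w. site_update_prob a b g k (f w) C) \<in> borel_measurable M"
proof -
  have "(\<lambda>x. site_update_prob a b g k x C) \<in> borel_measurable borel"
    unfolding site_update_prob_def set_lebesgue_integral_def by measurable
  then show ?thesis by (rule measurable_compose[OF assms(1)])
qed

lemma ennreal_site_update_prob:
  assumes v: "v \<in> cbox a b" and C[measurable]: "C \<in> sets borel"
  shows "ennreal (site_update_prob a b g k v C) =
    (\<integral>\<^sup>+y. indicator C (upd v k y) * ennreal (indicator {a$k..b$k} y * cd k y v) \<partial>lborel)"
    and "0 \<le> site_update_prob a b g k v C"
proof -
  let ?f = "\<lambda>y. indicator {a$k..b$k} y *\<^sub>R (indicator C (upd v k y) * cd k y v)"
  have "integrable lborel (\<lambda>y. indicator {a$k..b$k} y *\<^sub>R cd k y v)"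
    using cond_dens_integrable[OF v, of k] by (simp add: set_integrable_def)
  then have i: "integrable lborel ?f"
    by (rule Bochner_Integration.integrable_bound) (auto simp: indicator_def)
  have nn: "0 \<le> ?f y" for y using cond_dens_nonneg[OF v] by (simp add: indicator_def)
  have "ennreal (site_update_prob a b g k v C) = (\<integral>\<^sup>+y. ennreal (?f y) \<partial>lborel)"
    unfolding site_update_prob_def set_lebesgue_integral_def
    by (rule nn_integral_eq_integral[symmetric, OF i]) (simp add: cond_dens_nonneg[OF v])
  also have "\<dots> = (\<integral>\<^sup>+y. indicator C (upd v k y) * ennreal (indicator {a$k..b$k} y * cd k y v) \<partial>lborel)"
    by (intro nn_integral_cong) (simp add: indicator_def)
  finally show "ennreal (site_update_prob a b g k v C) =
    (\<integral>\<^sup>+y. indicator C (upd v k y) * ennreal (indicator {a$k..b$k} y * cd k y v) \<partial>lborel)" .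
  show "0 \<le> site_update_prob a b g k v C"
    unfolding site_update_prob_def set_lebesgue_integral_def
    by (intro Bochner_Integration.integral_nonneg nn)
qed

lemma emeasure_cond_density_atMost:
  assumes v: "v \<in> cbox a b" and x: "x \<in> {a$k..b$k}"
  shows "(\<integral>\<^sup>+y. ennreal (indicator {a$k..b$k} y * cd k y v) * indicator {..x} y \<partial>lborel) = ennreal (cdf_of k x v)"
proof -
  have i: "integrable lborel (\<lambda>y. indicator {a$k..x} y *\<^sub>R cd k y v)"
    using set_integrable_Icc_subset[OF cond_dens_integrable[OF v, of k], of "a$k" x] x
    by (simp add: set_integrable_def)
  have "(\<integral>\<^sup>+y. ennreal (indicator {a$k..b$k} y * cd k y v) * indicator {..x} y \<partial>lborel)
      = (\<integral>\<^sup>+y. ennreal (indicator {a$k..x} y *\<^sub>R cd k y v) \<partial>lborel)"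
    using x by (intro nn_integral_cong) (auto simp: indicator_def)
  also have "\<dots> = ennreal (cdf_of k x v)"
    unfolding cond_cdf_def set_lebesgue_integral_def
    by (rule nn_integral_eq_integral[OF i]) (simp add: cond_dens_nonneg[OF v])
  finally show ?thesis .
qed

definition cond_law :: "'n \<Rightarrow> real^'n \<Rightarrow> real measure" where
  "cond_law k v = density lborel (\<lambda>y. ennreal (indicator {a$k..b$k} y * cd k y v))"

lemma sets_cond_law [simp, measurable_cong]: "sets (cond_law k v) = sets borel"
  by (simp add: cond_law_def)

lemma space_cond_law [simp]: "space (cond_law k v) = UNIV"
  by (simp add: cond_law_def)

lemma emeasure_cond_law_atMost:
  assumes "v \<in> cbox a b" "x \<in> {a$k..b$k}"
  shows "emeasure (cond_law k v) {..x} = ennreal (cdf_of k x v)"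
  unfolding cond_law_def using emeasure_cond_density_atMost[OF assms] by (simp add: emeasure_density)

lemma cond_law_UNIV:
  assumes "v \<in> cbox a b"
  shows "emeasure (cond_law k v) UNIV = 1"
proof -
  have "emeasure (cond_law k v) UNIV = emeasure (cond_law k v) {..b$k}"
    unfolding cond_law_def
    by (simp add: emeasure_density, intro nn_integral_cong) (auto simp: indicator_def)
  also have "\<dots> = 1"
    by (subst emeasure_cond_law_atMost[OF assms]) (simp_all add: assms)
  finally show ?thesis .
qed

lemma cond_law_below: "x < a$k \<Longrightarrow> emeasure (cond_law k v) {..x} = 0"
  unfolding cond_law_def
  by (simp add: emeasure_density, subst nn_integral_0_iff_AE) (auto simp: indicator_def)

end

context gibbs_canonical
begin

text \<open>
  Up to level \<open>R\<^sub>[\<^sub>s\<^sub>,\<^sub>t\<^sub>]\<close> the chosen point contributes \<open>R\<^sub>[\<^sub>s\<^sub>,\<^sub>t\<^sub>](x)\<close>; the inverse of \<open>G_hat\<close> on the remaining levels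
  contributes \<open>G_hat(x) - R\<^sub>[\<^sub>s\<^sub>,\<^sub>t\<^sub>] = G\<^sub>k(x|v) - R\<^sub>[\<^sub>s\<^sub>,\<^sub>t\<^sub>](x)\<close>. Hence an update from any point of the box is an exact draw from
  the conditional distribution.
\<close>
lemma new_value_cdf:
  assumes st: "s < t" and v: "v \<in> box_of (et s (t-1) w)" and x: "x \<in> {a$k..b$k}"
  shows "emeasure lborel {u. 0 < u \<and> u \<le> 1 \<and> new_value s t k (w(t := (k, u))) v \<le> x} = ennreal (cdf_of k x v)"
proof -
  let ?A = "{u. 0 < u \<and> u \<le> Rk s t w k (b$k) \<and> lo s t (w(t := (k, u))) $ k \<le> x}"
  let ?r = "Rk s t w k (b$k)" and ?G = "Ghat s t w k v"
  note G = Ghat_spec[OF st v]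
  have Ga: "?G (a$k) = ?r" by (simp add: Ghat_def)
  have r1: "?r \<le> ?G x" "?G x \<le> 1" "?r \<le> 1"
    using mono_onD[OF G(2)[of k], of "a$k" x] mono_onD[OF G(2)[of k], of x "b$k"]
      mono_onD[OF G(2)[of k], of "a$k" "b$k"] x G(3)[of k] Ga by auto
  have r0: "0 \<le> ?r" by (simp add: Rk_nonneg)
  have "{u. 0 < u \<and> u \<le> 1 \<and> new_value s t k (w(t := (k, u))) v \<le> x} = ?A \<union> {?r<..?G x}"
  proof (rule set_eqI)
    fix u
    consider "u \<le> ?r" | "?r < u" "u \<le> 1" | "1 < u" by linarith
    then show "u \<in> {u. 0 < u \<and> u \<le> 1 \<and> new_value s t k (w(t := (k, u))) v \<le> x} \<longleftrightarrow> u \<in> ?A \<union> {?r<..?G x}"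
    proof cases
      case 1
      then show ?thesis using r1 by (auto simp: new_value_def Rk_upd)
    next
      case 2
      have "new_value s t k (w(t := (k, u))) v = gen_inv (a$k) (b$k) ?G u"
        using 2 v by (simp add: new_value_def Rk_upd eta_upd Ghat_upd[abs_def])
      moreover have "gen_inv (a$k) (b$k) ?G u \<le> x \<longleftrightarrow> u \<le> ?G x"
        using G x 2 by (intro gen_inv_le_iff) auto
      ultimately show ?thesis using 2 r0 by auto
    next
      case 3
      then show ?thesis using r1 by auto
    qed
  qed
  moreover have "?A \<in> sets lborel"
    by (intro sublevel_Ioc_sets borel_measurable_vec_nth measurable_compose[OF mark_section_measurable lo_measurable])
  moreover have "?A \<inter> {?r<..?G x} = {}" by auto
  ultimately have "emeasure lborel {u. 0 < u \<and> u \<le> 1 \<and> new_value s t k (w(t := (k, u))) v \<le> x}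
      = emeasure lborel ?A + emeasure lborel {?r<..?G x}"
    by (simp only:) (intro plus_emeasure[symmetric], auto)
  also have "\<dots> = ennreal (Rk s t w k x) + ennreal (?G x - ?r)"
    using selected_law[of s t x k w] st x r1 by simp
  also have "\<dots> = ennreal (cdf_of k x v)"
    using r1 x by (subst ennreal_plus[symmetric]) (auto simp: Rk_nonneg Ghat_def)
  finally show ?thesis .
qed

lemma new_value_section_measurable:
  "s < t \<Longrightarrow> (\<lambda>u. new_value s t k (w(t := (k, u))) v) \<in> borel_measurable borel"
  by (intro new_value_measurable mark_section_measurable) auto

lemma new_value_law:
  assumes st: "s < t" and v: "v \<in> box_of (et s (t-1) w)"
  shows "distr uniform01 borel (\<lambda>u. new_value s t k (w(t := (k, u))) v) = cond_law k v"
proof -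
  let ?X = "\<lambda>u. new_value s t k (w(t := (k, u))) v"
  have v': "v \<in> cbox a b" using v box_of_eta_subset by blast
  have X[measurable]: "?X \<in> borel_measurable borel"
    by (rule new_value_section_measurable[OF st])
  have inn: "a$k \<le> ?X u" "?X u \<le> b$k" for u
    using new_value_in[OF st, of k "w(t := (k, u))" v] by auto
  interpret u: prob_space uniform01 by (rule prob_space_uniform01)
  have D: "emeasure (distr uniform01 borel ?X) {..x} = emeasure lborel {u. 0 < u \<and> u \<le> 1 \<and> ?X u \<le> x}" for x
  proof -
    have "emeasure (distr uniform01 borel ?X) {..x} = emeasure uniform01 (?X -` {..x})"
      by (subst emeasure_distr) auto
    also have "\<dots> = emeasure lborel {u. 0 < u \<and> u \<le> 1 \<and> ?X u \<le> x}"
      using measurable_sets[OF X, of "{..x}"] by (subst emeasure_uniform01) auto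
    finally show ?thesis .
  qed
  interpret d: prob_space "distr uniform01 borel ?X" by (rule u.prob_space_distr) simp
  interpret c: prob_space "cond_law k v" by standard (simp add: cond_law_UNIV[OF v'])
  have "emeasure (distr uniform01 borel ?X) {..x} = emeasure (cond_law k v) {..x}" for x
  proof -
    consider "x < a$k" | "x \<in> {a$k..b$k}" | "x > b$k" by force
    then show ?thesis
    proof cases
      case 1
      then have "{u. 0 < u \<and> u \<le> 1 \<and> ?X u \<le> x} = {}" using inn(1) by (auto simp: not_le intro: less_le_trans)
      then show ?thesis using 1 by (simp only: D cond_law_below emeasure_empty)
    next
      case 2
      then show ?thesis by (simp add: D new_value_cdf[OF st v] emeasure_cond_law_atMost[OF v'])
    next
      case 3
      have "{u. 0 < u \<and> u \<le> 1 \<and> ?X u \<le> x} = {u. 0 < u \<and> u \<le> 1 \<and> ?X u \<le> b$k}"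
        using order_trans[OF inn(2), of x] inn(2) 3 by auto
      then have "emeasure (distr uniform01 borel ?X) {..x} = 1"
        using v' by (simp only: D new_value_cdf[OF st v]) (subst new_value_cdf[OF st v], simp_all)
      moreover have "emeasure (cond_law k v) {..x} = 1"
      proof (rule antisym)
        have "emeasure (cond_law k v) {..b$k} \<le> emeasure (cond_law k v) {..x}"
          using 3 by (intro emeasure_mono) auto
        moreover have "emeasure (cond_law k v) {..b$k} = 1"
          by (subst emeasure_cond_law_atMost[OF v']) (simp_all add: v')
        ultimately show "1 \<le> emeasure (cond_law k v) {..x}" by simp
      qed (rule c.emeasure_le_1)
      ultimately show ?thesis by simp
    qed
  qed
  then have "cdf (distr uniform01 borel ?X) = cdf (cond_law k v)"
    by (simp add: fun_eq_iff cdf_def measure_def)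
  moreover have "real_distribution (distr uniform01 borel ?X)" "real_distribution (cond_law k v)"
    by (simp_all add: real_distribution_def real_distribution_axioms_def d.prob_space_axioms c.prob_space_axioms)
  ultimately show ?thesis by (intro cdf_unique)
qed

lemma move_section_measurable:
  "s < t \<Longrightarrow> (\<lambda>p. move s t (w(t := p)) v) \<in> borel_measurable (count_space UNIV \<Otimes>\<^sub>M borel)"
  by (intro move_measurable measurable_fun_upd_seq) (auto simp: space_seq_space)

text \<open>
  One step of the Gibbs sampler from \<open>v\<close>, obtained by integrating out the mark at time \<open>t\<close> alone; the past
  enters only through the condition that \<open>v\<close> lies in the current box.
\<close>
lemma site_step:
  assumes st: "s < t" and v: "v \<in> box_of (et s (t-1) w)" and C[measurable]: "C \<in> sets borel"
  shows "(\<integral>\<^sup>+p. indicator {k} (fst p) * indicator C (move s t (w(t := p)) v) \<partial>mark_law) =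
    ennreal (site_update_prob a b g k v C / CARD('n))"
proof -
  let ?X = "\<lambda>u. new_value s t k (w(t := (k, u))) v"
  let ?f = "\<lambda>p. indicator {k} (fst p) * indicator C (move s t (w(t := p)) v) :: ennreal"
  have v': "v \<in> cbox a b" using v box_of_eta_subset by blast
  have [measurable]: "(\<lambda>p. move s t (w(t := p)) v) \<in> borel_measurable (count_space UNIV \<Otimes>\<^sub>M borel)"
    by (rule move_section_measurable[OF st])
  have X[measurable]: "?X \<in> borel_measurable borel"
    by (rule new_value_section_measurable[OF st])
  have "(\<integral>\<^sup>+p. ?f p \<partial>mark_law) = (\<Sum>j\<in>UNIV. ennreal (1 / CARD('n)) * (\<integral>\<^sup>+u. ?f (j, u) \<partial>uniform01))"
    by (rule nn_integral_mark_law) measurable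
  also have "\<dots> = (\<Sum>j\<in>UNIV. if j = k then ennreal (1 / CARD('n)) * (\<integral>\<^sup>+u. ?f (k, u) \<partial>uniform01) else 0)"
    by (intro sum.cong) auto
  also have "\<dots> = ennreal (1 / CARD('n)) * (\<integral>\<^sup>+u. indicator C (upd v k (?X u)) \<partial>uniform01)"
    by (simp add: move_def)
  also have "(\<integral>\<^sup>+u. indicator C (upd v k (?X u)) \<partial>uniform01) = (\<integral>\<^sup>+y. indicator C (upd v k y) \<partial>distr uniform01 borel ?X)"
    by (subst nn_integral_distr) auto
  also have "\<dots> = (\<integral>\<^sup>+y. indicator C (upd v k y) * ennreal (indicator {a$k..b$k} y * cd k y v) \<partial>lborel)"
    unfolding new_value_law[OF st v] cond_law_def
    by (subst nn_integral_density) (auto simp: mult.commute)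
  also have "\<dots> = ennreal (site_update_prob a b g k v C)"
    by (rule ennreal_site_update_prob(1)[symmetric, OF v' C])
  also have "ennreal (1 / CARD('n)) * ennreal (site_update_prob a b g k v C) =
      ennreal (site_update_prob a b g k v C / CARD('n))"
    using ennreal_site_update_prob(2)[OF v' C] by (simp add: ennreal_mult'[symmetric])
  finally show ?thesis .
qed

lemma kernel_step:
  assumes st: "s < t" and v: "v \<in> box_of (et s (t-1) w)" and C[measurable]: "C \<in> sets borel"
  shows "(\<integral>\<^sup>+p. indicator C (move s t (w(t := p)) v) \<partial>mark_law) = ennreal (gibbs_kernel a b g v C)"
proof -
  let ?f = "\<lambda>k p. indicator {k} (fst p) * indicator C (move s t (w(t := p)) v) :: ennreal"
  have v': "v \<in> cbox a b" using v box_of_eta_subset by blast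
  have [measurable]: "(\<lambda>p. move s t (w(t := p)) v) \<in> borel_measurable (count_space UNIV \<Otimes>\<^sub>M borel)"
    by (rule move_section_measurable[OF st])
  have "indicator C (move s t (w(t := p)) v) = (\<Sum>k\<in>UNIV. ?f k p)" for p
    by (simp add: sum_distrib_right[symmetric] indicator_def)
  then have "(\<integral>\<^sup>+p. indicator C (move s t (w(t := p)) v) \<partial>mark_law) = (\<integral>\<^sup>+p. (\<Sum>k\<in>UNIV. ?f k p) \<partial>mark_law)"
    by (intro nn_integral_cong)
  also have "\<dots> = (\<Sum>k\<in>UNIV. \<integral>\<^sup>+p. ?f k p \<partial>mark_law)"
    by (rule nn_integral_sum) measurable
  also have "\<dots> = (\<Sum>k\<in>UNIV. ennreal (site_update_prob a b g k v C / CARD('n)))"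
    by (simp only: site_step[OF st v C])
  also have "\<dots> = ennreal (gibbs_kernel a b g v C)"
    using ennreal_site_update_prob(2)[OF v' C]
    by (subst sum_ennreal) (auto simp: gibbs_kernel_def sum_divide_distrib)
  finally show ?thesis .
qed

end

section \<open>Uniqueness of the invariant law\<close>

context gibbs_target
begin

lemma site_update_prob_le_1:
  assumes v: "v \<in> cbox a b" and C: "C \<in> sets borel"
  shows "site_update_prob a b g k v C \<le> 1"
proof -
  have "ennreal (site_update_prob a b g k v C) \<le> (\<integral>\<^sup>+y. ennreal (indicator {a$k..b$k} y * cd k y v) \<partial>lborel)"
    unfolding ennreal_site_update_prob(1)[OF v C]
    by (intro nn_integral_mono) (auto simp: indicator_def)
  also have "\<dots> = emeasure (cond_law k v) UNIV"
    unfolding cond_law_def by (subst emeasure_density) auto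
  finally show ?thesis by (simp add: cond_law_UNIV[OF v])
qed

lemma gibbs_kernel_measurable [measurable]:
  assumes "C \<in> sets borel"
  shows "(\<lambda>x. gibbs_kernel a b g x C) \<in> borel_measurable borel"
  unfolding gibbs_kernel_def using assms by measurable

lemma gibbs_kernel_bounds:
  assumes v: "v \<in> cbox a b" and C: "C \<in> sets borel"
  shows "0 \<le> gibbs_kernel a b g v C" "gibbs_kernel a b g v C \<le> 1"
proof -
  show "0 \<le> gibbs_kernel a b g v C"
    unfolding gibbs_kernel_def using ennreal_site_update_prob(2)[OF v C]
    by (intro divide_nonneg_nonneg sum_nonneg) auto
  have "(\<Sum>k\<in>UNIV. site_update_prob a b g k v C) \<le> (\<Sum>k\<in>(UNIV::'n set). 1)"
    by (intro sum_mono site_update_prob_le_1 v C)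
  then show "gibbs_kernel a b g v C \<le> 1"
    unfolding gibbs_kernel_def by (simp add: divide_le_eq)
qed

lemma gibbs_invariantD:
  assumes inv: "gibbs_invariant a b g \<mu>" and C: "C \<in> sets borel"
  shows "AE x in \<mu>. x \<in> cbox a b"
    and "(\<integral>\<^sup>+x. ennreal (gibbs_kernel a b g x C) \<partial>\<mu>) = emeasure \<mu> C"
proof -
  interpret prob_space \<mu> using inv by (simp add: gibbs_invariant_def)
  have [simp, measurable_cong]: "sets \<mu> = sets borel" using inv by (simp add: gibbs_invariant_def)
  have "prob (cbox a b) = 1" using inv by (simp add: gibbs_invariant_def)
  from AE_prob_1[OF this] show AE: "AE x in \<mu>. x \<in> cbox a b" .
  have "integrable \<mu> (\<lambda>x. gibbs_kernel a b g x C)"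
  proof (rule integrable_const_bound[where B=1])
    show "AE x in \<mu>. norm (gibbs_kernel a b g x C) \<le> 1"
      using AE by eventually_elim (use gibbs_kernel_bounds[OF _ C] in auto)
    have "(\<lambda>x. gibbs_kernel a b g x C) \<in> borel_measurable borel"
      by (rule gibbs_kernel_measurable[OF C])
    then show "(\<lambda>x. gibbs_kernel a b g x C) \<in> borel_measurable \<mu>" by simp
  qed
  then have "(\<integral>\<^sup>+x. ennreal (gibbs_kernel a b g x C) \<partial>\<mu>) = ennreal (\<integral>x. gibbs_kernel a b g x C \<partial>\<mu>)"
    by (rule nn_integral_eq_integral) (use AE in eventually_elim, use gibbs_kernel_bounds[OF _ C] in auto)
  also have "\<dots> = emeasure \<mu> C"
    using inv C by (simp add: gibbs_invariant_def emeasure_eq_measure)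
  finally show "(\<integral>\<^sup>+x. ennreal (gibbs_kernel a b g x C) \<partial>\<mu>) = emeasure \<mu> C" .
qed

end

context gibbs_canonical
begin

primrec chain :: "int \<Rightarrow> nat \<Rightarrow> real^'n \<Rightarrow> (int \<Rightarrow> 'n \<times> real) \<Rightarrow> real^'n" where
  "chain s 0 z w = z"
| "chain s (Suc n) z w = move s (s + int n + 1) w (chain s n z w)"

lemma chain_in_eta: "z \<in> cbox a b \<Longrightarrow> chain s n z w \<in> box_of (et s (s + int n) w)"
proof (induction n)
  case 0
  then show ?case by (simp add: eta_init box_of_def in_state_iff)
next
  case (Suc n)
  then show ?case using move_in_eta[of s "s + int n + 1" "chain s n z w" w]
    by (simp add: algebra_simps)
qed

lemma chain_measurable:
  assumes f: "f \<in> measurable M seq_space" and h: "h \<in> borel_measurable M"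
  shows "(\<lambda>x. chain s n (h x) (f x)) \<in> borel_measurable M"
  by (induction n) (simp_all add: h move_measurable f)

lemma lo_upd: "r < t \<Longrightarrow> lo s r (w(t := p)) = lo s r w"
  by (simp add: lo_def eta_upd)

lemma move_upd: "r < t \<Longrightarrow> move s r (w(t := p)) v = move s r w v"
  by (simp add: move_def new_value_def lo_upd eta_upd Rk_def Ghat_def[abs_def])

lemma chain_upd: "s + int n < t \<Longrightarrow> chain s n z (w(t := p)) = chain s n z w"
  by (induction n) (simp_all add: move_upd)

text \<open>
  Integrating out the last mark turns a step of the chain into an application of the Gibbs kernel, and
  the kernel preserves \<open>\<mu>\<close>.
\<close>
lemma chain_law:
  assumes inv: "gibbs_invariant a b g \<mu>"
  shows "distr (\<mu> \<Otimes>\<^sub>M seq_law) borel (\<lambda>(z, w). chain s n z w) = \<mu>"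
proof -
  interpret \<mu>: prob_space \<mu> using inv by (simp add: gibbs_invariant_def)
  have sets\<mu> [simp]: "sets \<mu> = sets borel" using inv by (simp add: gibbs_invariant_def)
  interpret P: prob_space seq_law by (rule prob_space_seq_law)
  let ?N = "\<mu> \<Otimes>\<^sub>M seq_law"
  have sN: "sets ?N = sets (borel \<Otimes>\<^sub>M seq_space)"
    by (intro sets_pair_measure_cong) simp_all
  have fst: "fst \<in> borel_measurable ?N" and snd: "snd \<in> measurable ?N seq_space"
    by (simp_all add: measurable_cong_sets[OF sN refl])
  have X: "(\<lambda>q. chain s n (fst q) (snd q)) \<in> borel_measurable ?N" for n
    by (rule chain_measurable[OF snd fst])
  have Xw: "(\<lambda>w. chain s n z w) \<in> borel_measurable seq_space" for n z
    by (rule chain_measurable) simp_all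
  have em: "emeasure (distr ?N borel (\<lambda>(z, w). chain s n z w)) C =
      (\<integral>\<^sup>+z. \<integral>\<^sup>+w. indicator C (chain s n z w) \<partial>seq_law \<partial>\<mu>)" if C: "C \<in> sets borel" for C n
  proof -
    have "emeasure (distr ?N borel (\<lambda>(z, w). chain s n z w)) C =
        (\<integral>\<^sup>+q. indicator C q \<partial>distr ?N borel (\<lambda>(z, w). chain s n z w))"
      using C by simp
    also have "\<dots> = (\<integral>\<^sup>+q. indicator C (chain s n (fst q) (snd q)) \<partial>?N)"
      using X[of n] C by (subst nn_integral_distr) (auto simp: case_prod_beta')
    also have "\<dots> = (\<integral>\<^sup>+z. \<integral>\<^sup>+w. indicator C (chain s n z w) \<partial>seq_law \<partial>\<mu>)"
      using P.nn_integral_fst[OF measurable_compose[OF X[of n] borel_measurable_indicator[OF C]]] by simp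
    finally show ?thesis .
  qed
  show ?thesis
  proof (induction n)
    case 0
    show ?case
    proof (rule measure_eqI)
      fix C assume "C \<in> sets (distr ?N borel (\<lambda>(z, w). chain s 0 z w))"
      then have C: "C \<in> sets borel" by simp
      have "(\<integral>\<^sup>+z. \<integral>\<^sup>+w. indicator C (chain s 0 z w) \<partial>seq_law \<partial>\<mu>) = (\<integral>\<^sup>+z. indicator C z \<partial>\<mu>)"
        by (simp add: P.emeasure_space_1[simplified])
      also have "\<dots> = emeasure \<mu> C" using C by simp
      finally show "emeasure (distr ?N borel (\<lambda>(z, w). chain s 0 z w)) C = emeasure \<mu> C"
        unfolding em[OF C] .
    qed simp
  next
    case (Suc n)
    show ?case
    proof (rule measure_eqI)
      fix C assume "C \<in> sets (distr ?N borel (\<lambda>(z, w). chain s (Suc n) z w))"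
      then have C: "C \<in> sets borel" by simp
      let ?t = "s + int n + 1"
      have K: "(\<lambda>x. ennreal (gibbs_kernel a b g x C)) \<in> borel_measurable borel"
        using gibbs_kernel_measurable[OF C] by simp
      have step: "(\<integral>\<^sup>+w. indicator C (chain s (Suc n) z w) \<partial>seq_law) =
          (\<integral>\<^sup>+w. ennreal (gibbs_kernel a b g (chain s n z w) C) \<partial>seq_law)" if z: "z \<in> cbox a b" for z
      proof -
        have "(\<integral>\<^sup>+w. indicator C (chain s (Suc n) z w) \<partial>seq_law) =
            (\<integral>\<^sup>+w. \<integral>\<^sup>+p. indicator C (chain s (Suc n) z (w(?t := p))) \<partial>mark_law \<partial>seq_law)"
          by (rule nn_integral_resample) (rule measurable_compose[OF Xw], use C in simp)
        also have "\<dots> = (\<integral>\<^sup>+w. ennreal (gibbs_kernel a b g (chain s n z w) C) \<partial>seq_law)"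
        proof (rule nn_integral_cong)
          fix w
          have "chain s n z w \<in> box_of (et s (?t - 1) w)" using chain_in_eta[OF z] by simp
          then show "(\<integral>\<^sup>+p. indicator C (chain s (Suc n) z (w(?t := p))) \<partial>mark_law) =
              ennreal (gibbs_kernel a b g (chain s n z w) C)"
            using kernel_step[of s ?t "chain s n z w" w C] C by (simp add: chain_upd)
        qed
        finally show ?thesis .
      qed
      have "(\<integral>\<^sup>+z. \<integral>\<^sup>+w. indicator C (chain s (Suc n) z w) \<partial>seq_law \<partial>\<mu>) =
          (\<integral>\<^sup>+z. \<integral>\<^sup>+w. ennreal (gibbs_kernel a b g (chain s n z w) C) \<partial>seq_law \<partial>\<mu>)"
        by (rule nn_integral_cong_AE) (use gibbs_invariantD(1)[OF inv C] in eventually_elim, use step in auto)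
      also have "\<dots> = (\<integral>\<^sup>+q. ennreal (gibbs_kernel a b g (chain s n (fst q) (snd q)) C) \<partial>?N)"
        using P.nn_integral_fst[OF measurable_compose[OF X[of n] K]] by simp
      also have "\<dots> = (\<integral>\<^sup>+x. ennreal (gibbs_kernel a b g x C) \<partial>distr ?N borel (\<lambda>(z, w). chain s n z w))"
        using X[of n] K by (subst nn_integral_distr) (auto simp: case_prod_beta')
      also have "\<dots> = emeasure \<mu> C"
        unfolding Suc.IH by (rule gibbs_invariantD(2)[OF inv C])
      finally show "emeasure (distr ?N borel (\<lambda>(z, w). chain s (Suc n) z w)) C = emeasure \<mu> C"
        unfolding em[OF C] .
    qed simp
  qed
qed

lemma uncoupled_sets: "{w. \<not> cpl s t w} \<in> sets seq_law"
  using predE[OF pred_intros_logic(2)[OF coupled_measurable[of s t]]] by (simp add: space_seq_space)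

text \<open>
  A chain started at time \<open>t - n - 1\<close> from the invariant law \<open>\<mu>\<close> has law \<open>\<mu>\<close> at time \<open>t\<close>, and it sits at \<open>\<zeta>\<^sub>t\<close>
  as soon as the box containing it has shrunk to a point.
\<close>
lemma coupling_inequality:
  assumes inv: "gibbs_invariant a b g \<mu>" and C: "C \<in> sets borel"
  shows "emeasure \<mu> C \<le> emeasure (distr seq_law borel (zet t)) C + emeasure seq_law {w. \<not> cpl (t - int (Suc n)) t w}"
proof -
  interpret \<mu>: prob_space \<mu> using inv by (simp add: gibbs_invariant_def)
  have sets\<mu> [simp]: "sets \<mu> = sets borel" using inv by (simp add: gibbs_invariant_def)
  interpret P: prob_space seq_law by (rule prob_space_seq_law)
  let ?N = "\<mu> \<Otimes>\<^sub>M seq_law" and ?s = "t - int (Suc n)"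
  have sN: "sets ?N = sets (borel \<Otimes>\<^sub>M seq_space)"
    by (intro sets_pair_measure_cong) simp_all
  have fst: "fst \<in> borel_measurable ?N" and snd: "snd \<in> measurable ?N seq_space"
    by (simp_all add: measurable_cong_sets[OF sN refl])
  have X: "(\<lambda>q. chain ?s (Suc n) (fst q) (snd q)) \<in> borel_measurable ?N"
    by (rule chain_measurable[OF snd fst])
  have z: "zet t \<in> borel_measurable seq_law"
    using zeta_measurable by (simp add: measurable_cong_sets[OF sets_seq_law refl])
  have "emeasure \<mu> C = emeasure (distr ?N borel (\<lambda>(z, w). chain ?s (Suc n) z w)) C"
    by (simp only: chain_law[OF inv])
  also have "\<dots> = (\<integral>\<^sup>+q. indicator C q \<partial>distr ?N borel (\<lambda>(z, w). chain ?s (Suc n) z w))"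
    using C by simp
  also have "\<dots> = (\<integral>\<^sup>+q. indicator C (chain ?s (Suc n) (fst q) (snd q)) \<partial>?N)"
    using X C by (subst nn_integral_distr) (auto simp: case_prod_beta' simp del: chain.simps)
  also have "\<dots> = (\<integral>\<^sup>+z. \<integral>\<^sup>+w. indicator C (chain ?s (Suc n) z w) \<partial>seq_law \<partial>\<mu>)"
    using P.nn_integral_fst[OF measurable_compose[OF X borel_measurable_indicator[OF C]]]
    by (simp del: chain.simps)
  also have "\<dots> \<le> (\<integral>\<^sup>+z. (\<integral>\<^sup>+w. indicator C (zet t w) + indicator {w. \<not> cpl ?s t w} w \<partial>seq_law) \<partial>\<mu>)"
  proof (rule nn_integral_mono_AE, use gibbs_invariantD(1)[OF inv C] in eventually_elim, rule nn_integral_mono)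
    fix x w assume x: "x \<in> cbox a b"
    have "chain ?s (Suc n) x w = zet t w" if c: "cpl ?s t w"
      using chain_in_eta[OF x, of ?s "Suc n" w] coupled_box[OF c] zeta_coupled[OF c] by (simp del: chain.simps)
    then show "indicator C (chain ?s (Suc n) x w) \<le> (indicator C (zet t w) + indicator {w. \<not> cpl ?s t w} w :: ennreal)"
      by (cases "cpl ?s t w") (simp_all del: chain.simps add: indicator_def)
  qed
  also have "\<dots> = (\<integral>\<^sup>+w. indicator C (zet t w) + indicator {w. \<not> cpl ?s t w} w \<partial>seq_law)"
    by (simp add: \<mu>.emeasure_space_1)
  also have "\<dots> = (\<integral>\<^sup>+w. indicator C (zet t w) \<partial>seq_law) + (\<integral>\<^sup>+w. indicator {w. \<not> cpl ?s t w} w \<partial>seq_law)"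
    by (rule nn_integral_add) (use z C uncoupled_sets in auto)
  also have "(\<integral>\<^sup>+w. indicator C (zet t w) \<partial>seq_law) = (\<integral>\<^sup>+x. indicator C x \<partial>distr seq_law borel (zet t))"
    using z C by (subst nn_integral_distr) auto
  also have "\<dots> = emeasure (distr seq_law borel (zet t)) C"
    using C by simp
  also have "(\<integral>\<^sup>+w. indicator {w. \<not> cpl ?s t w} w \<partial>seq_law) = emeasure seq_law {w. \<not> cpl ?s t w}"
    using uncoupled_sets by simp
  finally show ?thesis .
qed

text \<open>
  Continuity from above: these events decrease to \<open>\<tau>(t) = -\<infinity>\<close>.
\<close>
lemma uncoupled_tendsto_0:
  assumes c: "AE w in seq_law. \<exists>s. cpl s t w"
  shows "(\<lambda>n. emeasure seq_law {w. \<not> cpl (t - int (Suc n)) t w}) \<longlonglongrightarrow> 0"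
proof -
  interpret P: prob_space seq_law by (rule prob_space_seq_law)
  let ?A = "\<lambda>n. {w. \<not> cpl (t - int (Suc n)) t w}"
  have "(\<lambda>n. emeasure seq_law (?A n)) \<longlonglongrightarrow> emeasure seq_law (\<Inter>n. ?A n)"
  proof (rule Lim_emeasure_decseq)
    show "decseq ?A"
    proof (rule decseq_SucI)
      fix n
      show "?A (Suc n) \<subseteq> ?A n"
        using coupled_antimono(1)[of "t - int (Suc (Suc n))" "t - int (Suc n)" t] by auto
    qed
  qed (use uncoupled_sets in auto)
  also have "(\<Inter>n. ?A n) = {w. \<not> (\<exists>s. cpl s t w)}"
  proof (intro set_eqI iffI)
    fix w assume "w \<in> (\<Inter>n. ?A n)"
    then have *: "\<not> cpl (t - int (Suc n)) t w" for n by auto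
    have "\<not> cpl s t w" for s
    proof
      assume s: "cpl s t w"
      then have "s < t" by (simp add: coupled_iff)
      then show False using s *[of "nat (t - s) - 1"] by simp
    qed
    then show "w \<in> {w. \<not> (\<exists>s. cpl s t w)}" by simp
  qed auto
  also have "emeasure seq_law {w. \<not> (\<exists>s. cpl s t w)} = 0"
  proof -
    have "{w. \<not> (\<exists>s. cpl s t w)} = (\<Inter>s. {w. \<not> cpl s t w})" by auto
    also have "\<dots> \<in> sets seq_law" using uncoupled_sets by (intro sets.countable_INT) auto
    finally show ?thesis
      using c by (subst (asm) AE_iff_measurable[OF _ refl]) simp_all
  qed
  finally show ?thesis .
qed

text \<open>
  Letting the starting time tend to \<open>-\<infinity>\<close> in the coupling inequality gives \<open>\<mu> C \<le> P(\<zeta>\<^sub>t \<in> C)\<close> for every \<open>C\<close>, also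
  for the complement of \<open>C\<close>; two probability measures so related are equal.
\<close>
lemma invariant_unique:
  assumes inv: "gibbs_invariant a b g \<mu>" and c: "AE w in seq_law. \<exists>s. cpl s t w"
  shows "\<mu> = distr seq_law borel (zet t)"
proof (rule measure_eqI)
  let ?D = "distr seq_law borel (zet t)"
  show "sets \<mu> = sets ?D" using inv by (simp add: gibbs_invariant_def)
  interpret \<mu>: prob_space \<mu> using inv by (simp add: gibbs_invariant_def)
  have sets\<mu> [simp]: "sets \<mu> = sets borel" using inv by (simp add: gibbs_invariant_def)
  have space\<mu> [simp]: "space \<mu> = UNIV" using sets_eq_imp_space_eq[OF sets\<mu>] by simp
  interpret P: prob_space seq_law by (rule prob_space_seq_law)
  have "zet t \<in> borel_measurable seq_law"
    using zeta_measurable by (simp add: measurable_cong_sets[OF sets_seq_law refl])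
  then interpret D: prob_space ?D by (rule P.prob_space_distr)
  have le: "emeasure \<mu> C \<le> emeasure ?D C" if C: "C \<in> sets borel" for C
  proof -
    have "(\<lambda>n. emeasure ?D C + emeasure seq_law {w. \<not> cpl (t - int (Suc n)) t w}) \<longlonglongrightarrow> emeasure ?D C + 0"
      by (intro tendsto_add tendsto_const uncoupled_tendsto_0 c)
    then have "emeasure \<mu> C \<le> emeasure ?D C + 0"
      by (rule tendsto_lowerbound) (use coupling_inequality[OF inv C] in auto)
    then show ?thesis by simp
  qed
  fix C assume "C \<in> sets \<mu>"
  then have C: "C \<in> sets borel" by simp
  have "\<mu>.prob C \<le> D.prob C" "\<mu>.prob (UNIV - C) \<le> D.prob (UNIV - C)"
    using le[of C] le[of "UNIV - C"] C by (auto simp: \<mu>.emeasure_eq_measure D.emeasure_eq_measure)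
  then have "\<mu>.prob C = D.prob C"
    using \<mu>.prob_compl[of C] D.prob_compl[of C] C by simp
  then show "emeasure \<mu> C = emeasure ?D C"
    by (simp add: \<mu>.emeasure_eq_measure D.emeasure_eq_measure)
qed

end

section \<open>Invariance of the target density\<close>

text \<open>
  Fubini, with one coordinate integrated first. The remaining coordinates are functions on the other
  basis vectors; the vector assembled from them has coordinate \<open>k\<close> equal to 0, which \<^const>\<open>upd\<close> overwrites.
\<close>
lemma nn_integral_lborel_coordinate:
  fixes h :: "real^'n \<Rightarrow> ennreal"
  assumes h: "h \<in> borel_measurable borel"
  shows "(\<integral>\<^sup>+x. h x \<partial>lborel) =
    (\<integral>\<^sup>+f. (\<integral>\<^sup>+y. h (upd (\<Sum>b\<in>Basis - {axis k 1}. f b *\<^sub>R b) k y) \<partial>lborel)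
      \<partial>PiM (Basis - {axis k 1}) (\<lambda>_. lborel))"
proof -
  interpret product_sigma_finite "\<lambda>_::real^'n. lborel :: real measure"
    by (simp add: product_sigma_finite_def sigma_finite_lborel)
  let ?e = "axis k 1 :: real^'n"
  let ?v = "\<lambda>f. \<Sum>b\<in>Basis. f b *\<^sub>R b :: real^'n"
  have e: "?e \<in> Basis" by (simp add: axis_in_Basis_iff)
  have ins: "insert ?e (Basis - {?e}) = Basis" using e by auto
  have v: "?v \<in> borel_measurable (PiM Basis (\<lambda>_. lborel))" by measurable
  have hv: "(\<lambda>f. h (?v f)) \<in> borel_measurable (PiM Basis (\<lambda>_. lborel))"
    by (rule measurable_compose[OF v h])
  have split: "?v (f(?e := y)) = upd (\<Sum>b\<in>Basis - {?e}. f b *\<^sub>R b) k y" for f y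
  proof -
    have "?v (f(?e := y)) = y *\<^sub>R ?e + (\<Sum>b\<in>Basis - {?e}. (f(?e := y)) b *\<^sub>R b)"
      by (subst sum.remove[OF _ e]) simp_all
    also have "(\<Sum>b\<in>Basis - {?e}. (f(?e := y)) b *\<^sub>R b) = (\<Sum>b\<in>Basis - {?e}. f b *\<^sub>R b)"
      by (intro sum.cong) auto
    also have "y *\<^sub>R ?e + (\<Sum>b\<in>Basis - {?e}. f b *\<^sub>R b) = upd (\<Sum>b\<in>Basis - {?e}. f b *\<^sub>R b) k y"
    proof -
      have "b $ k = 0" if "b \<in> Basis - {?e}" for b
        using that by (auto simp: Basis_vec_def axis_def)
      then have "(\<Sum>b\<in>Basis - {?e}. f b *\<^sub>R b) $ k = 0"
        by (simp add: sum_component)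
      then show ?thesis by (simp add: vec_eq_iff axis_def)
    qed
    finally show ?thesis .
  qed
  have "(\<integral>\<^sup>+x. h x \<partial>lborel) = (\<integral>\<^sup>+f. h (?v f) \<partial>PiM Basis (\<lambda>_. lborel))"
    by (subst lborel_eq, subst nn_integral_distr[OF v]) (use h in simp_all)
  also have "\<dots> = (\<integral>\<^sup>+f. h (?v f) \<partial>PiM (insert ?e (Basis - {?e})) (\<lambda>_. lborel))"
    by (simp only: ins)
  also have "\<dots> = (\<integral>\<^sup>+f. (\<integral>\<^sup>+y. h (?v (f(?e := y))) \<partial>lborel) \<partial>PiM (Basis - {?e}) (\<lambda>_. lborel))"
    by (rule product_nn_integral_insert) (use hv ins in simp_all)
  finally show ?thesis by (simp only: split)
qed

lemma upd_upd [simp]: "upd (upd x k y) k z = upd x k z"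
  by (simp add: vec_eq_iff)

context gibbs_target
begin

abbreviation "target \<equiv> density lborel (\<lambda>x. ennreal (g x))"

lemma Z_upd [simp]: "Z k (upd x k y) = Z k x"
  by (simp add: Z_def)

text \<open>
  Along a line in direction \<open>k\<close>, redrawing the coordinate from the conditional density leaves \<open>g\<close>
  invariant: the normalizing integral cancels against the total mass of \<open>g\<close> on the line.
\<close>
lemma section_balance:
  assumes C[measurable]: "C \<in> sets borel"
  shows "(\<integral>\<^sup>+y. ennreal (g (upd x k y)) \<partial>lborel) *
      (\<integral>\<^sup>+z. indicator C (upd x k z) * ennreal (indicator {a$k..b$k} z * (g (upd x k z) / Z k x)) \<partial>lborel)
    = (\<integral>\<^sup>+y. ennreal (g (upd x k y)) * indicator C (upd x k y) \<partial>lborel)"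
proof (cases "upd x k (a$k) \<in> cbox a b")
  case False
  \<comment> \<open>the whole line misses the state space, and both sides vanish\<close>
  have "upd x k y \<notin> cbox a b" for y
    using False ab_le[of k] unfolding in_state_iff by (auto split: if_splits)
  then show ?thesis by (simp add: g_outside)
next
  case True
  note Zp = Z_pos[OF True, of k, unfolded Z_upd]
  have ind: "indicator {a$k..b$k} z * g (upd x k z) = g (upd x k z)" for z
  proof (cases "z \<in> {a$k..b$k}")
    case False
    then have "upd x k z $ k \<notin> {a$k..b$k}" by simp
    then have "upd x k z \<notin> cbox a b" by (auto simp only: in_state_iff)
    then show ?thesis by (simp add: g_outside)
  qed simp
  have "(\<integral>\<^sup>+y. ennreal (g (upd x k y)) \<partial>lborel) = (\<integral>\<^sup>+y. ennreal (indicator {a$k..b$k} y *\<^sub>R g (upd x k y)) \<partial>lborel)"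
    by (simp add: ind)
  also have "\<dots> = ennreal (Z k x)"
    unfolding Z_def set_lebesgue_integral_def
    by (rule nn_integral_eq_integral)
       (use g_section_integrable[OF True, of k] in \<open>simp_all add: set_integrable_def g_nonneg\<close>)
  finally have 1: "(\<integral>\<^sup>+y. ennreal (g (upd x k y)) \<partial>lborel) = ennreal (Z k x)" .
  have "ennreal (indicator {a$k..b$k} z * (g (upd x k z) / Z k x)) = ennreal (1 / Z k x) * ennreal (g (upd x k z))" for z
    using Zp g_nonneg[of "upd x k z"] ind[of z] by (simp add: ennreal_mult[symmetric])
  then have "(\<integral>\<^sup>+z. indicator C (upd x k z) * ennreal (indicator {a$k..b$k} z * (g (upd x k z) / Z k x)) \<partial>lborel)
    = (\<integral>\<^sup>+z. ennreal (1 / Z k x) * (ennreal (g (upd x k z)) * indicator C (upd x k z)) \<partial>lborel)"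
    by (intro nn_integral_cong) (simp add: mult_ac)
  also have "\<dots> = ennreal (1 / Z k x) * (\<integral>\<^sup>+z. ennreal (g (upd x k z)) * indicator C (upd x k z) \<partial>lborel)"
    by (rule nn_integral_cmult) measurable
  finally show ?thesis
    using Zp by (simp only: 1 mult.assoc[symmetric] ennreal_mult[symmetric] less_imp_le zero_le_divide_1_iff) simp
qed

lemma site_update_preserves_target:
  assumes C[measurable]: "C \<in> sets borel"
  shows "(\<integral>\<^sup>+x. ennreal (site_update_prob a b g k x C) \<partial>target) = emeasure target C"
proof -
  let ?J = "\<lambda>x. \<integral>\<^sup>+z. indicator C (upd x k z) * ennreal (indicator {a$k..b$k} z * (g (upd x k z) / Z k x)) \<partial>lborel"
  have J: "?J \<in> borel_measurable borel" by measurable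
  have "(\<integral>\<^sup>+x. ennreal (site_update_prob a b g k x C) \<partial>target)
      = (\<integral>\<^sup>+x. ennreal (g x) * ennreal (site_update_prob a b g k x C) \<partial>lborel)"
    by (rule nn_integral_density) measurable
  also have "\<dots> = (\<integral>\<^sup>+x. ennreal (g x) * ?J x \<partial>lborel)"
  proof (rule nn_integral_cong)
    fix x
    show "ennreal (g x) * ennreal (site_update_prob a b g k x C) = ennreal (g x) * ?J x"
      using ennreal_site_update_prob(1)[OF _ C, of x k] g_outside[of x]
      by (cases "x \<in> cbox a b") (simp_all add: cond_dens_eq)
  qed
  also have "\<dots> = (\<integral>\<^sup>+f. (\<integral>\<^sup>+y. ennreal (g (upd (\<Sum>b\<in>Basis - {axis k 1}. f b *\<^sub>R b) k y)) *
      ?J (upd (\<Sum>b\<in>Basis - {axis k 1}. f b *\<^sub>R b) k y) \<partial>lborel) \<partial>PiM (Basis - {axis k 1}) (\<lambda>_. lborel))"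
    by (rule nn_integral_lborel_coordinate) (use J in simp)
  also have "\<dots> = (\<integral>\<^sup>+f. (\<integral>\<^sup>+y. ennreal (g (upd (\<Sum>b\<in>Basis - {axis k 1}. f b *\<^sub>R b) k y)) *
      indicator C (upd (\<Sum>b\<in>Basis - {axis k 1}. f b *\<^sub>R b) k y) \<partial>lborel) \<partial>PiM (Basis - {axis k 1}) (\<lambda>_. lborel))"
  proof (rule nn_integral_cong)
    fix f :: "real^'n \<Rightarrow> real"
    let ?x = "\<Sum>b\<in>Basis - {axis k 1}. f b *\<^sub>R b"
    have "(\<integral>\<^sup>+y. ennreal (g (upd ?x k y)) * ?J (upd ?x k y) \<partial>lborel) = (\<integral>\<^sup>+y. ennreal (g (upd ?x k y)) * ?J ?x \<partial>lborel)"
      by (simp only: upd_upd Z_upd)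
    also have "\<dots> = (\<integral>\<^sup>+y. ennreal (g (upd ?x k y)) \<partial>lborel) * ?J ?x"
      by (rule nn_integral_multc) measurable
    also have "\<dots> = (\<integral>\<^sup>+y. ennreal (g (upd ?x k y)) * indicator C (upd ?x k y) \<partial>lborel)"
      by (rule section_balance[OF C])
    finally show "(\<integral>\<^sup>+y. ennreal (g (upd ?x k y)) * ?J (upd ?x k y) \<partial>lborel) =
      (\<integral>\<^sup>+y. ennreal (g (upd ?x k y)) * indicator C (upd ?x k y) \<partial>lborel)" .
  qed
  also have "\<dots> = (\<integral>\<^sup>+x. ennreal (g x) * indicator C x \<partial>lborel)"
    by (rule nn_integral_lborel_coordinate[symmetric]) measurable
  also have "\<dots> = emeasure target C"
    by (rule emeasure_density[symmetric]) simp_all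
  finally show ?thesis .
qed

lemma prob_space_target: "prob_space target"
  by standard (simp add: emeasure_density g_mass)

lemma target_invariant: "gibbs_invariant a b g target"
proof -
  interpret prob_space target by (rule prob_space_target)
  have "emeasure target (cbox a b) = emeasure target UNIV"
    using g_outside by (simp add: emeasure_density, intro nn_integral_cong) (auto simp: indicator_def)
  also have "\<dots> = 1" by (simp add: emeasure_density g_mass)
  finally have 1: "emeasure target (cbox a b) = 1" .
  then have state: "measure target (cbox a b) = 1" by (simp add: measure_def)
  have AE: "AE x in target. x \<in> cbox a b" by (rule AE_prob_1[OF state])
  have "measure target C = (\<integral>x. gibbs_kernel a b g x C \<partial>target)" if C[measurable]: "C \<in> sets borel" for C
  proof -
    have "(\<integral>\<^sup>+x. ennreal (gibbs_kernel a b g x C) \<partial>target) =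
        (\<integral>\<^sup>+x. (\<Sum>k\<in>UNIV. ennreal (1 / CARD('n)) * ennreal (site_update_prob a b g k x C)) \<partial>target)"
    proof (rule nn_integral_cong_AE, use AE in eventually_elim)
      fix x assume "x \<in> cbox a b"
      then show "ennreal (gibbs_kernel a b g x C) =
          (\<Sum>k\<in>UNIV. ennreal (1 / CARD('n)) * ennreal (site_update_prob a b g k x C))"
        using ennreal_site_update_prob(2)[OF _ C]
        by (simp add: gibbs_kernel_def sum_divide_distrib ennreal_mult[symmetric] sum_ennreal)
    qed
    also have "\<dots> = (\<Sum>k\<in>(UNIV::'n set). \<integral>\<^sup>+x. ennreal (1 / CARD('n)) * ennreal (site_update_prob a b g k x C) \<partial>target)"
      by (rule nn_integral_sum) measurable
    also have "\<dots> = (\<Sum>k\<in>(UNIV::'n set). ennreal (1 / CARD('n)) * (\<integral>\<^sup>+x. ennreal (site_update_prob a b g k x C) \<partial>target))"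
      by (intro sum.cong refl nn_integral_cmult) measurable
    also have "\<dots> = (\<Sum>k\<in>(UNIV::'n set). ennreal (1 / CARD('n)) * ennreal (measure target C))"
      by (simp only: site_update_preserves_target[OF C] emeasure_eq_measure)
    also have "\<dots> = ennreal (measure target C)"
      by (simp add: ennreal_mult[symmetric] ennreal_of_nat_eq_real_of_nat)
    finally have nn: "(\<integral>\<^sup>+x. ennreal (gibbs_kernel a b g x C) \<partial>target) = ennreal (measure target C)" .
    have "(\<integral>x. gibbs_kernel a b g x C \<partial>target) = enn2real (\<integral>\<^sup>+x. ennreal (gibbs_kernel a b g x C) \<partial>target)"
      by (rule integral_eq_nn_integral)
         (use AE gibbs_kernel_bounds(1)[OF _ C] gibbs_kernel_measurable[OF C] in \<open>auto elim!: eventually_mono\<close>)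
    then show ?thesis by (simp add: nn)
  qed
  then show ?thesis
    unfolding gibbs_invariant_def using state prob_space_target by simp
qed

end

section \<open>The stationary process\<close>

context gibbs_target
begin

lemma coupled_cong:
  assumes "\<And>i. \<kappa> i \<omega> = \<kappa>' (i + h) \<omega>' \<and> U i \<omega> = U' (i + h) \<omega>'"
  shows "coupled a b g \<kappa> U s t \<omega> \<longleftrightarrow> coupled a b g \<kappa>' U' (s + h) (t + h) \<omega>'"
  using eta_cong[of s t \<kappa> \<omega> \<kappa>' h \<omega>' U U' a b g] assms by (simp add: coupled_def)

lemma zeta_cong:
  assumes "\<And>i. \<kappa> i \<omega> = \<kappa>' (i + h) \<omega>' \<and> U i \<omega> = U' (i + h) \<omega>'"
  shows "zeta a b g \<kappa> U t \<omega> = zeta a b g \<kappa>' U' (t + h) \<omega>'"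
proof -
  interpret L: gibbs_driven a b g \<kappa> U by unfold_locales
  interpret L': gibbs_driven a b g \<kappa>' U' by unfold_locales
  have eta: "eta a b g \<kappa> U s t \<omega> = eta a b g \<kappa>' U' (s + h) (t + h) \<omega>'" for s
    using assms by (intro eta_cong)
  have cpl: "coupled a b g \<kappa> U s t \<omega> \<longleftrightarrow> coupled a b g \<kappa>' U' (s + h) (t + h) \<omega>'" for s
    using assms by (intro coupled_cong)
  show ?thesis
  proof (cases "\<exists>s. coupled a b g \<kappa> U s t \<omega>")
    case True
    then obtain s where s: "coupled a b g \<kappa> U s t \<omega>" ..
    have "L.lo s t \<omega> = L'.lo (s + h) (t + h) \<omega>'" by (simp add: L.lo_def L'.lo_def eta)
    then show ?thesis using L.zeta_coupled[OF s] L'.zeta_coupled[of "s + h" "t + h" \<omega>'] s cpl by simp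
  next
    case False
    then have "\<not> coupled a b g \<kappa>' U' s (t + h) \<omega>'" for s
      using cpl[of "s - h"] by simp
    then show ?thesis using False L.zeta_uncoupled[of t \<omega>] L'.zeta_uncoupled[of "t + h" \<omega>'] by simp
  qed
qed

end

context gibbs_canonical
begin

text \<open>
  Over a one-point box \<open>{v}\<close>, \<open>R\<^sub>[\<^sub>s\<^sub>,\<^sub>t\<^sub>] = G\<^sub>k(b\<^sub>k|v) = 1\<close>, so every further update is determined: coupling persists and
  the stationary process performs the same steps as a chain started at \<open>s\<close>.
\<close>
lemma zeta_recursion:
  assumes c: "cpl s (t-1) w" and u: "0 < snd (w t)" "snd (w t) \<le> 1"
  shows "cpl s t w" "zet t w = move s t w (zet (t-1) w)"
proof -
  have st: "s < t" using c by (simp add: coupled_iff)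
  let ?v = "lo s (t-1) w" and ?k = "fst (w t)"
  have box: "box_of (et s (t-1) w) = {?v}" by (rule coupled_box[OF c])
  have v: "?v \<in> cbox a b" using lo_in_eta box_of_eta_subset by blast
  have "Rk s t w ?k (b $ ?k) = 1"
    using R_fun_point[OF box, of ?k "b $ ?k"] st v by (simp add: Rk_def)
  then have "\<exists>p. et s t w ?k = {p}"
    using eta_selected_point[of s t w] u st by auto
  moreover have "\<exists>p. et s t w k = {p}" if "k \<noteq> ?k" for k
    using c that by (simp add: eta_step[OF st] coupled_def)
  ultimately have "\<exists>p. et s t w k = {p}" for k by (cases "k = ?k") blast+
  then show cst: "cpl s t w" using st by (simp add: coupled_def)
  have "move s t w ?v \<in> {lo s t w}"
    using move_in_eta[OF st, of ?v w] box coupled_box[OF cst] by simp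
  then show "zet t w = move s t w (zet (t-1) w)"
    using zeta_coupled[OF cst] zeta_coupled[OF c] by simp
qed

text \<open>
  The mark at time \<open>t\<close> is resampled. This affects neither \<open>A\<close> nor \<open>\<zeta>\<^sub>t\<^sub>-\<^sub>1\<close>, and by the recursion the
  integral over the new mark is one Gibbs step from \<open>\<zeta>\<^sub>t\<^sub>-\<^sub>1\<close>. The starting time \<open>s\<close> used there depends on the
  past, which is harmless because the outcome of the step does not depend on \<open>s\<close>.
\<close>
lemma zeta_gibbs_step:
  assumes c: "AE w in seq_law. \<exists>s. cpl s (t-1) w"
    and A: "A \<in> sets seq_space" and past: "\<And>w p. w(t := p) \<in> A \<longleftrightarrow> w \<in> A"
    and C: "C \<in> sets borel"
  shows "emeasure seq_law (A \<inter> {w. fst (w t) = k \<and> zet t w \<in> C}) =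
    (\<integral>\<^sup>+w. indicator A w * ennreal (site_update_prob a b g k (zet (t-1) w) C / CARD('n)) \<partial>seq_law)"
proof -
  let ?f = "\<lambda>w. indicator A w * (indicator {k} (fst (w t)) * indicator C (zet t w)) :: ennreal"
  have A': "A \<in> sets seq_law" using A by simp
  have "{w \<in> space seq_space. fst (w t) = k} \<in> sets seq_space"
    using measurable_sets[OF site_measurable[of t], of "{k}"] by (simp add: vimage_def Int_def conj_commute)
  moreover have "{w \<in> space seq_space. zet t w \<in> C} \<in> sets seq_space"
    using measurable_sets[OF zeta_measurable[of t] C] by (simp add: vimage_def Int_def conj_commute)
  moreover have "A \<inter> {w. fst (w t) = k \<and> zet t w \<in> C} =
      A \<inter> {w \<in> space seq_space. fst (w t) = k} \<inter> {w \<in> space seq_space. zet t w \<in> C}"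
    by (auto simp: space_seq_space)
  ultimately have S: "A \<inter> {w. fst (w t) = k \<and> zet t w \<in> C} \<in> sets seq_space"
    using A by simp
  have f_eq: "?f = indicator (A \<inter> {w. fst (w t) = k \<and> zet t w \<in> C})"
    by (auto simp: fun_eq_iff indicator_def)
  have f: "?f \<in> borel_measurable seq_space"
    unfolding f_eq by (rule borel_measurable_indicator[OF S])
  have "emeasure seq_law (A \<inter> {w. fst (w t) = k \<and> zet t w \<in> C}) = (\<integral>\<^sup>+w. ?f w \<partial>seq_law)"
    using S unfolding f_eq by simp
  also have "\<dots> = (\<integral>\<^sup>+w. \<integral>\<^sup>+p. ?f (w(t := p)) \<partial>mark_law \<partial>seq_law)"
    by (rule nn_integral_resample[OF f])
  also have "\<dots> = (\<integral>\<^sup>+w. indicator A w * ennreal (site_update_prob a b g k (zet (t-1) w) C / CARD('n)) \<partial>seq_law)"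
  proof (rule nn_integral_cong_AE, use c in eventually_elim)
    fix w :: "int \<Rightarrow> 'n \<times> real"
    assume "\<exists>s. cpl s (t-1) w"
    then obtain s where s: "cpl s (t-1) w" ..
    then have st: "s < t" by (simp add: coupled_iff)
    have v: "zet (t-1) w \<in> box_of (et s (t-1) w)"
      using zeta_coupled[OF s] coupled_box[OF s] by simp
    have m: "(\<lambda>p. indicator {k} (fst p) * indicator C (move s t (w(t := p)) (zet (t-1) w)) :: ennreal)
        \<in> borel_measurable mark_law"
    proof -
      have "(\<lambda>p. move s t (w(t := p)) (zet (t-1) w)) \<in> borel_measurable (count_space UNIV \<Otimes>\<^sub>M borel)"
        by (rule move_section_measurable[OF st])
      then have "(\<lambda>p. indicator {k} (fst p) * indicator C (move s t (w(t := p)) (zet (t-1) w)) :: ennreal)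
        \<in> borel_measurable (count_space UNIV \<Otimes>\<^sub>M borel)"
        using C by measurable
      then show ?thesis by (simp add: measurable_cong_sets[OF sets_mark_law refl])
    qed
    have "(\<integral>\<^sup>+p. ?f (w(t := p)) \<partial>mark_law) =
        (\<integral>\<^sup>+p. indicator A w * (indicator {k} (fst p) * indicator C (move s t (w(t := p)) (zet (t-1) w))) \<partial>mark_law)"
    proof (rule nn_integral_cong_AE, use AE_mark_law in eventually_elim)
      fix p :: "'n \<times> real" assume p: "0 < snd p \<and> snd p \<le> 1"
      have "cpl s (t-1) (w(t := p))" using s by (simp add: coupled_upd)
      then have "zet t (w(t := p)) = move s t (w(t := p)) (zet (t-1) w)"
        using zeta_recursion(2)[of s t "w(t := p)"] p by (simp add: zeta_upd)
      moreover have "indicator A (w(t := p)) = (indicator A w :: ennreal)"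
        using past[of w p] by (simp only: indicator_def)
      ultimately show "?f (w(t := p)) =
          indicator A w * (indicator {k} (fst p) * indicator C (move s t (w(t := p)) (zet (t-1) w)))"
        by simp
    qed
    also have "\<dots> = indicator A w *
        (\<integral>\<^sup>+p. indicator {k} (fst p) * indicator C (move s t (w(t := p)) (zet (t-1) w)) \<partial>mark_law)"
      by (rule nn_integral_cmult[OF m])
    finally show "(\<integral>\<^sup>+p. ?f (w(t := p)) \<partial>mark_law) =
        indicator A w * ennreal (site_update_prob a b g k (zet (t-1) w) C / CARD('n))"
      unfolding site_step[OF st v C] .
  qed
  finally show ?thesis .
qed

end

lemma sigma_gen_basic: "t \<in> T \<Longrightarrow> A \<in> sets N \<Longrightarrow> X t -` A \<inter> space M \<in> sigma_gen M N X T"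
  unfolding sigma_gen_def by (rule sigma_sets.Basic) blast

lemma sigma_gen_INT:
  assumes "finite J" "J \<noteq> {}" "J \<subseteq> T" "\<And>j. j \<in> J \<Longrightarrow> A j \<in> sets N"
  shows "(\<Inter>j\<in>J. X j -` A j \<inter> space M) \<in> sigma_gen M N X T"
proof -
  interpret sigma_algebra "space M" "sigma_gen M N X T"
    unfolding sigma_gen_def by (rule sigma_algebra_sigma_sets) auto
  show ?thesis
    using assms by (intro countable_INT') (auto intro!: sigma_gen_basic countable_finite)
qed

abbreviation marks :: "(int \<Rightarrow> 'w \<Rightarrow> 'n) \<Rightarrow> (int \<Rightarrow> 'w \<Rightarrow> real) \<Rightarrow> 'w \<Rightarrow> int \<Rightarrow> 'n \<times> real" where
  "marks \<kappa> U \<omega> \<equiv> (\<lambda>t. (\<kappa> t \<omega>, U t \<omega>))"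

lemma driving_measurable:
  assumes "driving_sequences M \<kappa> U"
  shows "prob_space M" "\<kappa> t \<in> measurable M (count_space UNIV)" "U t \<in> borel_measurable M"
proof -
  show "prob_space M" using assms by (simp add: driving_sequences_def)
  then interpret prob_space M .
  show "\<kappa> t \<in> measurable M (count_space UNIV)" "U t \<in> borel_measurable M"
    using assms by (auto simp: driving_sequences_def indep_vars_def)
qed

lemma marks_measurable:
  assumes "driving_sequences M \<kappa> U"
  shows "marks \<kappa> U \<in> measurable M seq_space"
  by (rule measurable_PiM_single') (use driving_measurable[OF assms] in \<open>auto simp: space_pair_measure intro!: measurable_Pair\<close>)

text \<open>
  The pairs \<open>(\<kappa>\<^sub>t, U\<^sub>t)\<close> are independent since the probability of a finite intersection of rectangle events
  factorizes, first into its site part and its uniform part and then over the times; rectangles form an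
  intersection-stable generator.
\<close>
lemma marks_law:
  fixes M :: "'w measure" and \<kappa> :: "int \<Rightarrow> 'w \<Rightarrow> 'n::finite"
  assumes d: "driving_sequences M \<kappa> U"
  shows "distr M seq_space (marks \<kappa> U) = seq_law"
proof -
  interpret prob_space M by (rule driving_measurable[OF d])
  note km = driving_measurable(2)[OF d] and um = driving_measurable(3)[OF d]
  let ?N = "count_space (UNIV :: 'n set) \<Otimes>\<^sub>M (borel :: real measure)"
  let ?E = "{a \<times> b | a b. a \<in> sets (count_space (UNIV::'n set)) \<and> b \<in> sets (borel :: real measure)}"
  have pm: "(\<lambda>\<omega>. (\<kappa> t \<omega>, U t \<omega>)) \<in> measurable M ?N" for t
    using km um by (intro measurable_Pair)
  have indU: "indep_vars (\<lambda>_. borel) U UNIV" and indK: "indep_vars (\<lambda>_. count_space UNIV) \<kappa> UNIV"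
    and ind: "indep_set (sigma_gen M borel U UNIV) (sigma_gen M (count_space UNIV) \<kappa> UNIV)"
    using d by (auto simp: driving_sequences_def)
  have rect: "prob ((\<kappa> t -` A \<inter> space M) \<inter> (U t -` B \<inter> space M)) = prob (\<kappa> t -` A \<inter> space M) * prob (U t -` B \<inter> space M)"
    if "B \<in> sets borel" for t A B
    using indep_setD[OF ind sigma_gen_basic[of t UNIV B borel U M] sigma_gen_basic[of t UNIV A "count_space UNIV" \<kappa> M]] that
    by (simp add: Int_commute mult.commute)
  have law: "distr M ?N (\<lambda>\<omega>. (\<kappa> t \<omega>, U t \<omega>)) = mark_law" for t
  proof -
    interpret K: prob_space "distr M (count_space UNIV) (\<kappa> t)" by (rule prob_space_distr[OF km])
    interpret V: prob_space "distr M borel (U t)" by (rule prob_space_distr[OF um])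
    have "distr M (count_space UNIV) (\<kappa> t) \<Otimes>\<^sub>M distr M borel (U t) = distr M ?N (\<lambda>\<omega>. (\<kappa> t \<omega>, U t \<omega>))"
    proof (rule pair_measure_eqI)
      show "sigma_finite_measure (distr M (count_space UNIV) (\<kappa> t))" "sigma_finite_measure (distr M borel (U t))"
        by unfold_locales
      show "sets (distr M (count_space UNIV) (\<kappa> t) \<Otimes>\<^sub>M distr M borel (U t)) = sets (distr M ?N (\<lambda>\<omega>. (\<kappa> t \<omega>, U t \<omega>)))"
        by (simp only: sets_distr) (rule sets_pair_measure_cong; simp)
      fix A B assume "A \<in> sets (distr M (count_space UNIV) (\<kappa> t))" and "B \<in> sets (distr M borel (U t))"
      then have A: "A \<in> sets (count_space UNIV)" and B: "B \<in> sets borel" by simp_all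
      have "(\<lambda>\<omega>. (\<kappa> t \<omega>, U t \<omega>)) -` (A \<times> B) \<inter> space M = (\<kappa> t -` A \<inter> space M) \<inter> (U t -` B \<inter> space M)"
        by auto
      then show "emeasure (distr M (count_space UNIV) (\<kappa> t)) A * emeasure (distr M borel (U t)) B =
          emeasure (distr M ?N (\<lambda>\<omega>. (\<kappa> t \<omega>, U t \<omega>))) (A \<times> B)"
        using emeasure_distr[OF km A] emeasure_distr[OF um B] emeasure_distr[OF pm pair_measureI[OF A B]] rect[OF B, of t A]
        by (simp add: emeasure_eq_measure ennreal_mult)
    qed
    then show ?thesis
      using d by (simp add: mark_law_def uniform01_def driving_sequences_def)
  qed
  have "indep_vars (\<lambda>_. ?N) (\<lambda>t \<omega>. (\<kappa> t \<omega>, U t \<omega>)) J" if J: "finite J" "J \<noteq> {}" for J :: "int set"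
  proof (subst indep_vars_finite[OF J(2,1), where E="\<lambda>_. ?E"])
    show "\<forall>A\<in>J \<rightarrow> ?E. prob (\<Inter>j\<in>J. (\<lambda>\<omega>. (\<kappa> j \<omega>, U j \<omega>)) -` A j \<inter> space M) =
        (\<Prod>j\<in>J. prob ((\<lambda>\<omega>. (\<kappa> j \<omega>, U j \<omega>)) -` A j \<inter> space M))"
    proof
      fix A assume "A \<in> J \<rightarrow> ?E"
      then have "\<forall>j\<in>J. \<exists>K V. A j = K \<times> V \<and> V \<in> sets borel" by auto
      then obtain K V where KV: "\<And>j. j \<in> J \<Longrightarrow> A j = K j \<times> V j" "\<And>j. j \<in> J \<Longrightarrow> V j \<in> sets borel"
        by metis
      have eq: "(\<lambda>\<omega>. (\<kappa> j \<omega>, U j \<omega>)) -` A j \<inter> space M = (\<kappa> j -` K j \<inter> space M) \<inter> (U j -` V j \<inter> space M)" if "j \<in> J" for j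
        using KV(1)[OF that] by auto
      have "(\<Inter>j\<in>J. (\<lambda>\<omega>. (\<kappa> j \<omega>, U j \<omega>)) -` A j \<inter> space M) =
          (\<Inter>j\<in>J. U j -` V j \<inter> space M) \<inter> (\<Inter>j\<in>J. \<kappa> j -` K j \<inter> space M)"
        using eq by auto
      then have "prob (\<Inter>j\<in>J. (\<lambda>\<omega>. (\<kappa> j \<omega>, U j \<omega>)) -` A j \<inter> space M) =
          prob (\<Inter>j\<in>J. U j -` V j \<inter> space M) * prob (\<Inter>j\<in>J. \<kappa> j -` K j \<inter> space M)"
        using indep_setD[OF ind sigma_gen_INT[OF J, of UNIV V borel U M] sigma_gen_INT[OF J, of UNIV K "count_space UNIV" \<kappa> M]] KV(2)
        by simp
      also have "\<dots> = (\<Prod>j\<in>J. prob (U j -` V j \<inter> space M)) * (\<Prod>j\<in>J. prob (\<kappa> j -` K j \<inter> space M))"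
        using indep_varsD[OF indU J(2,1), of V] indep_varsD[OF indK J(2,1), of K] KV(2) by simp
      also have "\<dots> = (\<Prod>j\<in>J. prob ((\<lambda>\<omega>. (\<kappa> j \<omega>, U j \<omega>)) -` A j \<inter> space M))"
        unfolding prod.distrib[symmetric] using eq rect KV(2) by (intro prod.cong) (simp_all add: mult.commute)
      finally show "prob (\<Inter>j\<in>J. (\<lambda>\<omega>. (\<kappa> j \<omega>, U j \<omega>)) -` A j \<inter> space M) =
        (\<Prod>j\<in>J. prob ((\<lambda>\<omega>. (\<kappa> j \<omega>, U j \<omega>)) -` A j \<inter> space M))" .
    qed
    show "Int_stable ?E" for i by (rule Int_stable_pair_measure_generator)
    show "sets ?N = sigma_sets (space ?N) ?E" for i
      by (simp only: sets_pair_measure space_pair_measure)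
  qed (auto simp: space_pair_measure intro!: pm exI[of _ UNIV])
  then have "indep_vars (\<lambda>_. ?N) (\<lambda>t \<omega>. (\<kappa> t \<omega>, U t \<omega>)) UNIV"
    unfolding indep_vars_def2 using pm
    by (subst indep_sets_finite_index_sets) auto
  then have "distr M (PiM UNIV (\<lambda>_. ?N)) (\<lambda>\<omega>. \<lambda>t\<in>UNIV. (\<kappa> t \<omega>, U t \<omega>)) = PiM UNIV (\<lambda>t. distr M ?N (\<lambda>\<omega>. (\<kappa> t \<omega>, U t \<omega>)))"
    by (subst (asm) indep_vars_iff_distr_eq_PiM) (use pm in simp_all)
  then show ?thesis by (simp add: law seq_law_def restrict_UNIV)
qed

lemma seq_law_shift:
  "distr (seq_law :: (int \<Rightarrow> 'n::finite \<times> real) measure) seq_space (\<lambda>w t. w (t + h)) = seq_law"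
proof -
  let ?P = "PiM (UNIV :: int set) (\<lambda>_. mark_law :: ('n \<times> real) measure)"
  have "distr ?P ?P (\<lambda>w. \<lambda>t\<in>UNIV. w (t + h)) = ?P"
    using distr_PiM_reindex[of UNIV "\<lambda>_. mark_law :: ('n \<times> real) measure" "\<lambda>t::int. t + h" UNIV] prob_space_mark_law
    by (auto simp: inj_on_def)
  then have "distr (seq_law :: (int \<Rightarrow> 'n \<times> real) measure) seq_law (\<lambda>w t. w (t + h)) = seq_law"
    by (simp add: seq_law_def restrict_UNIV)
  moreover have "distr (seq_law :: (int \<Rightarrow> 'n \<times> real) measure) seq_space (\<lambda>w t. w (t + h)) =
      distr seq_law seq_law (\<lambda>w t. w (t + h))"
    by (rule distr_cong) simp_all
  ultimately show ?thesis by (simp only:)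
qed

text \<open>
  Being the preimage of a measurable set that is invariant under \<open>\<phi>\<close> passes to generated
  \<open>\<sigma>\<close>-fields. With \<open>\<phi>\<close> overwriting the mark at time \<open>t\<close>, this describes the events of the past.
\<close>
lemma past_event_lift:
  assumes basic: "\<And>B. B \<in> G \<Longrightarrow> \<exists>B'\<in>sets N. B = W -` B' \<inter> space M \<and> (\<forall>w p. \<phi> w p \<in> B' \<longleftrightarrow> w \<in> B')"
    and W: "W \<in> measurable M N" and \<phi>: "\<And>w p. \<phi> w p \<in> space N \<longleftrightarrow> w \<in> space N"
    and A: "A \<in> sigma_sets (space M) G"
  shows "\<exists>A'\<in>sets N. A = W -` A' \<inter> space M \<and> (\<forall>w p. \<phi> w p \<in> A' \<longleftrightarrow> w \<in> A')"
  using A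
proof induction
  case (Basic B)
  then show ?case by (rule basic)
next
  case Empty
  then show ?case by (intro bexI[of _ "{}"]) auto
next
  case (Compl A)
  then obtain A' where "A' \<in> sets N" "A = W -` A' \<inter> space M" "\<forall>w p. \<phi> w p \<in> A' \<longleftrightarrow> w \<in> A'" by blast
  then show ?case using \<phi> measurable_space[OF W] by (intro bexI[of _ "space N - A'"]) auto
next
  case (Union A)
  then obtain A' where "\<And>i. A' i \<in> sets N" "\<And>i. A i = W -` A' i \<inter> space M" "\<And>i. \<forall>w p. \<phi> w p \<in> A' i \<longleftrightarrow> w \<in> A' i" by metis
  then show ?case by (intro bexI[of _ "\<Union>i::nat. A' i"]) auto
qed

theorem theorem3p1:
  fixes a b :: "real^'n" and g :: "real^'n \<Rightarrow> real"
    and M :: "'w measure" and \<kappa> :: "int \<Rightarrow> 'w \<Rightarrow> 'n" and U :: "int \<Rightarrow> 'w \<Rightarrow> real"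
  assumes "CARD('n) \<ge> 2"
    and "density_on_box a b g"
    and "conditionals_ok a b g"
    and "driving_sequences M \<kappa> U"
    and "\<forall>t. AE \<omega> in M. tau a b g \<kappa> U t \<omega> > Minf"
  shows "stationary M (zeta a b g \<kappa> U) \<and> gibbs_sampler a b g M \<kappa> (zeta a b g \<kappa> U) \<and>
    (\<forall>t. distributed M lborel (zeta a b g \<kappa> U t) (\<lambda>x. ennreal (g x))) \<and>
    (\<forall>\<mu>. gibbs_invariant a b g \<mu> \<longleftrightarrow> \<mu> = density lborel (\<lambda>x. ennreal (g x))) \<and>
    (\<forall>s t. s \<le> t \<longrightarrow>
      (SUP z\<in>cbox a b. measure M {\<omega> \<in> space M. zeta_from a b g \<kappa> U z s t \<omega> \<noteq> zeta a b g \<kappa> U t \<omega>})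
      \<le> measure M {\<omega> \<in> space M. tau a b g \<kappa> U t \<omega> < Fin s})"
proof -
  note d = assms(4)
  interpret gibbs_canonical a b g
    by unfold_locales (use assms in simp_all)
  interpret D: gibbs_driven a b g \<kappa> U by unfold_locales
  interpret prob_space M by (rule driving_measurable[OF d])
  let ?W = "marks \<kappa> U" and ?\<zeta> = "zeta a b g \<kappa> U"
  note km = driving_measurable(2)[OF d] and W = marks_measurable[OF d] and Wlaw = marks_law[OF d]
  have sp: "?W \<omega> \<in> space seq_space" for \<omega> by (simp add: space_seq_space)
  have zW: "?\<zeta> (t + h) \<omega> = zet t (\<lambda>i. ?W \<omega> (i + h))" for t h \<omega>
    using zeta_cong[of \<kappa> \<omega> "\<lambda>t w. fst (w t)" "-h" "\<lambda>i. ?W \<omega> (i + h)" U "\<lambda>t w. snd (w t)" "t + h"] by simp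
  have zW0: "?\<zeta> t \<omega> = zet t (?W \<omega>)" for t \<omega>
    using zW[of t 0 \<omega>] by simp
  have cW: "coupled a b g \<kappa> U s t \<omega> \<longleftrightarrow> cpl s t (?W \<omega>)" for s t \<omega>
    using coupled_cong[of \<kappa> \<omega> "\<lambda>t w. fst (w t)" 0 "?W \<omega>" U "\<lambda>t w. snd (w t)" s t] by simp
  have \<zeta>m: "?\<zeta> t \<in> borel_measurable M" for t
    unfolding zW0[abs_def] by (rule measurable_compose[OF W zeta_measurable])
  have coup: "AE w in seq_law. \<exists>s. cpl s t w" for t
  proof -
    have "{w \<in> space seq_space. \<exists>s. cpl s t w} \<in> sets seq_space"
      by (rule predE) (intro pred_intros_countable coupled_measurable)
    moreover have "AE \<omega> in M. \<exists>s. cpl s t (?W \<omega>)"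
      using assms(5)[rule_format, of t] unfolding D.tau_greater_iff cW .
    ultimately have "AE w in distr M seq_space ?W. \<exists>s. cpl s t w"
      by (subst AE_distr_iff[OF W])
    then show ?thesis by (simp only: Wlaw)
  qed
  have U01: "AE \<omega> in M. \<forall>t. 0 < U t \<omega> \<and> U t \<omega> \<le> 1"
  proof -
    have "AE w in distr M seq_space ?W. \<forall>t. 0 < snd (w t) \<and> snd (w t) \<le> 1"
      unfolding Wlaw by (rule AE_seq_law)
    from AE_distrD[OF W this] show ?thesis by simp
  qed

  \<comment> \<open>the density \<open>g\<close> is invariant and every invariant law is that of \<open>\<zeta>\<^sub>0\<close>\<close>
  have unique: "gibbs_invariant a b g \<mu> \<longleftrightarrow> \<mu> = target" for \<mu>
    using invariant_unique[OF _ coup[of 0]] target_invariant by metis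
  have zlaw: "distr M borel (?\<zeta> t) = target" for t
  proof -
    have "distr M borel (?\<zeta> t) = distr (distr M seq_space ?W) borel (zet t)"
      unfolding zW0[abs_def] by (subst distr_distr[OF zeta_measurable W]) (simp add: comp_def)
    also have "\<dots> = target"
      using invariant_unique[OF target_invariant coup[of t]] by (simp add: Wlaw)
    finally show ?thesis .
  qed
  have "distributed M lborel (?\<zeta> t) (\<lambda>x. ennreal (g x))" for t
  proof -
    have "distr M lborel (?\<zeta> t) = distr M borel (?\<zeta> t)" by (rule distr_cong) simp_all
    then show ?thesis unfolding distributed_def using zlaw \<zeta>m by simp
  qed
  moreover have "stationary M ?\<zeta>"
  proof -
    let ?B = "PiM UNIV (\<lambda>_. borel) :: (int \<Rightarrow> real^'n) measure"
    let ?F = "\<lambda>w t. zet t w"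
    have F: "?F \<in> measurable seq_space ?B"
      by (rule measurable_PiM_single') (simp_all add: zeta_measurable)
    have law: "distr M ?B (\<lambda>\<omega> t. ?\<zeta> (t + h) \<omega>) = distr seq_law ?B ?F" for h
    proof -
      have S: "(\<lambda>w t. w (t + h)) \<in> measurable seq_space seq_space"
        by (rule measurable_PiM_single') (simp_all add: space_pair_measure)
      have "distr M ?B (\<lambda>\<omega> t. ?\<zeta> (t + h) \<omega>) = distr M ?B (?F \<circ> ((\<lambda>w t. w (t + h)) \<circ> ?W))"
        by (simp add: zW comp_def)
      also have "\<dots> = distr (distr (distr M seq_space ?W) seq_space (\<lambda>w t. w (t + h))) ?B ?F"
        by (simp only: distr_distr[OF S W] distr_distr[OF F measurable_comp[OF W S]])
      also have "\<dots> = distr seq_law ?B ?F"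
        by (simp only: Wlaw seq_law_shift)
      finally show ?thesis .
    qed
    show ?thesis unfolding stationary_def using law[of 0] by (simp add: law)
  qed
  moreover have "gibbs_sampler a b g M \<kappa> ?\<zeta>"
    unfolding gibbs_sampler_def
  proof (intro conjI allI ballI)
    fix t k C A
    assume C: "C \<in> sets (borel :: (real^'n) measure)"
      and A: "A \<in> sigma_sets (space M) (sigma_gen M (count_space UNIV) \<kappa> {..t-1} \<union> sigma_gen M borel ?\<zeta> {..t-1})"
    \<comment> \<open>the past \<open>\<sigma>\<close>-field is generated by two \<open>\<sigma>\<close>-fields, so the lifting is applied to each of them and then once more\<close>
    have lift: "\<exists>B'\<in>sets seq_space. B = ?W -` B' \<inter> space M \<and> (\<forall>w p. w(t := p) \<in> B' \<longleftrightarrow> w \<in> B')"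
      if "B \<in> sigma_gen M (count_space UNIV) \<kappa> {..t-1} \<union> sigma_gen M borel ?\<zeta> {..t-1}" for B
      using that
    proof
      assume "B \<in> sigma_gen M (count_space UNIV) \<kappa> {..t-1}"
      then show ?thesis unfolding sigma_gen_def
      proof (rule past_event_lift[OF _ W, rotated -1])
        fix B assume "B \<in> {\<kappa> r -` Q \<inter> space M |r Q. r \<in> {..t-1} \<and> Q \<in> sets (count_space UNIV)}"
        then obtain r Q where B: "B = \<kappa> r -` Q \<inter> space M" "r \<le> t - 1" by auto
        have "(\<lambda>w. fst (w r)) -` Q \<inter> space seq_space \<in> sets seq_space"
          by (rule measurable_sets[OF site_measurable]) simp
        then show "\<exists>B'\<in>sets seq_space. B = ?W -` B' \<inter> space M \<and> (\<forall>w p. w(t := p) \<in> B' \<longleftrightarrow> w \<in> B')"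
          using B by (intro bexI[of _ "(\<lambda>w. fst (w r)) -` Q \<inter> space seq_space"]) (auto simp: space_seq_space)
      qed (simp add: space_seq_space)
    next
      assume "B \<in> sigma_gen M borel ?\<zeta> {..t-1}"
      then show ?thesis unfolding sigma_gen_def
      proof (rule past_event_lift[OF _ W, rotated -1])
        fix B assume "B \<in> {?\<zeta> r -` Q \<inter> space M |r Q. r \<in> {..t-1} \<and> Q \<in> sets borel}"
        then obtain r Q where B: "B = ?\<zeta> r -` Q \<inter> space M" "r \<le> t - 1" "Q \<in> sets borel" by auto
        have "zet r -` Q \<inter> space seq_space \<in> sets seq_space"
          by (rule measurable_sets[OF zeta_measurable B(3)])
        then show "\<exists>B'\<in>sets seq_space. B = ?W -` B' \<inter> space M \<and> (\<forall>w p. w(t := p) \<in> B' \<longleftrightarrow> w \<in> B')"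
          using B by (intro bexI[of _ "zet r -` Q \<inter> space seq_space"]) (auto simp: space_seq_space zW0 zeta_upd)
      qed (simp add: space_seq_space)
    qed
    have "\<exists>A'\<in>sets seq_space. A = ?W -` A' \<inter> space M \<and> (\<forall>w p. w(t := p) \<in> A' \<longleftrightarrow> w \<in> A')"
      by (rule past_event_lift[OF lift W _ A]) (simp_all add: space_seq_space)
    then obtain A' where A': "A' \<in> sets seq_space" "A = ?W -` A' \<inter> space M" "\<And>w p. w(t := p) \<in> A' \<longleftrightarrow> w \<in> A'"
      by blast
    let ?q = "\<lambda>v. site_update_prob a b g k v C / CARD('n)"
    have q: "0 \<le> ?q (?\<zeta> (t-1) \<omega>)" for \<omega>
      using ennreal_site_update_prob(2)[OF D.zeta_in_state C] by simp
    have qm: "?q \<in> borel_measurable borel"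
      using C by measurable
    have E: "A' \<inter> {w. fst (w t) = k \<and> zet t w \<in> C} \<in> sets seq_space"
    proof -
      have "A' \<inter> {w. fst (w t) = k \<and> zet t w \<in> C} =
          A' \<inter> ((\<lambda>w. fst (w t)) -` {k} \<inter> space seq_space) \<inter> (zet t -` C \<inter> space seq_space)"
        by (auto simp: space_seq_space)
      then show ?thesis
        using A'(1) measurable_sets[OF site_measurable[of t], of "{k}"] measurable_sets[OF zeta_measurable[of t] C]
        by simp
    qed
    have "emeasure M (A \<inter> {\<omega> \<in> space M. \<kappa> t \<omega> = k \<and> ?\<zeta> t \<omega> \<in> C}) =
        emeasure M (?W -` (A' \<inter> {w. fst (w t) = k \<and> zet t w \<in> C}) \<inter> space M)"
      unfolding A'(2) by (rule arg_cong[where f="emeasure M"]) (auto simp: zW0)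
    also have "\<dots> = emeasure seq_law (A' \<inter> {w. fst (w t) = k \<and> zet t w \<in> C})"
      unfolding Wlaw[symmetric] by (rule emeasure_distr[OF W E, symmetric])
    also have "\<dots> = (\<integral>\<^sup>+w. indicator A' w * ennreal (?q (zet (t-1) w)) \<partial>seq_law)"
      by (rule zeta_gibbs_step[OF coup A'(1,3) C])
    also have "\<dots> = (\<integral>\<^sup>+\<omega>. indicator A' (?W \<omega>) * ennreal (?q (zet (t-1) (?W \<omega>))) \<partial>M)"
    proof -
      have "(\<lambda>w. indicator A' w * ennreal (?q (zet (t-1) w))) \<in> borel_measurable seq_space"
        by (intro borel_measurable_times_ennreal borel_measurable_indicator A'
            measurable_compose[OF measurable_compose[OF zeta_measurable qm] measurable_ennreal])
      then have "(\<lambda>w. indicator A' w * ennreal (?q (zet (t-1) w))) \<in> borel_measurable (distr M seq_space ?W)"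
        by (simp only: measurable_distr_eq1)
      from nn_integral_distr[OF W this] show ?thesis by (simp only: Wlaw)
    qed
    also have "\<dots> = (\<integral>\<^sup>+\<omega>. ennreal (indicator A \<omega> * ?q (?\<zeta> (t-1) \<omega>)) \<partial>M)"
      by (intro nn_integral_cong) (auto simp: A'(2) zW0 indicator_def)
    finally have em: "emeasure M (A \<inter> {\<omega> \<in> space M. \<kappa> t \<omega> = k \<and> ?\<zeta> t \<omega> \<in> C}) =
        (\<integral>\<^sup>+\<omega>. ennreal (indicator A \<omega> * ?q (?\<zeta> (t-1) \<omega>)) \<partial>M)" .
    have AM: "A \<in> sets M" unfolding A'(2) by (rule measurable_sets[OF W A'(1)])
    have "(\<integral>\<omega>. indicator A \<omega> * ?q (?\<zeta> (t-1) \<omega>) \<partial>M) =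
        enn2real (\<integral>\<^sup>+\<omega>. ennreal (indicator A \<omega> * ?q (?\<zeta> (t-1) \<omega>)) \<partial>M)"
    proof (rule integral_eq_nn_integral)
      show "(\<lambda>\<omega>. indicator A \<omega> * ?q (?\<zeta> (t-1) \<omega>)) \<in> borel_measurable M"
        by (intro borel_measurable_times borel_measurable_indicator AM measurable_compose[OF \<zeta>m qm])
      show "AE \<omega> in M. 0 \<le> indicator A \<omega> * ?q (?\<zeta> (t-1) \<omega>)"
        by (intro AE_I2 mult_nonneg_nonneg q) simp
    qed
    then show "measure M (A \<inter> {\<omega> \<in> space M. \<kappa> t \<omega> = k \<and> ?\<zeta> t \<omega> \<in> C}) =
        (\<integral>\<omega>. indicator A \<omega> * ?q (?\<zeta> (t-1) \<omega>) \<partial>M)"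
      by (simp only: measure_def em)
  qed (use \<zeta>m km D.zeta_in_state in auto)
  moreover have "(SUP z\<in>cbox a b. measure M {\<omega> \<in> space M. zeta_from a b g \<kappa> U z s t \<omega> \<noteq> ?\<zeta> t \<omega>})
      \<le> measure M {\<omega> \<in> space M. tau a b g \<kappa> U t \<omega> < Fin s}" if "s \<le> t" for s t
  proof (rule cSUP_least)
    show "cbox a b \<noteq> {}" using D.zeta_in_state by blast
    fix z assume z: "z \<in> cbox a b"
    show "measure M {\<omega> \<in> space M. zeta_from a b g \<kappa> U z s t \<omega> \<noteq> ?\<zeta> t \<omega>}
        \<le> measure M {\<omega> \<in> space M. tau a b g \<kappa> U t \<omega> < Fin s}"
    proof (rule finite_measure_mono_AE)
      show "AE \<omega> in M. \<omega> \<in> {\<omega> \<in> space M. zeta_from a b g \<kappa> U z s t \<omega> \<noteq> ?\<zeta> t \<omega>} \<longrightarrow>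
          \<omega> \<in> {\<omega> \<in> space M. tau a b g \<kappa> U t \<omega> < Fin s}"
        using U01
      proof eventually_elim
        case (elim \<omega>)
        then have "zeta_from a b g \<kappa> U z s t \<omega> \<in> box_of (eta a b g \<kappa> U s t \<omega>)"
          by (intro D.zeta_from_in_eta z that) auto
        then show ?case
          using D.coupled_box D.zeta_coupled by (fastforce simp: D.tau_less_iff)
      qed
      have "{\<omega> \<in> space M. tau a b g \<kappa> U t \<omega> < Fin s} = ?W -` {w. \<not> cpl s t w} \<inter> space M"
        by (auto simp: D.tau_less_iff cW)
      also have "\<dots> \<in> sets M"
        by (rule measurable_sets[OF W]) (use uncoupled_sets in simp)
      finally show "{\<omega> \<in> space M. tau a b g \<kappa> U t \<omega> < Fin s} \<in> sets M" .
    qed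
  qed
  ultimately show ?thesis using unique by blast
qed

end
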